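(* Let $\lambda$ be an infinite regular cardinal, let $\mathcal{R}$ be a small additive category with $\lambda$-small products, let $\mathcal{M}$ be the category of left $\mathcal{R}$-modules, and let $\mathcal{N}$ be the full subcategory of $\mathcal{M}$ consisting of those left $\mathcal{R}$-modules which preserve $\lambda$-small products. Then $$\mathrm{fun}_\lambda(\mathcal{N})=\{F|_{\mathcal{N}}\ :\ F\in\mathrm{fun}(\mathcal{M})\}$$ (up to isomorphism of functors); that is, the functors $\mathcal{N}\to\mathrm{Ab}$ which preserve $\lambda$-directed colimits and products are, up to isomorphism, exactly the restrictions to $\mathcal{N}$ of the functors $\mathcal{M}\to\mathrm{Ab}$ which preserve directed colimits and products. Equivalently, for each $F\in\mathrm{fun}_\lambda(\mathcal{N})$ there is a pp-pair $\phi/\psi$ for left $\mathcal{R}$-modules such that $F\simeq F_{\phi/\psi}|_{\mathcal{N}}$.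
   Context: A left $\mathcal{R}$-module is an additive functor $\mathcal{R}\to\mathrm{Ab}$. $\mathrm{fun}_\lambda(\mathcal{N})$ is the category of functors $\mathcal{N}\to\mathrm{Ab}$ preserving $\lambda$-directed colimits and products; $\mathrm{fun}(\mathcal{M})$ is the category of functors $\mathcal{M}\to\mathrm{Ab}$ preserving directed colimits and products. A $\lambda$-small product is one indexed by a set of cardinality $<\lambda$. For a left $\mathcal{R}$-module $M$ and an object $k\in\mathcal{R}$ write $M^k=M(k)$, and for $A:m\to n$ in $\mathcal{R}$ and $x\in M^m$ write $Ax=M(A)(x)$. For an object $n\in\mathcal{R}$, a *pp-$n$-formula* $\phi$ for left $\mathcal{R}$-modules is a cospan $n\xrightarrow{A}m\xleftarrow{B}l$ in $\mathcal{R}$; its solution set in $M$ is $F_\phi M=\{x\in M^n : Ax=By\text{ for some }y\in M^l\}$, which defines a functor $F_\phi:\mathcal{M}\to\mathrm{Ab}$. If $\phi,\psi$ are pp-$n$-formulas with $F_\psi$ a subfunctor of $F_\phi$, then $\phi/\psi$ is called a *pp-pair* (pp-$n$-pair), and $F_{\phi/\psi}=F_\phi/F_\psi:\mathcal{M}\to\mathrm{Ab}$. *)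

theory Defs
  imports "HOL-Algebra.Coset" "HOL-Algebra.Weak_Morphisms"
begin

unbundle cardinal_syntax

section \<open>Size\<close>

text \<open>
  Smallness is relative to a Grothendieck universe, given by a type \<open>'u\<close> of strongly inaccessible
  cardinality: a set is small if its cardinality is strictly below that of \<open>'u\<close>. Small groups,
  small index sets and small posets all have isomorphic copies supported on small subsets of \<open>'u\<close>,
  so only those are used below.
\<close>

definition inaccessible :: "'u rel \<Rightarrow> bool" where
  "inaccessible k \<longleftrightarrow> Card_order k \<and> natLeq <o k \<and> regularCard k \<and>
     (\<forall>A :: 'u set. |A| <o k \<longrightarrow> |Pow A| <o k)"

section \<open>Categories\<close>

record ('o, 'a) precat =
  Obj :: "'o set"
  Arr :: "'a set"
  Dom :: "'a \<Rightarrow> 'o"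
  Cod :: "'a \<Rightarrow> 'o"
  Ident :: "'o \<Rightarrow> 'a"
  Comp :: "'a \<Rightarrow> 'a \<Rightarrow> 'a"  \<comment> \<open>\<open>Comp C g f\<close> is \<open>g\<close> after \<open>f\<close>\<close>

definition Hom :: "('o, 'a, 'z) precat_scheme \<Rightarrow> 'o \<Rightarrow> 'o \<Rightarrow> 'a set" where
  "Hom C a b = {f \<in> Arr C. Dom C f = a \<and> Cod C f = b}"

locale category =
  fixes C :: "('o, 'a, 'z) precat_scheme"
  assumes Dom_closed: "f \<in> Arr C \<Longrightarrow> Dom C f \<in> Obj C"
    and Cod_closed: "f \<in> Arr C \<Longrightarrow> Cod C f \<in> Obj C"
    and Ident_closed: "a \<in> Obj C \<Longrightarrow> Ident C a \<in> Hom C a a"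
    and Comp_closed: "\<lbrakk>f \<in> Hom C a b; g \<in> Hom C b c\<rbrakk> \<Longrightarrow> Comp C g f \<in> Hom C a c"
    and Comp_Ident: "f \<in> Hom C a b \<Longrightarrow> Comp C f (Ident C a) = f"
    and Ident_Comp: "f \<in> Hom C a b \<Longrightarrow> Comp C (Ident C b) f = f"
    and Comp_assoc: "\<lbrakk>f \<in> Hom C a b; g \<in> Hom C b c; h \<in> Hom C c d\<rbrakk>
          \<Longrightarrow> Comp C h (Comp C g f) = Comp C (Comp C h g) f"

definition is_iso :: "('o, 'a, 'z) precat_scheme \<Rightarrow> 'o \<Rightarrow> 'o \<Rightarrow> 'a \<Rightarrow> bool" where
  "is_iso C a b f \<longleftrightarrow> f \<in> Hom C a b \<and>
     (\<exists>g \<in> Hom C b a. Comp C g f = Ident C a \<and> Comp C f g = Ident C b)"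

definition full_subcat ::
  "('o, 'a, 'z) precat_scheme \<Rightarrow> ('o \<Rightarrow> bool) \<Rightarrow> ('o, 'a, 'z) precat_scheme" where
  "full_subcat C P = C\<lparr>Obj := {a \<in> Obj C. P a}, Arr := {f \<in> Arr C. P (Dom C f) \<and> P (Cod C f)}\<rparr>"

text \<open>The group structure on hom-sets is written multiplicatively, as in HOL-Algebra's
  \<^const>\<open>comm_group\<close>.\<close>

record ('o, 'a) additive_precat = "('o, 'a) precat" +
  HomGrp :: "'o \<Rightarrow> 'o \<Rightarrow> 'a monoid"

locale preadditive_category = category C
  for C :: "('o, 'a, 'z) additive_precat_scheme" +
  assumes HomGrp_comm_group: "\<lbrakk>a \<in> Obj C; b \<in> Obj C\<rbrakk> \<Longrightarrow> comm_group (HomGrp C a b)"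
    and HomGrp_carrier: "\<lbrakk>a \<in> Obj C; b \<in> Obj C\<rbrakk> \<Longrightarrow> carrier (HomGrp C a b) = Hom C a b"
    and Comp_add_left: "\<lbrakk>f \<in> Hom C a b; g \<in> Hom C b c; g' \<in> Hom C b c\<rbrakk> \<Longrightarrow>
          Comp C (g \<otimes>\<^bsub>HomGrp C b c\<^esub> g') f = Comp C g f \<otimes>\<^bsub>HomGrp C a c\<^esub> Comp C g' f"
    and Comp_add_right: "\<lbrakk>f \<in> Hom C a b; f' \<in> Hom C a b; g \<in> Hom C b c\<rbrakk> \<Longrightarrow>
          Comp C g (f \<otimes>\<^bsub>HomGrp C a b\<^esub> f') = Comp C g f \<otimes>\<^bsub>HomGrp C a c\<^esub> Comp C g f'"

definition is_zero_object :: "('o, 'a, 'z) precat_scheme \<Rightarrow> 'o \<Rightarrow> bool" where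
  "is_zero_object C z \<longleftrightarrow> z \<in> Obj C \<and>
     (\<forall>a \<in> Obj C. (\<exists>!f. f \<in> Hom C a z) \<and> (\<exists>!f. f \<in> Hom C z a))"

definition is_biproduct ::
  "('o, 'a, 'z) additive_precat_scheme \<Rightarrow> 'o \<Rightarrow> 'o \<Rightarrow> 'o \<Rightarrow> 'a \<Rightarrow> 'a \<Rightarrow> 'a \<Rightarrow> 'a \<Rightarrow> bool" where
  "is_biproduct C a b s i j p q \<longleftrightarrow> s \<in> Obj C \<and>
     i \<in> Hom C a s \<and> j \<in> Hom C b s \<and> p \<in> Hom C s a \<and> q \<in> Hom C s b \<and>
     Comp C p i = Ident C a \<and> Comp C q j = Ident C b \<and>
     Comp C q i = \<one>\<^bsub>HomGrp C a b\<^esub> \<and> Comp C p j = \<one>\<^bsub>HomGrp C b a\<^esub> \<and>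
     Comp C i p \<otimes>\<^bsub>HomGrp C s s\<^esub> Comp C j q = Ident C s"

locale additive_category = preadditive_category C
  for C :: "('o, 'a, 'z) additive_precat_scheme" +
  assumes ex_zero_object: "\<exists>z. is_zero_object C z"
    and ex_biproduct: "\<lbrakk>a \<in> Obj C; b \<in> Obj C\<rbrakk> \<Longrightarrow> \<exists>s i j p q. is_biproduct C a b s i j p q"

section \<open>Functors\<close>

record ('o, 'a, 'p, 'b) fctr =
  ObjMap :: "'o \<Rightarrow> 'p"
  ArrMap :: "'a \<Rightarrow> 'b"

definition is_functor ::
  "('o, 'a, 'y) precat_scheme \<Rightarrow> ('p, 'b, 'z) precat_scheme \<Rightarrow> ('o, 'a, 'p, 'b) fctr \<Rightarrow> bool" where
  "is_functor C D F \<longleftrightarrow>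
     (\<forall>a \<in> Obj C. ObjMap F a \<in> Obj D) \<and>
     (\<forall>a \<in> Obj C. \<forall>b \<in> Obj C. \<forall>f \<in> Hom C a b. ArrMap F f \<in> Hom D (ObjMap F a) (ObjMap F b)) \<and>
     (\<forall>a \<in> Obj C. ArrMap F (Ident C a) = Ident D (ObjMap F a)) \<and>
     (\<forall>a \<in> Obj C. \<forall>b \<in> Obj C. \<forall>c \<in> Obj C. \<forall>f \<in> Hom C a b. \<forall>g \<in> Hom C b c.
        ArrMap F (Comp C g f) = Comp D (ArrMap F g) (ArrMap F f))"

definition is_additive_functor ::
  "('o, 'a, 'y) additive_precat_scheme \<Rightarrow> ('p, 'b, 'z) additive_precat_scheme \<Rightarrow>
     ('o, 'a, 'p, 'b) fctr \<Rightarrow> bool" where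
  "is_additive_functor C D F \<longleftrightarrow> is_functor C D F \<and>
     (\<forall>a \<in> Obj C. \<forall>b \<in> Obj C.
        ArrMap F \<in> hom (HomGrp C a b) (HomGrp D (ObjMap F a) (ObjMap F b)))"

definition nat_trans ::
  "('o, 'a, 'y) precat_scheme \<Rightarrow> ('p, 'b, 'z) precat_scheme \<Rightarrow>
     ('o, 'a, 'p, 'b) fctr \<Rightarrow> ('o, 'a, 'p, 'b) fctr \<Rightarrow> ('o \<Rightarrow> 'b) \<Rightarrow> bool" where
  "nat_trans C D F G t \<longleftrightarrow>
     (\<forall>a \<in> Obj C. t a \<in> Hom D (ObjMap F a) (ObjMap G a)) \<and>
     (\<forall>a \<in> Obj C. \<forall>b \<in> Obj C. \<forall>f \<in> Hom C a b.
        Comp D (t b) (ArrMap F f) = Comp D (ArrMap G f) (t a))"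

definition nat_isomorphic ::
  "('o, 'a, 'y) precat_scheme \<Rightarrow> ('p, 'b, 'z) precat_scheme \<Rightarrow>
     ('o, 'a, 'p, 'b) fctr \<Rightarrow> ('o, 'a, 'p, 'b) fctr \<Rightarrow> bool" where
  "nat_isomorphic C D F G \<longleftrightarrow>
     (\<exists>t. nat_trans C D F G t \<and> (\<forall>a \<in> Obj C. is_iso D (ObjMap F a) (ObjMap G a) (t a)))"

definition restrict_functor ::
  "('o, 'a, 'p, 'b) fctr \<Rightarrow> ('o, 'a, 'y) precat_scheme \<Rightarrow> ('o, 'a, 'p, 'b) fctr" where
  "restrict_functor F C = \<lparr>ObjMap = restrict (ObjMap F) (Obj C), ArrMap = restrict (ArrMap F) (Arr C)\<rparr>"

datatype ('x, 't) arrow = Arrow (src: 'x) (tgt: 'x) (amap: 't)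

text \<open>Components of natural transformations (and, below, underlying maps of group homomorphisms)
  are required to be extensional, so that equality of arrows is equality of functions on the
  relevant domain.\<close>

definition functor_cat ::
  "('o, 'a, 'y) precat_scheme \<Rightarrow> ('p, 'b, 'z) precat_scheme \<Rightarrow>
     (('o, 'a, 'p, 'b) fctr, (('o, 'a, 'p, 'b) fctr, 'o \<Rightarrow> 'b) arrow) precat" where
  "functor_cat C D =
    \<lparr>Obj = {F. is_functor C D F},
     Arr = {t. is_functor C D (src t) \<and> is_functor C D (tgt t) \<and>
               nat_trans C D (src t) (tgt t) (amap t) \<and> amap t \<in> extensional (Obj C)},
     Dom = src,
     Cod = tgt,
     Ident = (\<lambda>F. Arrow F F (\<lambda>a \<in> Obj C. Ident D (ObjMap F a))),
     Comp = (\<lambda>s t. Arrow (src t) (tgt s) (\<lambda>a \<in> Obj C. Comp D (amap s a) (amap t a)))\<rparr>"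

section \<open>Products and directed colimits\<close>

definition is_product ::
  "('o, 'a, 'z) precat_scheme \<Rightarrow> 'i set \<Rightarrow> ('i \<Rightarrow> 'o) \<Rightarrow> 'o \<Rightarrow> ('i \<Rightarrow> 'a) \<Rightarrow> bool" where
  "is_product C I X p \<pi> \<longleftrightarrow> p \<in> Obj C \<and> (\<forall>i \<in> I. \<pi> i \<in> Hom C p (X i)) \<and>
     (\<forall>q \<in> Obj C. \<forall>f. (\<forall>i \<in> I. f i \<in> Hom C q (X i)) \<longrightarrow>
        (\<exists>!h. h \<in> Hom C q p \<and> (\<forall>i \<in> I. Comp C (\<pi> i) h = f i)))"

text \<open>In the next two definitions the products are those indexed by sets of cardinality \<open>< k\<close>.
  Since \<open>k\<close> is a cardinal on \<open>'u\<close>, every such set is in bijection with a subset of \<open>'u\<close>.\<close>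

definition has_products :: "'u rel \<Rightarrow> ('o, 'a, 'z) precat_scheme \<Rightarrow> bool" where
  "has_products k C \<longleftrightarrow> (\<forall>(I :: 'u set) X. |I| <o k \<longrightarrow> (\<forall>i \<in> I. X i \<in> Obj C) \<longrightarrow>
     (\<exists>p \<pi>. is_product C I X p \<pi>))"

definition preserves_products ::
  "'u rel \<Rightarrow> ('o, 'a, 'y) precat_scheme \<Rightarrow> ('p, 'b, 'z) precat_scheme \<Rightarrow>
     ('o, 'a, 'p, 'b) fctr \<Rightarrow> bool" where
  "preserves_products k C D F \<longleftrightarrow>
     (\<forall>(I :: 'u set) X p \<pi>. |I| <o k \<longrightarrow> (\<forall>i \<in> I. X i \<in> Obj C) \<longrightarrow> is_product C I X p \<pi> \<longrightarrow>
        is_product D I (\<lambda>i. ObjMap F (X i)) (ObjMap F p) (\<lambda>i. ArrMap F (\<pi> i)))"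

text \<open>\<open>m\<close>-directed: every subset of cardinality \<open>< m\<close> has an upper bound. For \<open>m = natLeq\<close>
  (the cardinal of the natural numbers) this is ordinary directedness, including nonemptiness.\<close>

definition directed_poset :: "'m rel \<Rightarrow> 'i set \<Rightarrow> 'i rel \<Rightarrow> bool" where
  "directed_poset m I r \<longleftrightarrow> partial_order_on I r \<and>
     (\<forall>S. S \<subseteq> I \<longrightarrow> |S| <o m \<longrightarrow> (\<exists>u \<in> I. \<forall>s \<in> S. (s, u) \<in> r))"

definition poset_diagram ::
  "('o, 'a, 'z) precat_scheme \<Rightarrow> 'i set \<Rightarrow> 'i rel \<Rightarrow> ('i \<Rightarrow> 'o) \<Rightarrow> ('i \<Rightarrow> 'i \<Rightarrow> 'a) \<Rightarrow> bool" where
  "poset_diagram C I r X T \<longleftrightarrow> (\<forall>i \<in> I. X i \<in> Obj C) \<and>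
     (\<forall>(i, j) \<in> r. T i j \<in> Hom C (X i) (X j)) \<and>
     (\<forall>i \<in> I. T i i = Ident C (X i)) \<and>
     (\<forall>i j k. (i, j) \<in> r \<longrightarrow> (j, k) \<in> r \<longrightarrow> T i k = Comp C (T j k) (T i j))"

definition is_cocone ::
  "('o, 'a, 'z) precat_scheme \<Rightarrow> 'i set \<Rightarrow> 'i rel \<Rightarrow> ('i \<Rightarrow> 'o) \<Rightarrow> ('i \<Rightarrow> 'i \<Rightarrow> 'a) \<Rightarrow>
     'o \<Rightarrow> ('i \<Rightarrow> 'a) \<Rightarrow> bool" where
  "is_cocone C I r X T l c \<longleftrightarrow> l \<in> Obj C \<and> (\<forall>i \<in> I. c i \<in> Hom C (X i) l) \<and>
     (\<forall>(i, j) \<in> r. Comp C (c j) (T i j) = c i)"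

definition is_colimit ::
  "('o, 'a, 'z) precat_scheme \<Rightarrow> 'i set \<Rightarrow> 'i rel \<Rightarrow> ('i \<Rightarrow> 'o) \<Rightarrow> ('i \<Rightarrow> 'i \<Rightarrow> 'a) \<Rightarrow>
     'o \<Rightarrow> ('i \<Rightarrow> 'a) \<Rightarrow> bool" where
  "is_colimit C I r X T l c \<longleftrightarrow> is_cocone C I r X T l c \<and>
     (\<forall>q d. is_cocone C I r X T q d \<longrightarrow>
        (\<exists>!h. h \<in> Hom C l q \<and> (\<forall>i \<in> I. Comp C h (c i) = d i)))"

text \<open>Preservation of the colimits of diagrams indexed by the \<open>m\<close>-directed posets of
  cardinality \<open>< k\<close>.\<close>

definition preserves_directed_colimits ::
  "'u rel \<Rightarrow> 'm rel \<Rightarrow> ('o, 'a, 'y) precat_scheme \<Rightarrow> ('p, 'b, 'z) precat_scheme \<Rightarrow>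
     ('o, 'a, 'p, 'b) fctr \<Rightarrow> bool" where
  "preserves_directed_colimits k m C D F \<longleftrightarrow>
     (\<forall>(I :: 'u set) r X T l c. |I| <o k \<longrightarrow> directed_poset m I r \<longrightarrow> poset_diagram C I r X T \<longrightarrow>
        is_colimit C I r X T l c \<longrightarrow>
        is_colimit D I r (\<lambda>i. ObjMap F (X i)) (\<lambda>i j. ArrMap F (T i j))
          (ObjMap F l) (\<lambda>i. ArrMap F (c i)))"

section \<open>Abelian groups and modules\<close>

type_synonym 'u ab_arrow = "('u monoid, 'u \<Rightarrow> 'u) arrow"

definition Ab :: "('u monoid, 'u ab_arrow) additive_precat" where
  "Ab =
    \<lparr>Obj = {G. comm_group G \<and> |carrier G| <o |UNIV :: 'u set|},
     Arr = {f. comm_group (src f) \<and> |carrier (src f)| <o |UNIV :: 'u set| \<and>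
               comm_group (tgt f) \<and> |carrier (tgt f)| <o |UNIV :: 'u set| \<and>
               amap f \<in> hom (src f) (tgt f) \<and> amap f \<in> extensional (carrier (src f))},
     Dom = src,
     Cod = tgt,
     Ident = (\<lambda>G. Arrow G G (\<lambda>x \<in> carrier G. x)),
     Comp = (\<lambda>g f. Arrow (src f) (tgt g) (\<lambda>x \<in> carrier (src f). amap g (amap f x))),
     HomGrp = (\<lambda>G H.
       \<lparr>carrier = {f. src f = G \<and> tgt f = H \<and> amap f \<in> hom G H \<and> amap f \<in> extensional (carrier G)},
        mult = (\<lambda>f g. Arrow G H (\<lambda>x \<in> carrier G. amap f x \<otimes>\<^bsub>H\<^esub> amap g x)),
        one = Arrow G H (\<lambda>x \<in> carrier G. \<one>\<^bsub>H\<^esub>)\<rparr>)\<rparr>"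

type_synonym ('o, 'a, 'u) lmod = "('o, 'a, 'u monoid, 'u ab_arrow) fctr"
type_synonym ('o, 'a, 'u) lmod_arrow = "(('o, 'a, 'u) lmod, 'o \<Rightarrow> 'u ab_arrow) arrow"
type_synonym ('o, 'a, 'u) lmod_functor =
  "(('o, 'a, 'u) lmod, ('o, 'a, 'u) lmod_arrow, 'u monoid, 'u ab_arrow) fctr"

definition left_modules ::
  "('o, 'a) additive_precat \<Rightarrow> (('o, 'a, 'u) lmod, ('o, 'a, 'u) lmod_arrow) precat" where
  "left_modules R = full_subcat (functor_cat R Ab) (is_additive_functor R Ab)"

definition product_preserving_modules ::
  "'u rel \<Rightarrow> ('o, 'a) additive_precat \<Rightarrow> (('o, 'a, 'u) lmod, ('o, 'a, 'u) lmod_arrow) precat" where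
  "product_preserving_modules k R = full_subcat (left_modules R) (preserves_products k R Ab)"

text \<open>The objects of the category of functors \<open>C \<rightarrow> Ab\<close> preserving (small) \<open>m\<close>-directed colimits and
  (small) products.\<close>

definition Fun :: "'m rel \<Rightarrow> ('o, 'a, 'z) precat_scheme \<Rightarrow> ('o, 'a, 'u monoid, 'u ab_arrow) fctr set" where
  "Fun m C = {F. is_functor C Ab F \<and>
     preserves_directed_colimits |UNIV :: 'u set| m C Ab F \<and>
     preserves_products |UNIV :: 'u set| C Ab F}"

section \<open>pp-pairs\<close>

text \<open>The cospan \<open>n \<rightarrow> m \<leftarrow> l\<close> with legs \<open>A : n \<rightarrow> m\<close> and \<open>B : l \<rightarrow> m\<close> is the pair \<open>(A, B)\<close>.\<close>

definition pp_formula :: "('o, 'a, 'z) precat_scheme \<Rightarrow> 'o \<Rightarrow> 'a \<times> 'a \<Rightarrow> bool" where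
  "pp_formula R n \<phi> \<longleftrightarrow> (\<exists>m \<in> Obj R. \<exists>l \<in> Obj R. n \<in> Obj R \<and> fst \<phi> \<in> Hom R n m \<and> snd \<phi> \<in> Hom R l m)"

definition pp_solutions ::
  "('o, 'a, 'z) precat_scheme \<Rightarrow> 'a \<times> 'a \<Rightarrow> ('o, 'a, 'u) lmod \<Rightarrow> 'u set" where
  "pp_solutions R \<phi> M =
     {x \<in> carrier (ObjMap M (Dom R (fst \<phi>))). \<exists>y \<in> carrier (ObjMap M (Dom R (snd \<phi>))).
        amap (ArrMap M (fst \<phi>)) x = amap (ArrMap M (snd \<phi>)) y}"

definition pp_pair :: "'u itself \<Rightarrow> ('o, 'a) additive_precat \<Rightarrow> 'o \<Rightarrow> 'a \<times> 'a \<Rightarrow> 'a \<times> 'a \<Rightarrow> bool" where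
  "pp_pair _ R n \<phi> \<psi> \<longleftrightarrow> pp_formula R n \<phi> \<and> pp_formula R n \<psi> \<and>
     (\<forall>M \<in> Obj (left_modules R :: (('o, 'a, 'u) lmod, ('o, 'a, 'u) lmod_arrow) precat).
        pp_solutions R \<psi> M \<subseteq> pp_solutions R \<phi> M)"

text \<open>The quotient group \<open>F\<^sub>\<phi> M / F\<^sub>\<psi> M\<close> has carrier type \<open>'u set\<close>. To obtain an object of \<^const>\<open>Ab\<close>,
  it is transported to \<open>'u\<close> along the injection that sends each coset to a chosen element of it.\<close>

definition coset_rep :: "'u set \<Rightarrow> 'u" where
  "coset_rep K = (SOME x. x \<in> K)"

definition pp_quotient ::
  "('o, 'a, 'z) precat_scheme \<Rightarrow> 'o \<Rightarrow> 'a \<times> 'a \<Rightarrow> 'a \<times> 'a \<Rightarrow> ('o, 'a, 'u) lmod \<Rightarrow> 'u monoid" where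
  "pp_quotient R n \<phi> \<psi> M =
     image_group coset_rep ((ObjMap M n)\<lparr>carrier := pp_solutions R \<phi> M\<rparr> Mod pp_solutions R \<psi> M)"

definition pp_functor ::
  "('o, 'a, 'z) precat_scheme \<Rightarrow> 'o \<Rightarrow> 'a \<times> 'a \<Rightarrow> 'a \<times> 'a \<Rightarrow> ('o, 'a, 'u) lmod_functor" where
  "pp_functor R n \<phi> \<psi> =
    \<lparr>ObjMap = pp_quotient R n \<phi> \<psi>,
     ArrMap = (\<lambda>t. Arrow (pp_quotient R n \<phi> \<psi> (src t)) (pp_quotient R n \<phi> \<psi> (tgt t))
       (\<lambda>u \<in> carrier (pp_quotient R n \<phi> \<psi> (src t)).
          coset_rep (pp_solutions R \<psi> (tgt t) #>\<^bsub>ObjMap (tgt t) n\<^esub> amap (amap t n) u)))\<rparr>"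

end

theory Submission
  imports Defs "HOL-Algebra.Product_Groups"
begin

text \<open>
  The modules that preserve \<open>lam\<close>-small products are closed, inside all modules, under products and
  \<open>lam\<close>-directed colimits, and both are computed objectwise: products commute with products, and
  \<open>lam\<close>-directed colimits of abelian groups commute with \<open>lam\<close>-small products. So products and
  \<open>lam\<close>-directed colimits of such modules are products and directed colimits of modules, and
  restriction sends \<^term>\<open>Fun natLeq (left_modules R)\<close> into
  \<^term>\<open>Fun lam (product_preserving_modules lam R)\<close>.

  For the converse, let \<open>C f\<close> be the cokernel of the map \<open>R(m, -) \<rightarrow> R(n, -)\<close> given by an arrow
  \<open>f : n \<rightarrow> m\<close>. By the Yoneda lemma, homomorphisms \<open>C f \<rightarrow> X\<close> are the elements of \<open>X n\<close> annihilated
  by \<open>f\<close>. Representable modules preserve products and products of abelian groups are exact, so \<open>C f\<close>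
  preserves \<open>lam\<close>-small products. If \<open>X\<close> does so too, then fewer than \<open>lam\<close> elements
  of \<open>X\<close> amount to one element of \<open>X\<close> at the product of their sorts, and fewer than \<open>lam\<close> relations
  between them amount to one relation; therefore \<open>X\<close> is a \<open>lam\<close>-directed colimit of modules \<open>C f\<close>
  (theorem \<open>directed_presentation\<close>).

  Now let \<open>F\<close> preserve products and \<open>lam\<close>-directed colimits. Every element of a group \<open>F X\<close> comes from
  some \<open>F (C f)\<close>. The pairs consisting of a module \<open>C f\<close> and an element \<open>z\<close> of \<open>F (C f)\<close> form a small
  set, so there is a product \<open>P\<close> of these modules, and \<open>F P\<close> contains an element that projects to each
  \<open>z\<close>. That element comes from a single \<open>F (C f)\<close>, and hence a single element \<open>y\<close> of this \<open>F (C f)\<close>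
  generates \<open>F\<close>: it defines an epimorphism \<open>Hom(C f, -) \<rightarrow> F\<close> (lemma \<open>single_generator\<close>).
  Its kernel inherits what the argument uses, so it is an epimorphic image of some \<open>Hom(C g, -)\<close>. By
  Yoneda again, \<open>F X\<close> is naturally the group \<open>{x. f x = 0}\<close> modulo \<open>{h y | y. g y = 0}\<close> for some arrow
  \<open>h\<close> (theorem \<open>Fun_presentation\<close>). Both are solution sets of pp-formulas, and they form a
  pp-pair for all modules since \<open>f h\<close> factors through \<open>g\<close> (lemma \<open>presentation_pp_pair\<close>).

  Finally, a system of the form \<open>A x = B y\<close> is solvable in a product as soon as it is solvable in each
  factor, and a solution in a directed colimit already exists at some stage, so the functor of a pp-pair
  preserves products and directed colimits on all modules (theorem \<open>ppF_in_Fun\<close>).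

  Products and colimits are handled through elements throughout. In abelian groups and
  in modules each is characterised by a condition on elements; the condition implies the universal
  property by direct construction of the mediating map, and the converse holds because one object
  satisfying the condition exists and universal objects are unique up to isomorphism. Groups are written
  multiplicatively.
\<close>

section \<open>Small sets\<close>

locale universe =
  fixes U :: "'u itself"
  assumes inaccessible_universe: "inaccessible |UNIV :: 'u set|"
begin

definition small :: "'x set \<Rightarrow> bool" where
  "small A \<longleftrightarrow> |A| <o |UNIV :: 'u set|"

lemma small_inj_into: "small A \<Longrightarrow> \<exists>e :: 'x \<Rightarrow> 'u. inj_on e A" for A :: "'x set"
  unfolding small_def by (drule ordLess_imp_ordLeq) (auto simp flip: card_of_ordLeq)

lemma small_ordLeq: "|A| \<le>o |B| \<Longrightarrow> small B \<Longrightarrow> small A"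
  unfolding small_def by (rule ordLeq_ordLess_trans)

lemma small_subset: "A \<subseteq> B \<Longrightarrow> small B \<Longrightarrow> small A"
  by (rule small_ordLeq[OF card_of_mono1])

lemma small_image: "small A \<Longrightarrow> small (f ` A)"
  by (rule small_ordLeq[OF card_of_image])

lemma small_inj_image:
  assumes "inj_on e A"
  shows "small (e ` A) \<longleftrightarrow> small A"
  using small_image[of A e] small_image[of "e ` A" "inv_into A e"] assms by auto

lemma infinite_universe: "natLeq <o |UNIV :: 'u set|"
  using inaccessible_universe by (simp add: inaccessible_def)

lemma Cinfinite_universe: "Cinfinite |UNIV :: 'u set|"
  using cinfinite_mono[OF ordLess_imp_ordLeq[OF infinite_universe] natLeq_cinfinite] card_of_Card_order by simp

lemma small_ordLess: "|A| <o k \<Longrightarrow> k <o |UNIV :: 'u set| \<Longrightarrow> small A"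
  unfolding small_def by (rule ordLess_transitive)

lemma small_finite: "finite A \<Longrightarrow> small A"
  using small_ordLess[OF _ infinite_universe] by (simp add: finite_iff_ordLess_natLeq)

lemma small_Pow:
  fixes A :: "'x set"
  assumes "small A"
  shows "small (Pow A)"
proof -
  obtain e :: "'x \<Rightarrow> 'u" where e: "inj_on e A" using small_inj_into[OF assms] by blast
  have "small (e ` A)" by (rule small_image[OF assms])
  then have "small (Pow (e ` A))"
    using inaccessible_universe by (simp add: inaccessible_def small_def)
  moreover have "inj_on ((`) e) (Pow A)"
    using e by (rule inj_on_image_Pow)
  moreover have "((`) e) ` Pow A = Pow (e ` A)"
    using image_Pow_surj by blast
  ultimately show ?thesis using small_inj_image[of "(`) e" "Pow A"] by simp
qed

lemma small_UNION: "small I \<Longrightarrow> (\<And>i. i \<in> I \<Longrightarrow> small (A i)) \<Longrightarrow> small (\<Union>i\<in>I. A i)"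
proof -
  assume I: "small I" and A: "\<And>i. i \<in> I \<Longrightarrow> small (A i)"
  have "regularCard |UNIV :: 'u set|" using inaccessible_universe by (simp add: inaccessible_def)
  from regularCard_UNION_bound[OF Cinfinite_universe this I[unfolded small_def] A[unfolded small_def]]
  show ?thesis unfolding small_def .
qed

lemma small_Sigma: "small I \<Longrightarrow> (\<And>i. i \<in> I \<Longrightarrow> small (A i)) \<Longrightarrow> small (Sigma I A)"
proof -
  assume I: "small I" and A: "\<And>i. i \<in> I \<Longrightarrow> small (A i)"
  have "small (\<Union>i\<in>I. (\<lambda>a. (i, a)) ` A i)" by (intro small_UNION[OF I] small_image A)
  moreover have "Sigma I A = (\<Union>i\<in>I. (\<lambda>a. (i, a)) ` A i)" by auto
  ultimately show ?thesis by simp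
qed

lemma small_PiE:
  assumes "small I" and "\<And>i. i \<in> I \<Longrightarrow> small (A i)"
  shows "small (Pi\<^sub>E I A)"
proof -
  define graph where "graph f = {(i, f i) | i. i \<in> I}" for f :: "'a \<Rightarrow> 'b"
  have "graph ` Pi\<^sub>E I A \<subseteq> Pow (Sigma I A)"
    by (auto simp: graph_def)
  then have "small (graph ` Pi\<^sub>E I A)"
    by (rule small_subset[OF _ small_Pow[OF small_Sigma[OF assms]]])
  moreover have "inj_on graph (Pi\<^sub>E I A)"
  proof (rule inj_onI)
    fix f g assume f: "f \<in> Pi\<^sub>E I A" and g: "g \<in> Pi\<^sub>E I A" and eq: "graph f = graph g"
    have "f i = g i" if "i \<in> I" for i
    proof -
      have "(i, f i) \<in> graph g" using that by (simp flip: eq) (auto simp: graph_def)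
      then show ?thesis by (auto simp: graph_def)
    qed
    then show "f = g" using PiE_ext[OF f g] by blast
  qed
  ultimately show ?thesis using small_inj_image by blast
qed

end

section \<open>Elementwise products and directed colimits\<close>

text \<open>Underlying sets of products and directed colimits of groups: \<open>P\<close> with the maps \<open>\<pi> i\<close> is a product of
  the sets \<open>Y i\<close>. For a colimit, two elements identified in \<open>L\<close> are already
  identified at some stage; by directedness it is enough to compare elements of the same \<open>X i\<close>.\<close>

definition jointly_bijective ::
  "'i set \<Rightarrow> ('i \<Rightarrow> 'y set) \<Rightarrow> 'x set \<Rightarrow> ('i \<Rightarrow> 'x \<Rightarrow> 'y) \<Rightarrow> bool" where
  "jointly_bijective I Y P \<pi> \<longleftrightarrow>
     (\<forall>x \<in> P. \<forall>y \<in> P. (\<forall>i \<in> I. \<pi> i x = \<pi> i y) \<longrightarrow> x = y) \<and>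
     (\<forall>z. (\<forall>i \<in> I. z i \<in> Y i) \<longrightarrow> (\<exists>x \<in> P. \<forall>i \<in> I. \<pi> i x = z i))"

definition elementwise_colimit ::
  "'i set \<Rightarrow> 'i rel \<Rightarrow> ('i \<Rightarrow> 'x set) \<Rightarrow> ('i \<Rightarrow> 'i \<Rightarrow> 'x \<Rightarrow> 'x) \<Rightarrow> 'y set \<Rightarrow> ('i \<Rightarrow> 'x \<Rightarrow> 'y) \<Rightarrow> bool" where
  "elementwise_colimit I r X T L c \<longleftrightarrow>
     (\<forall>z \<in> L. \<exists>i \<in> I. \<exists>x \<in> X i. c i x = z) \<and>
     (\<forall>i \<in> I. \<forall>x \<in> X i. \<forall>y \<in> X i. c i x = c i y \<longrightarrow> (\<exists>j. (i, j) \<in> r \<and> T i j x = T i j y))"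

lemma jointly_bijective_inj:
  "\<lbrakk>jointly_bijective I Y P \<pi>; x \<in> P; y \<in> P; \<And>i. i \<in> I \<Longrightarrow> \<pi> i x = \<pi> i y\<rbrakk> \<Longrightarrow> x = y"
  unfolding jointly_bijective_def by blast

lemma jointly_bijective_surj:
  "\<lbrakk>jointly_bijective I Y P \<pi>; \<And>i. i \<in> I \<Longrightarrow> z i \<in> Y i\<rbrakk> \<Longrightarrow> \<exists>x \<in> P. \<forall>i \<in> I. \<pi> i x = z i"
  unfolding jointly_bijective_def by blast

lemma elementwise_colimit_surj:
  "\<lbrakk>elementwise_colimit I r X T L c; z \<in> L\<rbrakk> \<Longrightarrow> \<exists>i \<in> I. \<exists>x \<in> X i. c i x = z"
  unfolding elementwise_colimit_def by blast

lemma elementwise_colimit_eq: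
  "\<lbrakk>elementwise_colimit I r X T L c; i \<in> I; x \<in> X i; y \<in> X i; c i x = c i y\<rbrakk>
     \<Longrightarrow> \<exists>j. (i, j) \<in> r \<and> T i j x = T i j y"
  unfolding elementwise_colimit_def by blast

text \<open>Both properties are passed along the comparison maps between two universal objects. The map \<open>h\<close> is
  injective as \<open>k\<close> undoes it, and compatibility with the projections or coprojections gives the rest.\<close>

lemma jointly_bijective_transfer:
  assumes "jointly_bijective I Y Q \<rho>"
    and "\<And>x. x \<in> P \<Longrightarrow> h x \<in> Q" and "\<And>x. x \<in> Q \<Longrightarrow> k x \<in> P" and "\<And>x. x \<in> P \<Longrightarrow> k (h x) = x"
    and "\<And>i x. i \<in> I \<Longrightarrow> x \<in> P \<Longrightarrow> \<rho> i (h x) = \<pi> i x"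
    and "\<And>i x. i \<in> I \<Longrightarrow> x \<in> Q \<Longrightarrow> \<pi> i (k x) = \<rho> i x"
  shows "jointly_bijective I Y P \<pi>"
  unfolding jointly_bijective_def
proof (intro conjI ballI allI impI)
  fix x y assume "x \<in> P" "y \<in> P" "\<forall>i\<in>I. \<pi> i x = \<pi> i y"
  then have "h x = h y"
    using assms(2,5) jointly_bijective_inj[OF assms(1)] by metis
  then show "x = y" using assms(4) \<open>x \<in> P\<close> \<open>y \<in> P\<close> by metis
next
  fix z assume "\<forall>i\<in>I. z i \<in> Y i"
  then obtain x where "x \<in> Q" "\<forall>i\<in>I. \<rho> i x = z i"
    using jointly_bijective_surj[OF assms(1)] by metis
  then show "\<exists>x\<in>P. \<forall>i\<in>I. \<pi> i x = z i" using assms(3,6) by metis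
qed

lemma jointly_bijective_inj_image:
  assumes e: "inj_on e S"
    and jb: "jointly_bijective (e ` S) (\<lambda>i. Y (inv_into S e i)) P (\<lambda>i. \<pi> (inv_into S e i))"
  shows "jointly_bijective S Y P \<pi>"
  unfolding jointly_bijective_def
proof (intro conjI ballI allI impI)
  fix x y assume x: "x \<in> P" and y: "y \<in> P" and eq: "\<forall>s\<in>S. \<pi> s x = \<pi> s y"
  show "x = y" by (rule jointly_bijective_inj[OF jb x y]) (use e eq in auto)
next
  fix z assume z: "\<forall>s\<in>S. z s \<in> Y s"
  have "\<exists>x \<in> P. \<forall>i \<in> e ` S. \<pi> (inv_into S e i) x = z (inv_into S e i)"
    by (rule jointly_bijective_surj[OF jb]) (use z e in auto)
  then show "\<exists>x \<in> P. \<forall>s \<in> S. \<pi> s x = z s" using e by simp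
qed

lemma elementwise_colimit_transfer:
  assumes "elementwise_colimit I r X T M d"
    and "\<And>x. x \<in> L \<Longrightarrow> h x \<in> M" and "\<And>x. x \<in> L \<Longrightarrow> k (h x) = x"
    and "\<And>i x. i \<in> I \<Longrightarrow> x \<in> X i \<Longrightarrow> h (c i x) = d i x"
    and "\<And>i x. i \<in> I \<Longrightarrow> x \<in> X i \<Longrightarrow> k (d i x) = c i x"
  shows "elementwise_colimit I r X T L c"
  unfolding elementwise_colimit_def
proof (intro conjI ballI allI impI)
  fix z assume z: "z \<in> L"
  then obtain i x where "i \<in> I" "x \<in> X i" "d i x = h z"
    using elementwise_colimit_surj[OF assms(1)] assms(2) by metis
  then show "\<exists>i\<in>I. \<exists>x\<in>X i. c i x = z" using assms(3,5) z by metis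
next
  fix i x y assume "i \<in> I" "x \<in> X i" "y \<in> X i" "c i x = c i y"
  then show "\<exists>j. (i, j) \<in> r \<and> T i j x = T i j y"
    using elementwise_colimit_eq[OF assms(1)] assms(4) by metis
qed

lemma directed_posetD:
  assumes "directed_poset m I r"
  shows "r \<subseteq> I \<times> I" "\<And>i. i \<in> I \<Longrightarrow> (i, i) \<in> r" "trans r" "antisym r"
  using assms unfolding directed_poset_def partial_order_on_def preorder_on_def refl_on_def by auto

lemma directed_poset_bound:
  "\<lbrakk>directed_poset m I r; S \<subseteq> I; |S| <o m\<rbrakk> \<Longrightarrow> \<exists>u \<in> I. \<forall>s \<in> S. (s, u) \<in> r"
  unfolding directed_poset_def by blast

lemma directed_poset_mono:
  assumes "directed_poset m I r" and "m' \<le>o m"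
  shows "directed_poset m' I r"
  using assms(1) ordLess_ordLeq_trans[OF _ assms(2)] unfolding directed_poset_def by fastforce

lemma directed_poset_two:
  assumes "directed_poset natLeq I r" and "i \<in> I" and "j \<in> I"
  shows "\<exists>u \<in> I. (i, u) \<in> r \<and> (j, u) \<in> r"
  using directed_poset_bound[OF assms(1), of "{i, j}"] assms(2,3) finite_iff_ordLess_natLeq by auto

lemma directed_poset_nonempty: "directed_poset natLeq I r \<Longrightarrow> I \<noteq> {}"
  using directed_poset_bound[of natLeq I r "{}"] finite_iff_ordLess_natLeq by auto

section \<open>Limits and colimits in a category\<close>

lemma is_product_universal:
  "\<lbrakk>is_product C I X p \<pi>; q \<in> Obj C; \<And>i. i \<in> I \<Longrightarrow> f i \<in> Hom C q (X i)\<rbrakk>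
     \<Longrightarrow> \<exists>!h. h \<in> Hom C q p \<and> (\<forall>i \<in> I. Comp C (\<pi> i) h = f i)"
  by (simp add: is_product_def)

lemma is_productD:
  assumes "is_product C S K p \<rho>"
  shows "p \<in> Obj C" and "s \<in> S \<Longrightarrow> \<rho> s \<in> Hom C p (K s)"
  using assms by (simp_all add: is_product_def)

lemma is_product_unique:
  assumes "category C" and p: "is_product C I X p \<pi>" and q: "is_product C I X q \<rho>"
  obtains h k where "h \<in> Hom C p q" "k \<in> Hom C q p" "Comp C k h = Ident C p"
    "\<And>i. i \<in> I \<Longrightarrow> Comp C (\<rho> i) h = \<pi> i" "\<And>i. i \<in> I \<Longrightarrow> Comp C (\<pi> i) k = \<rho> i"
proof -
  interpret category C by fact
  obtain h where h: "h \<in> Hom C p q" "\<And>i. i \<in> I \<Longrightarrow> Comp C (\<rho> i) h = \<pi> i"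
    using p q unfolding is_product_def by metis
  obtain k where k: "k \<in> Hom C q p" "\<And>i. i \<in> I \<Longrightarrow> Comp C (\<pi> i) k = \<rho> i"
    using p q unfolding is_product_def by metis
  have pO: "p \<in> Obj C" and pi: "\<And>i. i \<in> I \<Longrightarrow> \<pi> i \<in> Hom C p (X i)"
    using p unfolding is_product_def by auto
  have "\<exists>!e. e \<in> Hom C p p \<and> (\<forall>i \<in> I. Comp C (\<pi> i) e = \<pi> i)"
    using p unfolding is_product_def by blast
  moreover have "Comp C k h \<in> Hom C p p" "Ident C p \<in> Hom C p p"
    using Comp_closed h k Ident_closed pO by auto
  moreover have "Comp C (\<pi> i) (Comp C k h) = \<pi> i" if "i \<in> I" for i
    using Comp_assoc[OF h(1) k(1) pi[OF that]] k(2) h(2) that by simp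
  moreover have "Comp C (\<pi> i) (Ident C p) = \<pi> i" if "i \<in> I" for i
    using Comp_Ident[OF pi[OF that]] .
  ultimately have "Comp C k h = Ident C p" by blast
  then show thesis using that h k by blast
qed

lemma is_colimit_unique:
  assumes "category C" and l: "is_colimit C I r X T l c" and m: "is_colimit C I r X T m d"
  obtains h k where "h \<in> Hom C l m" "k \<in> Hom C m l" "Comp C k h = Ident C l"
    "\<And>i. i \<in> I \<Longrightarrow> Comp C h (c i) = d i" "\<And>i. i \<in> I \<Longrightarrow> Comp C k (d i) = c i"
proof -
  interpret category C by fact
  have lc: "is_cocone C I r X T l c" and md: "is_cocone C I r X T m d"
    using l m unfolding is_colimit_def by auto
  obtain h where h: "h \<in> Hom C l m" "\<And>i. i \<in> I \<Longrightarrow> Comp C h (c i) = d i"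
    using l md unfolding is_colimit_def by metis
  obtain k where k: "k \<in> Hom C m l" "\<And>i. i \<in> I \<Longrightarrow> Comp C k (d i) = c i"
    using m lc unfolding is_colimit_def by metis
  have lO: "l \<in> Obj C" and ci: "\<And>i. i \<in> I \<Longrightarrow> c i \<in> Hom C (X i) l"
    using lc unfolding is_cocone_def by auto
  have "\<exists>!e. e \<in> Hom C l l \<and> (\<forall>i \<in> I. Comp C e (c i) = c i)"
    using l lc unfolding is_colimit_def by blast
  moreover have "Comp C k h \<in> Hom C l l" "Ident C l \<in> Hom C l l"
    using Comp_closed h k Ident_closed lO by auto
  moreover have "Comp C (Comp C k h) (c i) = c i" if "i \<in> I" for i
    using Comp_assoc[OF ci[OF that] h(1) k(1)] k(2) h(2) that by simp
  moreover have "Comp C (Ident C l) (c i) = c i" if "i \<in> I" for i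
    using Ident_Comp[OF ci[OF that]] .
  ultimately have "Comp C k h = Ident C l" by blast
  then show thesis using that h k by blast
qed

lemma is_product_cong:
  assumes "\<And>i. i \<in> I \<Longrightarrow> X i = X' i" "\<And>i. i \<in> I \<Longrightarrow> \<pi> i = \<pi>' i"
  shows "is_product C I X p \<pi> \<longleftrightarrow> is_product C I X' p \<pi>'"
  unfolding is_product_def using assms by simp

lemma is_product_reindex:
  assumes b: "bij_betw b I' I" and p: "is_product C I X p \<pi>"
  shows "is_product C I' (\<lambda>i. X (b i)) p (\<lambda>i. \<pi> (b i))"
  unfolding is_product_def
proof (intro conjI ballI allI impI)
  show "p \<in> Obj C" using p by (simp add: is_product_def)
  show "\<pi> (b i) \<in> Hom C p (X (b i))" if "i \<in> I'" for i
    using p that bij_betwE[OF b] by (simp add: is_product_def)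
  fix q f assume q: "q \<in> Obj C" and f: "\<forall>i\<in>I'. f i \<in> Hom C q (X (b i))"
  let ?f = "\<lambda>i. f (inv_into I' b i)"
  have b': "\<And>i. i \<in> I \<Longrightarrow> inv_into I' b i \<in> I' \<and> b (inv_into I' b i) = i"
    by (metis b bij_betw_def f_inv_into_f inv_into_into)
  then have "\<forall>i\<in>I. ?f i \<in> Hom C q (X i)" using f by metis
  then have "\<exists>!h. h \<in> Hom C q p \<and> (\<forall>i\<in>I. Comp C (\<pi> i) h = ?f i)"
    by (intro is_product_universal[OF p q]) simp
  moreover have "(\<forall>i\<in>I. Comp C (\<pi> i) h = ?f i) \<longleftrightarrow> (\<forall>i\<in>I'. Comp C (\<pi> (b i)) h = f i)" for h
    by (metis b b' bij_betwE bij_betw_inv_into_left)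
  ultimately show "\<exists>!h. h \<in> Hom C q p \<and> (\<forall>i\<in>I'. Comp C (\<pi> (b i)) h = f i)" by simp
qed

lemma (in category) Hom_Obj:
  assumes "f \<in> Hom C a b"
  shows "a \<in> Obj C" and "b \<in> Obj C"
  using assms Dom_closed Cod_closed by (auto simp: Hom_def)

lemma is_product_Hom_eqI:
  assumes "category C" and p: "is_product C S K p \<rho>" and h: "h \<in> Hom C q p" "h' \<in> Hom C q p"
    and eq: "\<And>s. s \<in> S \<Longrightarrow> Comp C (\<rho> s) h = Comp C (\<rho> s) h'"
  shows "h = h'"
proof -
  interpret category C by fact
  have rho: "\<rho> s \<in> Hom C p (K s)" if "s \<in> S" for s using p that by (simp add: is_product_def)
  have "\<exists>!e. e \<in> Hom C q p \<and> (\<forall>s\<in>S. Comp C (\<rho> s) e = Comp C (\<rho> s) h')"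
    by (rule is_product_universal[OF p Hom_Obj(1)[OF h(1)]]) (rule Comp_closed[OF h(2) rho])
  then show ?thesis using h eq by blast
qed

lemma full_subcat_Hom:
  "Hom (full_subcat C P) a b = (if P a \<and> P b then Hom C a b else {})"
  unfolding Hom_def full_subcat_def by auto

lemma full_subcat_Obj: "a \<in> Obj (full_subcat C P) \<longleftrightarrow> a \<in> Obj C \<and> P a"
  unfolding full_subcat_def by simp

lemma full_subcat_Comp: "Comp (full_subcat C P) = Comp C"
  and full_subcat_Ident: "Ident (full_subcat C P) = Ident C"
  unfolding full_subcat_def by simp_all

lemma category_full_subcat:
  assumes "category C"
  shows "category (full_subcat C P)"
proof -
  interpret category C by fact
  show ?thesis
  proof (unfold_locales, goal_cases)
    case (1 f) then show ?case using Dom_closed by (simp add: full_subcat_def)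
  next
    case (2 f) then show ?case using Cod_closed by (simp add: full_subcat_def)
  next
    case (3 a) then show ?case using Ident_closed by (simp add: full_subcat_Hom full_subcat_Obj full_subcat_Ident)
  next
    case (4 f a b g c) then show ?case using Comp_closed by (auto simp: full_subcat_Hom full_subcat_Comp split: if_splits)
  next
    case (5 f a b) then show ?case using Comp_Ident by (auto simp: full_subcat_Hom full_subcat_Comp full_subcat_Ident split: if_splits)
  next
    case (6 f a b) then show ?case using Ident_Comp by (auto simp: full_subcat_Hom full_subcat_Comp full_subcat_Ident split: if_splits)
  next
    case (7 f a b g c h d) then show ?case using Comp_assoc by (auto simp: full_subcat_Hom full_subcat_Comp split: if_splits)
  qed
qed

lemma is_functorD:
  assumes "is_functor C D F"
  shows "a \<in> Obj C \<Longrightarrow> ObjMap F a \<in> Obj D"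
    and "\<lbrakk>a \<in> Obj C; b \<in> Obj C; f \<in> Hom C a b\<rbrakk> \<Longrightarrow> ArrMap F f \<in> Hom D (ObjMap F a) (ObjMap F b)"
    and "a \<in> Obj C \<Longrightarrow> ArrMap F (Ident C a) = Ident D (ObjMap F a)"
    and "\<lbrakk>a \<in> Obj C; b \<in> Obj C; c \<in> Obj C; f \<in> Hom C a b; g \<in> Hom C b c\<rbrakk>
      \<Longrightarrow> ArrMap F (Comp C g f) = Comp D (ArrMap F g) (ArrMap F f)"
  using assms by (simp_all add: is_functor_def)

text \<open>Components are composed objectwise, and their extensionality turns objectwise equality into equality of
  arrows.\<close>

lemma category_functor_cat:
  assumes "category C" and "category D"
  shows "category (functor_cat C D)"
proof -
  interpret C: category C by fact
  interpret D: category D by fact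
  have Hom_iff: "t \<in> Hom (functor_cat C D) F G \<longleftrightarrow> is_functor C D F \<and> is_functor C D G \<and>
      src t = F \<and> tgt t = G \<and> nat_trans C D F G (amap t) \<and> amap t \<in> extensional (Obj C)" for t F G
    unfolding Hom_def functor_cat_def by auto
  have comp: "amap t a \<in> Hom D (ObjMap F a) (ObjMap G a)"
    if "t \<in> Hom (functor_cat C D) F G" "a \<in> Obj C" for t F G a
    using that unfolding Hom_iff nat_trans_def by blast
  have arrow_eq: "s = t" if "s \<in> Hom (functor_cat C D) F G" "t \<in> Hom (functor_cat C D) F G"
    "\<And>a. a \<in> Obj C \<Longrightarrow> amap s a = amap t a" for s t F G
  proof -
    have "amap s = amap t"
      using that(1,2) unfolding Hom_iff by (intro extensionalityI[of _ "Obj C"] that(3)) simp_all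
    then show ?thesis using that(1,2) unfolding Hom_iff by (intro arrow.expand) simp
  qed
  have Comp_simp: "Comp (functor_cat C D) t s =
      Arrow (src s) (tgt t) (\<lambda>a \<in> Obj C. Comp D (amap t a) (amap s a))" for s t
    unfolding functor_cat_def by simp
  have Id_simp: "Ident (functor_cat C D) F = Arrow F F (\<lambda>a \<in> Obj C. Ident D (ObjMap F a))" for F
    unfolding functor_cat_def by simp
  have Comp_in: "Comp (functor_cat C D) t s \<in> Hom (functor_cat C D) F H"
    if s: "s \<in> Hom (functor_cat C D) F G" and t: "t \<in> Hom (functor_cat C D) G H" for s t F G H
  proof -
    have "nat_trans C D F H (\<lambda>a \<in> Obj C. Comp D (amap t a) (amap s a))"
      unfolding nat_trans_def
    proof (intro conjI ballI)
      fix a assume a: "a \<in> Obj C"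
      then show "(\<lambda>a \<in> Obj C. Comp D (amap t a) (amap s a)) a \<in> Hom D (ObjMap F a) (ObjMap H a)"
        using D.Comp_closed[OF comp[OF s a] comp[OF t a]] by simp
      fix b f assume b: "b \<in> Obj C" and f: "f \<in> Hom C a b"
      have Ff: "ArrMap F f \<in> Hom D (ObjMap F a) (ObjMap F b)"
        and Gf: "ArrMap G f \<in> Hom D (ObjMap G a) (ObjMap G b)"
        and Hf: "ArrMap H f \<in> Hom D (ObjMap H a) (ObjMap H b)"
        using s t is_functorD(2)[OF _ a b f] unfolding Hom_iff by blast+
      have sf: "Comp D (amap s b) (ArrMap F f) = Comp D (ArrMap G f) (amap s a)"
        and tf: "Comp D (amap t b) (ArrMap G f) = Comp D (ArrMap H f) (amap t a)"
        using s t a b f unfolding Hom_iff nat_trans_def by blast+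
      have "Comp D (Comp D (amap t b) (amap s b)) (ArrMap F f)
          = Comp D (Comp D (amap t b) (ArrMap G f)) (amap s a)"
        using D.Comp_assoc[OF Ff comp[OF s b] comp[OF t b]] D.Comp_assoc[OF comp[OF s a] Gf comp[OF t b]] sf by simp
      also have "\<dots> = Comp D (ArrMap H f) (Comp D (amap t a) (amap s a))"
        using D.Comp_assoc[OF comp[OF s a] comp[OF t a] Hf] tf by simp
      finally show "Comp D ((\<lambda>a \<in> Obj C. Comp D (amap t a) (amap s a)) b) (ArrMap F f)
          = Comp D (ArrMap H f) ((\<lambda>a \<in> Obj C. Comp D (amap t a) (amap s a)) a)"
        using a b by simp
    qed
    then show ?thesis using s t unfolding Hom_iff Comp_simp by simp
  qed
  have Id_in: "Ident (functor_cat C D) F \<in> Hom (functor_cat C D) F F" if F: "is_functor C D F" for F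
  proof -
    have "nat_trans C D F F (\<lambda>a \<in> Obj C. Ident D (ObjMap F a))"
      unfolding nat_trans_def
    proof (intro conjI ballI)
      fix a assume a: "a \<in> Obj C"
      then show "(\<lambda>a \<in> Obj C. Ident D (ObjMap F a)) a \<in> Hom D (ObjMap F a) (ObjMap F a)"
        using D.Ident_closed is_functorD(1)[OF F] by simp
      fix b f assume b: "b \<in> Obj C" and f: "f \<in> Hom C a b"
      show "Comp D ((\<lambda>a \<in> Obj C. Ident D (ObjMap F a)) b) (ArrMap F f)
          = Comp D (ArrMap F f) ((\<lambda>a \<in> Obj C. Ident D (ObjMap F a)) a)"
        using a b D.Ident_Comp[OF is_functorD(2)[OF F a b f]] D.Comp_Ident[OF is_functorD(2)[OF F a b f]] by simp
    qed
    then show ?thesis using F unfolding Hom_iff Id_simp by simp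
  qed
  show ?thesis
  proof (unfold_locales, goal_cases)
    case (1 f) then show ?case by (simp add: functor_cat_def)
  next
    case (2 f) then show ?case by (simp add: functor_cat_def)
  next
    case (3 F) then show ?case using Id_in by (simp add: functor_cat_def)
  next
    case 4 then show ?case using Comp_in by blast
  next
    case (5 t F G)
    have "Comp (functor_cat C D) t (Ident (functor_cat C D) F) \<in> Hom (functor_cat C D) F G"
      using 5 Comp_in Id_in Hom_iff by blast
    then show ?case
      by (rule arrow_eq[OF _ 5]) (use D.Comp_Ident[OF comp[OF 5]] in \<open>simp add: Comp_simp Id_simp\<close>)
  next
    case (6 t F G)
    have "Comp (functor_cat C D) (Ident (functor_cat C D) G) t \<in> Hom (functor_cat C D) F G"
      using 6 Comp_in Id_in Hom_iff by blast
    then show ?case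
      by (rule arrow_eq[OF _ 6]) (use D.Ident_Comp[OF comp[OF 6]] in \<open>simp add: Comp_simp Id_simp\<close>)
  next
    case (7 f F G g H h K)
    show ?case
      by (rule arrow_eq[OF Comp_in[OF Comp_in[OF 7(1,2)] 7(3)] Comp_in[OF 7(1) Comp_in[OF 7(2,3)]]])
        (use D.Comp_assoc[OF comp[OF 7(1)] comp[OF 7(2)] comp[OF 7(3)]] in \<open>simp add: Comp_simp\<close>)
  qed
qed

section \<open>The category of small abelian groups\<close>

lemma comm_group_is_group: "comm_group G \<Longrightarrow> group G"
  by (simp add: comm_group_def)

lemma hom_apply_closed: "h \<in> hom G H \<Longrightarrow> x \<in> carrier G \<Longrightarrow> h x \<in> carrier H"
  and hom_apply_mult: "h \<in> hom G H \<Longrightarrow> x \<in> carrier G \<Longrightarrow> y \<in> carrier G \<Longrightarrow> h (x \<otimes>\<^bsub>G\<^esub> y) = h x \<otimes>\<^bsub>H\<^esub> h y"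
  by (auto simp: hom_def)

definition ab_map :: "'u monoid \<Rightarrow> 'u monoid \<Rightarrow> ('u \<Rightarrow> 'u) \<Rightarrow> 'u ab_arrow" where
  "ab_map G H h = Arrow G H (restrict h (carrier G))"

lemma ab_map_apply [simp]: "x \<in> carrier G \<Longrightarrow> amap (ab_map G H h) x = h x"
  by (simp add: ab_map_def)

lemma ab_Obj_iff: "G \<in> Obj (Ab :: ('u monoid, 'u ab_arrow) additive_precat) \<longleftrightarrow>
    comm_group G \<and> |carrier G| <o |UNIV :: 'u set|"
  by (simp add: Ab_def)

lemma ab_Obj_comm_group: "G \<in> Obj Ab \<Longrightarrow> comm_group G"
  by (simp add: ab_Obj_iff)

lemma ab_Obj_group: "G \<in> Obj Ab \<Longrightarrow> group G"
  using ab_Obj_comm_group comm_group_is_group by blast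

lemma ab_Hom_iff: "f \<in> Hom Ab G H \<longleftrightarrow> G \<in> Obj Ab \<and> H \<in> Obj Ab \<and> src f = G \<and> tgt f = H \<and>
    amap f \<in> hom G H \<and> amap f \<in> extensional (carrier G)"
  unfolding Hom_def Ab_def by auto

lemma ab_map_in_Hom:
  assumes "G \<in> Obj Ab" and "H \<in> Obj Ab" and "h \<in> hom G H"
  shows "ab_map G H h \<in> Hom Ab G H"
proof -
  interpret group G using assms(1) by (rule ab_Obj_group)
  have "restrict h (carrier G) \<in> hom G H" using assms(3) by (auto simp: hom_def)
  then show ?thesis using assms by (simp add: ab_Hom_iff ab_map_def)
qed

lemma ab_Hom_eqI:
  assumes "f \<in> Hom Ab G H" and "g \<in> Hom Ab G H" and "\<And>x. x \<in> carrier G \<Longrightarrow> amap f x = amap g x"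
  shows "f = g"
proof -
  have "amap f = amap g"
    using assms(1,2) by (intro extensionalityI[of _ "carrier G"] assms(3)) (simp_all add: ab_Hom_iff)
  then show ?thesis using assms(1,2) by (intro arrow.expand) (simp add: ab_Hom_iff)
qed

lemma ab_Hom_Obj:
  assumes "f \<in> Hom Ab G H"
  shows "G \<in> Obj Ab" and "H \<in> Obj Ab"
  using assms by (simp_all add: ab_Hom_iff)

lemma ab_apply_hom: "f \<in> Hom Ab G H \<Longrightarrow> group_hom G H (amap f)"
  using ab_Obj_group by (auto simp: ab_Hom_iff group_hom_def group_hom_axioms_def)

lemma ab_apply_closed: "f \<in> Hom Ab G H \<Longrightarrow> x \<in> carrier G \<Longrightarrow> amap f x \<in> carrier H"
  by (auto simp: ab_Hom_iff hom_def)

lemma ab_apply_mult: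
  "f \<in> Hom Ab G H \<Longrightarrow> x \<in> carrier G \<Longrightarrow> y \<in> carrier G \<Longrightarrow> amap f (x \<otimes>\<^bsub>G\<^esub> y) = amap f x \<otimes>\<^bsub>H\<^esub> amap f y"
  by (auto simp: ab_Hom_iff hom_def)

lemma ab_apply_one: "f \<in> Hom Ab G H \<Longrightarrow> amap f \<one>\<^bsub>G\<^esub> = \<one>\<^bsub>H\<^esub>"
  by (rule group_hom.hom_one[OF ab_apply_hom])

lemma ab_Comp_apply: "f \<in> Hom Ab G H \<Longrightarrow> x \<in> carrier G \<Longrightarrow> amap (Comp Ab g f) x = amap g (amap f x)"
  by (simp add: ab_Hom_iff) (simp add: Ab_def)

lemma ab_Ident_apply: "x \<in> carrier G \<Longrightarrow> amap (Ident Ab G) x = x"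
  by (simp add: Ab_def)

lemma ab_Comp_in_Hom:
  assumes f: "f \<in> Hom Ab G H" and g: "g \<in> Hom Ab H K"
  shows "Comp Ab g f \<in> Hom Ab G K"
proof -
  interpret group G using ab_Hom_Obj(1)[OF f] by (rule ab_Obj_group)
  have "(\<lambda>x \<in> carrier G. amap g (amap f x)) \<in> hom G K"
    using ab_apply_closed[OF f] ab_apply_closed[OF g] ab_apply_mult[OF f] ab_apply_mult[OF g]
    by (auto simp: hom_def)
  moreover have "Comp Ab g f = Arrow G K (\<lambda>x \<in> carrier G. amap g (amap f x))"
    using f g by (simp add: ab_Hom_iff) (simp add: Ab_def)
  ultimately show ?thesis using ab_Hom_Obj[OF f] ab_Hom_Obj[OF g] by (simp add: ab_Hom_iff)
qed

lemma ab_Ident_in_Hom: "G \<in> Obj Ab \<Longrightarrow> Ident Ab G \<in> Hom Ab G G"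
proof -
  assume G: "G \<in> Obj Ab"
  interpret group G using G by (rule ab_Obj_group)
  have "Ident Ab G = ab_map G G (\<lambda>x. x)" by (simp add: Ab_def ab_map_def)
  then show ?thesis using ab_map_in_Hom[OF G G, of "\<lambda>x. x"] by (simp add: hom_def)
qed

lemma category_Ab: "category Ab"
proof (unfold_locales, goal_cases)
  case (1 f) then show ?case by (simp add: Ab_def)
next
  case (2 f) then show ?case by (simp add: Ab_def)
next
  case (3 G) then show ?case by (rule ab_Ident_in_Hom)
next
  case (4 f G H g K) then show ?case by (rule ab_Comp_in_Hom)
next
  case (5 f G H)
  show ?case
    by (rule ab_Hom_eqI[OF ab_Comp_in_Hom[OF ab_Ident_in_Hom[OF ab_Hom_Obj(1)[OF 5]] 5] 5])
      (simp add: ab_Comp_apply[OF ab_Ident_in_Hom[OF ab_Hom_Obj(1)[OF 5]]] ab_Ident_apply)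
next
  case (6 f G H)
  show ?case
    by (rule ab_Hom_eqI[OF ab_Comp_in_Hom[OF 6 ab_Ident_in_Hom[OF ab_Hom_Obj(2)[OF 6]]] 6])
      (simp add: ab_Comp_apply[OF 6] ab_apply_closed[OF 6] ab_Ident_apply)
next
  case (7 f G H g K h L)
  show ?case
    by (rule ab_Hom_eqI[OF ab_Comp_in_Hom[OF ab_Comp_in_Hom[OF 7(1,2)] 7(3)] ab_Comp_in_Hom[OF 7(1) ab_Comp_in_Hom[OF 7(2,3)]]])
      (simp add: ab_Comp_apply[OF 7(1)] ab_Comp_apply[OF 7(2)] ab_apply_closed[OF 7(1)]
        ab_Comp_apply[OF ab_Comp_in_Hom[OF 7(1,2)]])
qed

text \<open>The inverse map of a bijective homomorphism is made extensional in order to be an arrow of \<^const>\<open>Ab\<close>.\<close>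

lemma ab_is_isoI:
  assumes f: "f \<in> Hom Ab G H" and bij: "bij_betw (amap f) (carrier G) (carrier H)"
  shows "is_iso Ab G H f"
proof -
  interpret f: group_hom G H "amap f" by (rule ab_apply_hom[OF f])
  let ?g = "ab_map H G (inv_into (carrier G) (amap f))"
  have "amap f \<in> iso G H" using f bij by (simp add: iso_def ab_Hom_iff)
  then have "inv_into (carrier G) (amap f) \<in> hom H G"
    by (rule f.G.iso_set_sym[THEN iso_imp_homomorphism])
  then have g: "?g \<in> Hom Ab H G" using ab_map_in_Hom ab_Hom_Obj[OF f] by blast
  have "Comp Ab ?g f = Ident Ab G"
    by (rule ab_Hom_eqI[OF ab_Comp_in_Hom[OF f g] ab_Ident_in_Hom[OF ab_Hom_Obj(1)[OF f]]])
      (use bij in \<open>simp add: ab_Comp_apply[OF f] ab_Ident_apply ab_apply_closed[OF f] bij_betw_inv_into_left\<close>)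
  moreover have "Comp Ab f ?g = Ident Ab H"
    by (rule ab_Hom_eqI[OF ab_Comp_in_Hom[OF g f] ab_Ident_in_Hom[OF ab_Hom_Obj(2)[OF f]]])
      (use bij in \<open>simp add: ab_Comp_apply[OF g] ab_Ident_apply bij_betw_inv_into_right\<close>)
  ultimately show ?thesis using f g unfolding is_iso_def by blast
qed

lemma (in comm_group) subgroup_imp_comm_group:
  assumes "subgroup S G"
  shows "comm_group (G\<lparr>carrier := S\<rparr>)"
proof -
  interpret S: group "G\<lparr>carrier := S\<rparr>" by (rule subgroup_imp_group[OF assms])
  show ?thesis
    by (rule S.group_comm_groupI) (use m_comm subgroup.subset[OF assms] in auto)
qed

text \<open>Any choice of names for the cosets makes the quotient a group over the type of the names. For pp-pairs
  the name of a coset is one of its elements; for groups over other types the names come from the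
  universe.\<close>

lemma image_of_quotient:
  fixes G :: "'x monoid" and e :: "'x set \<Rightarrow> 'y"
  assumes "comm_group G" and "subgroup K G" and inj: "inj_on e (carrier (G Mod K))"
  defines "H \<equiv> image_group e (G Mod K)" and "q \<equiv> \<lambda>x. e (K #>\<^bsub>G\<^esub> x)"
  shows "comm_group H" and "q \<in> hom G H" and "q ` carrier G = carrier H"
    and "\<And>x. x \<in> carrier G \<Longrightarrow> q x = \<one>\<^bsub>H\<^esub> \<longleftrightarrow> x \<in> K"
proof -
  interpret comm_group G by fact
  interpret K: subgroup K G by fact
  interpret N: normal K G by (rule subgroup_imp_normal) fact
  have Q: "comm_group (G Mod K)" by (rule abelian_FactGroup) fact
  interpret Q: comm_group "G Mod K" by fact
  have e_hom: "e \<in> iso (G Mod K) H"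
    using inj Q.m_closed
    by (auto simp: iso_def hom_def H_def image_group_def bij_betw_def inv_into_f_f)
  have "comm_group (H\<lparr>one := e \<one>\<^bsub>G Mod K\<^esub>\<rparr>)" by (rule Q.iso_imp_img_comm_group[OF e_hom])
  moreover have "H\<lparr>one := e \<one>\<^bsub>G Mod K\<^esub>\<rparr> = H" by (simp add: H_def image_group_def)
  ultimately show H: "comm_group H" by simp
  show "q \<in> hom G H"
    using Group.hom_compose[OF N.r_coset_hom_Mod iso_imp_homomorphism[OF e_hom]]
    by (simp add: q_def o_def)
  show "q ` carrier G = carrier H"
    by (simp add: H_def q_def image_group_def carrier_FactGroup image_image)
  fix x assume x: "x \<in> carrier G"
  have KQ: "K \<in> carrier (G Mod K)" and xQ: "K #>\<^bsub>G\<^esub> x \<in> carrier (G Mod K)"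
    using Q.one_closed x by (auto simp: carrier_FactGroup)
  have "q x = \<one>\<^bsub>H\<^esub> \<longleftrightarrow> e (K #>\<^bsub>G\<^esub> x) = e K" by (simp add: H_def q_def image_group_def)
  also have "\<dots> \<longleftrightarrow> K #>\<^bsub>G\<^esub> x = K" using inj KQ xQ by (auto dest: inj_onD)
  also have "\<dots> \<longleftrightarrow> x \<in> K" using x K.rcos_const rcos_self[OF x K.subgroup_axioms] group_axioms by auto
  finally show "q x = \<one>\<^bsub>H\<^esub> \<longleftrightarrow> x \<in> K" .
qed

lemma group_hom_eq_iff:
  assumes "group_hom G H q" and "x \<in> carrier G" "y \<in> carrier G"
  shows "q x = q y \<longleftrightarrow> q (x \<otimes>\<^bsub>G\<^esub> inv\<^bsub>G\<^esub> y) = \<one>\<^bsub>H\<^esub>"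
proof -
  interpret q: group_hom G H q by fact
  have "q (x \<otimes>\<^bsub>G\<^esub> inv\<^bsub>G\<^esub> y) = q x \<otimes>\<^bsub>H\<^esub> inv\<^bsub>H\<^esub> q y" using assms(2,3) by simp
  moreover have "q x \<otimes>\<^bsub>H\<^esub> inv\<^bsub>H\<^esub> q y = \<one>\<^bsub>H\<^esub> \<longleftrightarrow> q x = q y"
    using assms(2,3) q.H.inv_equality[of "q x" "inv\<^bsub>H\<^esub> q y"] by (auto simp: q.H.inv_inv)
  ultimately show ?thesis by simp
qed

context universe
begin

abbreviation AbU :: "('u monoid, 'u ab_arrow) additive_precat" where "AbU \<equiv> Ab"

lemma AbU_Obj_iff: "G \<in> Obj AbU \<longleftrightarrow> comm_group G \<and> small (carrier G)"
  by (simp add: ab_Obj_iff small_def)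

text \<open>The source of all objects of \<^const>\<open>Ab\<close> that have to be constructed: a small group over any type has few
  enough cosets to name them by elements of the universe.\<close>

lemma ab_quotient_exists:
  fixes G :: "'x monoid"
  assumes G: "comm_group G" "small (carrier G)" and K: "subgroup K G"
  obtains H q where "H \<in> Obj AbU" "q \<in> hom G H" "q ` carrier G = carrier H"
    "\<And>x. x \<in> carrier G \<Longrightarrow> q x = \<one>\<^bsub>H\<^esub> \<longleftrightarrow> x \<in> K"
proof -
  have "small (carrier (G Mod K))"
    using small_image[OF G(2)] by (simp add: carrier_FactGroup)
  then obtain e :: "'x set \<Rightarrow> 'u" where "inj_on e (carrier (G Mod K))"
    using small_inj_into by blast
  note quotient = image_of_quotient[OF G(1) K this]
  have "small (carrier (image_group e (G Mod K)))"
    using small_image[OF G(2)] quotient(3)[symmetric] by simp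
  then show thesis using that[OF _ quotient(2,3,4)] quotient(1) by (simp add: AbU_Obj_iff)
qed

lemma ab_copy_exists:
  fixes G :: "'x monoid"
  assumes G: "comm_group G" "small (carrier G)"
  obtains H e where "H \<in> Obj AbU" "e \<in> hom G H" "bij_betw e (carrier G) (carrier H)"
proof -
  interpret comm_group G by fact
  obtain H q where q: "H \<in> Obj AbU" "q \<in> hom G H" "q ` carrier G = carrier H"
    "\<And>x. x \<in> carrier G \<Longrightarrow> q x = \<one>\<^bsub>H\<^esub> \<longleftrightarrow> x \<in> {\<one>\<^bsub>G\<^esub>}"
    using ab_quotient_exists[OF G triv_subgroup] by blast
  interpret q: group_hom G H q
    using q ab_Obj_group[OF q(1)] by (auto simp: group_hom_def group_hom_axioms_def)
  have "inj_on q (carrier G)"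
    using q(4) q.inj_on_one_iff by blast
  then show thesis using that[OF q(1,2)] q(3) by (simp add: bij_betw_def)
qed

subsection \<open>Products\<close>

lemma ab_product_exists:
  assumes I: "small I" and X: "\<And>i. i \<in> I \<Longrightarrow> X i \<in> Obj AbU"
  shows "\<exists>P \<pi>. P \<in> Obj AbU \<and> (\<forall>i \<in> I. \<pi> i \<in> Hom AbU P (X i)) \<and>
    jointly_bijective I (\<lambda>i. carrier (X i)) (carrier P) (\<lambda>i. amap (\<pi> i))"
proof -
  let ?Q = "product_group I X"
  have cg: "comm_group ?Q"
  proof -
    have g: "group ?Q" using X ab_Obj_group by (intro product_group) blast
    then interpret group ?Q .
    show ?thesis
    proof (rule group_comm_groupI)
      fix x y assume "x \<in> carrier ?Q" "y \<in> carrier ?Q"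
      then have "x i \<otimes>\<^bsub>X i\<^esub> y i = y i \<otimes>\<^bsub>X i\<^esub> x i" if "i \<in> I" for i
        using that comm_monoid.m_comm[OF comm_group.axioms(1)[OF ab_Obj_comm_group[OF X[OF that]]]] by auto
      then show "x \<otimes>\<^bsub>?Q\<^esub> y = y \<otimes>\<^bsub>?Q\<^esub> x" by (simp cong: restrict_cong)
    qed
  qed
  have sm: "small (carrier ?Q)"
    using small_PiE[OF I, of "\<lambda>i. carrier (X i)"] X by (simp add: AbU_Obj_iff)
  obtain P e where P: "P \<in> Obj AbU" and e: "e \<in> hom ?Q P" "bij_betw e (carrier ?Q) (carrier P)"
    using ab_copy_exists[OF cg sm] by blast
  define d where "d = inv_into (carrier ?Q) e"
  have d: "d \<in> hom P ?Q"
    using e comm_group_is_group[OF cg] group.iso_set_sym[of ?Q e P] by (simp add: iso_def d_def)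
  have de: "d (e f) = f" if "f \<in> carrier ?Q" for f
    using bij_betw_inv_into_left[OF e(2)] that by (simp add: d_def)
  have ed: "e (d x) = x" and dP: "d x \<in> carrier ?Q" if "x \<in> carrier P" for x
    using bij_betw_inv_into_right[OF e(2)] that hom_apply_closed[OF d] by (auto simp: d_def)
  define \<pi> where "\<pi> i = ab_map P (X i) (\<lambda>x. d x i)" for i
  have pi: "\<pi> i \<in> Hom AbU P (X i)" if i: "i \<in> I" for i
  proof -
    have "(\<lambda>x. d x i) \<in> hom P (X i)"
      using hom_apply_closed[OF d] hom_apply_mult[OF d] i by (auto simp: hom_def)
    then show ?thesis unfolding \<pi>_def by (intro ab_map_in_Hom P X i)
  qed
  have "jointly_bijective I (\<lambda>i. carrier (X i)) (carrier P) (\<lambda>i. amap (\<pi> i))"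
    unfolding jointly_bijective_def
  proof (intro conjI ballI allI impI)
    fix x y assume x: "x \<in> carrier P" and y: "y \<in> carrier P"
      and eq: "\<forall>i\<in>I. amap (\<pi> i) x = amap (\<pi> i) y"
    have "d x i = d y i" if "i \<in> I" for i using eq x y that by (simp add: \<pi>_def)
    then have "d x = d y"
      using PiE_ext[of "d x" I "\<lambda>i. carrier (X i)" "d y"] dP x y by simp
    then show "x = y" using ed x y by metis
  next
    fix z assume "\<forall>i\<in>I. z i \<in> carrier (X i)"
    then have z: "restrict z I \<in> carrier ?Q" by simp
    have "e (restrict z I) \<in> carrier P" using hom_apply_closed[OF e(1) z] .
    moreover have "\<forall>i\<in>I. amap (\<pi> i) (e (restrict z I)) = z i"
      using calculation de[OF z] by (simp add: \<pi>_def)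
    ultimately show "\<exists>x\<in>carrier P. \<forall>i\<in>I. amap (\<pi> i) x = z i" by blast
  qed
  then show ?thesis using P pi by blast
qed

lemma ab_is_productI:
  assumes P: "P \<in> Obj AbU" and pi: "\<And>i. i \<in> I \<Longrightarrow> \<pi> i \<in> Hom AbU P (X i)"
    and bij: "jointly_bijective I (\<lambda>i. carrier (X i)) (carrier P) (\<lambda>i. amap (\<pi> i))"
  shows "is_product AbU I X P \<pi>"
  unfolding is_product_def
proof (intro conjI ballI allI impI)
  fix Q f assume Q: "Q \<in> Obj AbU" and f: "\<forall>i\<in>I. f i \<in> Hom AbU Q (X i)"
  interpret P: group P using P by (rule ab_Obj_group)
  interpret Q: group Q using Q by (rule ab_Obj_group)
  have "\<forall>x\<in>carrier Q. \<exists>y. y \<in> carrier P \<and> (\<forall>i\<in>I. amap (\<pi> i) y = amap (f i) x)"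
    using jointly_bijective_surj[OF bij] ab_apply_closed f by meson
  then obtain h where h: "\<And>x. x \<in> carrier Q \<Longrightarrow> h x \<in> carrier P"
    "\<And>x i. x \<in> carrier Q \<Longrightarrow> i \<in> I \<Longrightarrow> amap (\<pi> i) (h x) = amap (f i) x"
    by metis
  have "h \<in> hom Q P"
  proof (rule homI)
    fix x y assume xy: "x \<in> carrier Q" "y \<in> carrier Q"
    show "h (x \<otimes>\<^bsub>Q\<^esub> y) = h x \<otimes>\<^bsub>P\<^esub> h y"
    proof (rule jointly_bijective_inj[OF bij])
      fix i assume i: "i \<in> I"
      show "amap (\<pi> i) (h (x \<otimes>\<^bsub>Q\<^esub> y)) = amap (\<pi> i) (h x \<otimes>\<^bsub>P\<^esub> h y)"
        using xy h i f by (simp add: ab_apply_mult[OF pi[OF i]] ab_apply_mult[of "f i" Q "X i"])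
    qed (use xy h in auto)
  qed (rule h)
  then have m: "ab_map Q P h \<in> Hom AbU Q P" by (intro ab_map_in_Hom P Q)
  show "\<exists>!h. h \<in> Hom AbU Q P \<and> (\<forall>i\<in>I. Comp AbU (\<pi> i) h = f i)"
  proof (rule ex1I[of _ "ab_map Q P h"], intro conjI ballI m)
    fix i assume i: "i \<in> I"
    then have fi: "f i \<in> Hom AbU Q (X i)" using f by blast
    show "Comp AbU (\<pi> i) (ab_map Q P h) = f i"
      by (rule ab_Hom_eqI[OF ab_Comp_in_Hom[OF m pi[OF i]] fi]) (simp add: ab_Comp_apply[OF m] h i)
  next
    fix k assume k: "k \<in> Hom AbU Q P \<and> (\<forall>i\<in>I. Comp AbU (\<pi> i) k = f i)"
    then have kQ: "k \<in> Hom AbU Q P" by blast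
    show "k = ab_map Q P h"
    proof (rule ab_Hom_eqI[OF kQ m])
      fix x assume x: "x \<in> carrier Q"
      show "amap k x = amap (ab_map Q P h) x"
      proof (rule jointly_bijective_inj[OF bij])
        fix i assume i: "i \<in> I"
        have "amap (\<pi> i) (amap k x) = amap (f i) x"
          using k i ab_Comp_apply[OF kQ x, of "\<pi> i"] by simp
        then show "amap (\<pi> i) (amap k x) = amap (\<pi> i) (amap (ab_map Q P h) x)" using h x i by simp
      qed (use x h ab_apply_closed[OF kQ] in auto)
    qed
  qed
qed (use P pi in auto)

theorem ab_is_product_iff:
  assumes I: "small I" and X: "\<And>i. i \<in> I \<Longrightarrow> X i \<in> Obj AbU"
    and P: "P \<in> Obj AbU" and pi: "\<And>i. i \<in> I \<Longrightarrow> \<pi> i \<in> Hom AbU P (X i)"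
  shows "is_product AbU I X P \<pi> \<longleftrightarrow>
    jointly_bijective I (\<lambda>i. carrier (X i)) (carrier P) (\<lambda>i. amap (\<pi> i))"
proof
  assume prod: "is_product AbU I X P \<pi>"
  obtain Q \<rho> where Q: "Q \<in> Obj AbU" and rho: "\<And>i. i \<in> I \<Longrightarrow> \<rho> i \<in> Hom AbU Q (X i)"
    and bij: "jointly_bijective I (\<lambda>i. carrier (X i)) (carrier Q) (\<lambda>i. amap (\<rho> i))"
    using ab_product_exists[of I X, OF I X] by blast
  have "is_product AbU I X Q \<rho>" using ab_is_productI[OF Q rho bij] by blast
  from is_product_unique[OF category_Ab prod this]
  obtain h k where hk: "h \<in> Hom AbU P Q" "k \<in> Hom AbU Q P" "Comp Ab k h = Ident Ab P"
    "\<And>i. i \<in> I \<Longrightarrow> Comp Ab (\<rho> i) h = \<pi> i" "\<And>i. i \<in> I \<Longrightarrow> Comp Ab (\<pi> i) k = \<rho> i"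
    by blast
  show "jointly_bijective I (\<lambda>i. carrier (X i)) (carrier P) (\<lambda>i. amap (\<pi> i))"
  proof (rule jointly_bijective_transfer[OF bij, where h = "amap h" and k = "amap k"])
    show "amap k (amap h x) = x" if "x \<in> carrier P" for x
      using ab_Comp_apply[OF hk(1) that, of k] hk(3) ab_Ident_apply[OF that] by simp
    show "amap (\<rho> i) (amap h x) = amap (\<pi> i) x" if "i \<in> I" "x \<in> carrier P" for i x
      using ab_Comp_apply[OF hk(1) that(2), of "\<rho> i"] hk(4)[OF that(1)] by simp
    show "amap (\<pi> i) (amap k x) = amap (\<rho> i) x" if "i \<in> I" "x \<in> carrier Q" for i x
      using ab_Comp_apply[OF hk(2) that(2), of "\<pi> i"] hk(5)[OF that(1)] by simp
  qed (use ab_apply_closed[OF hk(1)] ab_apply_closed[OF hk(2)] in auto)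
qed (use ab_is_productI P pi in blast)

subsection \<open>Directed colimits\<close>

lemma ab_poset_diagramD:
  assumes "poset_diagram Ab I r X T" and "r \<subseteq> I \<times> I"
  shows "i \<in> I \<Longrightarrow> X i \<in> Obj Ab" "(i, j) \<in> r \<Longrightarrow> T i j \<in> Hom Ab (X i) (X j)"
    "i \<in> I \<Longrightarrow> x \<in> carrier (X i) \<Longrightarrow> amap (T i i) x = x"
    "(i, j) \<in> r \<Longrightarrow> (j, k) \<in> r \<Longrightarrow> x \<in> carrier (X i) \<Longrightarrow> amap (T j k) (amap (T i j) x) = amap (T i k) x"
proof -
  show "i \<in> I \<Longrightarrow> X i \<in> Obj Ab" using assms(1) by (simp add: poset_diagram_def)
  show T: "(i, j) \<in> r \<Longrightarrow> T i j \<in> Hom Ab (X i) (X j)" for i j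
    using assms(1) by (auto simp: poset_diagram_def)
  show "i \<in> I \<Longrightarrow> x \<in> carrier (X i) \<Longrightarrow> amap (T i i) x = x"
    using assms(1) by (simp add: poset_diagram_def ab_Ident_apply)
  assume ij: "(i, j) \<in> r" and jk: "(j, k) \<in> r" and x: "x \<in> carrier (X i)"
  have "T i k = Comp Ab (T j k) (T i j)" using assms(1) ij jk unfolding poset_diagram_def by blast
  then show "amap (T j k) (amap (T i j) x) = amap (T i k) x"
    using ab_Comp_apply[OF T[OF ij] x] by simp
qed

text \<open>The colimit is realised by germs. In the product of all \<open>X i\<close>, the families that are trivial from some
  index on form a subgroup. An element \<open>x\<close> of \<open>X i\<close> gives the family with value \<open>T i j x\<close> at each \<open>j\<close>
  above \<open>i\<close> and \<open>\<one>\<close> elsewhere, and modulo that subgroup this depends only on the germ of \<open>x\<close>. By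
  directedness the classes of such families form a subgroup of the quotient, which is the colimit.\<close>

lemma ab_colimit_exists:
  assumes I: "small I" and dir: "directed_poset natLeq I r" and diag: "poset_diagram AbU I r X T"
  shows "\<exists>L c. is_cocone AbU I r X T L c \<and>
    elementwise_colimit I r (\<lambda>i. carrier (X i)) (\<lambda>i j. amap (T i j)) (carrier L) (\<lambda>i. amap (c i))"
proof -
  note rI = directed_posetD(1)[OF dir] and r_refl = directed_posetD(2)[OF dir]
  have r_trans: "(i, k) \<in> r" if "(i, j) \<in> r" "(j, k) \<in> r" for i j k
    using directed_posetD(3)[OF dir] that by (meson transD)
  note X = ab_poset_diagramD(1)[OF diag rI] and T = ab_poset_diagramD(2)[OF diag rI]
    and T_id = ab_poset_diagramD(3)[OF diag rI] and T_comp = ab_poset_diagramD(4)[OF diag rI]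
  obtain P \<pi> where P: "P \<in> Obj AbU" and pi: "\<forall>i \<in> I. \<pi> i \<in> Hom AbU P (X i)"
    and bij: "jointly_bijective I (\<lambda>i. carrier (X i)) (carrier P) (\<lambda>i. amap (\<pi> i))"
    using ab_product_exists[of I X, OF I X] by blast
  interpret P: comm_group P using P by (rule ab_Obj_comm_group)
  have pi_hom: "group_hom P (X i) (amap (\<pi> i))" if "i \<in> I" for i
    using pi that ab_apply_hom by blast
  have Xg: "group (X i)" if "i \<in> I" for i using X[OF that] by (rule ab_Obj_group)
  \<comment> \<open>the families that are eventually trivial\<close>
  define Z where "Z = {x \<in> carrier P. \<exists>i\<in>I. \<forall>j. (i, j) \<in> r \<longrightarrow> amap (\<pi> j) x = \<one>\<^bsub>X j\<^esub>}"
  have rI2: "j \<in> I" if "(i, j) \<in> r" for i j using rI that by blast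
  have Z: "subgroup Z P"
  proof (rule P.subgroupI)
    show "Z \<subseteq> carrier P" by (auto simp: Z_def)
    obtain i where "i \<in> I" using directed_poset_nonempty[OF dir] by blast
    then have "\<one>\<^bsub>P\<^esub> \<in> Z"
      using rI2 group_hom.hom_one[OF pi_hom] by (auto simp: Z_def)
    then show "Z \<noteq> {}" by blast
    fix x assume "x \<in> Z"
    then obtain i where x: "x \<in> carrier P" and i: "i \<in> I" "\<And>j. (i, j) \<in> r \<Longrightarrow> amap (\<pi> j) x = \<one>\<^bsub>X j\<^esub>"
      by (auto simp: Z_def)
    have "amap (\<pi> j) (inv\<^bsub>P\<^esub> x) = \<one>\<^bsub>X j\<^esub>" if "(i, j) \<in> r" for j
      using group_hom.hom_inv[OF pi_hom[OF rI2[OF that]] x] i(2)[OF that]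
        group.is_monoid[OF Xg[OF rI2[OF that]]] by (simp add: monoid.inv_one)
    then show "inv\<^bsub>P\<^esub> x \<in> Z" using x i(1) by (auto simp: Z_def)
    fix y assume "y \<in> Z"
    then obtain i' where y: "y \<in> carrier P" and i': "i' \<in> I" "\<And>j. (i', j) \<in> r \<Longrightarrow> amap (\<pi> j) y = \<one>\<^bsub>X j\<^esub>"
      by (auto simp: Z_def)
    obtain u where u: "u \<in> I" "(i, u) \<in> r" "(i', u) \<in> r" using directed_poset_two[OF dir i(1) i'(1)] by blast
    have "amap (\<pi> j) (x \<otimes>\<^bsub>P\<^esub> y) = \<one>\<^bsub>X j\<^esub>" if "(u, j) \<in> r" for j
      using group_hom.hom_mult[OF pi_hom[OF rI2[OF that]] x y] i(2) i'(2) r_trans[OF u(2) that] r_trans[OF u(3) that]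
        group.is_monoid[OF Xg[OF rI2[OF that]]] by (simp add: monoid.l_one)
    then show "x \<otimes>\<^bsub>P\<^esub> y \<in> Z" using x y u(1) by (auto simp: Z_def)
  qed
  have "small (carrier P)" using P by (simp add: AbU_Obj_iff)
  then obtain H q where H: "H \<in> Obj AbU" and q: "q \<in> hom P H" and "q ` carrier P = carrier H"
    and qZ: "\<And>x. x \<in> carrier P \<Longrightarrow> q x = \<one>\<^bsub>H\<^esub> \<longleftrightarrow> x \<in> Z"
    using ab_quotient_exists[OF P.comm_group_axioms _ Z] by blast
  interpret H: comm_group H using H by (rule ab_Obj_comm_group)
  have q_eq: "q x = q y \<longleftrightarrow> x \<otimes>\<^bsub>P\<^esub> inv\<^bsub>P\<^esub> y \<in> Z" if "x \<in> carrier P" "y \<in> carrier P" for x y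
    using group_hom_eq_iff[of P H q x y] qZ[of "x \<otimes>\<^bsub>P\<^esub> inv\<^bsub>P\<^esub> y"] q that P.group_axioms H.group_axioms
    by (simp add: group_hom_def group_hom_axioms_def)
  have quot: "amap (\<pi> j) (x \<otimes>\<^bsub>P\<^esub> inv\<^bsub>P\<^esub> y) = \<one>\<^bsub>X j\<^esub> \<longleftrightarrow> amap (\<pi> j) x = amap (\<pi> j) y"
    if "j \<in> I" "x \<in> carrier P" "y \<in> carrier P" for j x y
    by (rule group_hom_eq_iff[OF pi_hom[OF that(1)] that(2,3), symmetric])
  \<comment> \<open>the family attached to an element of \<open>X i\<close>\<close>
  define coord where "coord i x j = (if (i, j) \<in> r then amap (T i j) x else \<one>\<^bsub>X j\<^esub>)" for i x j
  have ex: "\<exists>y\<in>carrier P. \<forall>j\<in>I. amap (\<pi> j) y = coord i x j" if "x \<in> carrier (X i)" for i x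
  proof (rule jointly_bijective_surj[OF bij])
    fix j assume "j \<in> I"
    then show "coord i x j \<in> carrier (X j)"
      using ab_apply_closed[OF T that] monoid.one_closed[OF group.is_monoid[OF Xg]] by (auto simp: coord_def)
  qed
  define E where "E i x = (SOME y. y \<in> carrier P \<and> (\<forall>j\<in>I. amap (\<pi> j) y = coord i x j))" for i x
  have E_all: "E i x \<in> carrier P \<and> (\<forall>j\<in>I. amap (\<pi> j) (E i x) = coord i x j)" if "x \<in> carrier (X i)" for i x
    unfolding E_def by (rule someI_ex[OF ex[OF that, unfolded Bex_def]])
  have E: "E i x \<in> carrier P" if "x \<in> carrier (X i)" for i x
    using E_all[OF that] by blast
  have E_pi: "amap (\<pi> j) (E i x) = coord i x j" if "x \<in> carrier (X i)" "j \<in> I" for i x j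
    using E_all[OF that(1)] that(2) by blast
  define \<gamma> where "\<gamma> i x = q (E i x)" for i x
  have gamma_hom: "\<gamma> i \<in> hom (X i) H" if i: "i \<in> I" for i
  proof (rule homI)
    interpret Xi: group "X i" by (rule Xg[OF i])
    show "\<gamma> i x \<in> carrier H" if "x \<in> carrier (X i)" for x
      using hom_apply_closed[OF q E[OF that]] by (simp add: \<gamma>_def)
    fix x y assume x: "x \<in> carrier (X i)" and y: "y \<in> carrier (X i)"
    have "E i (x \<otimes>\<^bsub>X i\<^esub> y) = E i x \<otimes>\<^bsub>P\<^esub> E i y"
    proof (rule jointly_bijective_inj[OF bij])
      fix j assume j: "j \<in> I"
      interpret Xj: group "X j" by (rule Xg[OF j])
      show "amap (\<pi> j) (E i (x \<otimes>\<^bsub>X i\<^esub> y)) = amap (\<pi> j) (E i x \<otimes>\<^bsub>P\<^esub> E i y)"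
        using x y j by (simp add: E_pi group_hom.hom_mult[OF pi_hom[OF j] E E] coord_def ab_apply_mult[OF T])
    qed (use E x y in auto)
    then show "\<gamma> i (x \<otimes>\<^bsub>X i\<^esub> y) = \<gamma> i x \<otimes>\<^bsub>H\<^esub> \<gamma> i y"
      using hom_apply_mult[OF q E[OF x] E[OF y]] by (simp add: \<gamma>_def)
  qed
  \<comment> \<open>the families of \<open>x\<close> and of \<open>T i j x\<close> agree above \<open>j\<close>\<close>
  have gamma_T: "\<gamma> j (amap (T i j) x) = \<gamma> i x" if ij: "(i, j) \<in> r" and x: "x \<in> carrier (X i)" for i j x
  proof -
    have y: "amap (T i j) x \<in> carrier (X j)" by (rule ab_apply_closed[OF T[OF ij] x])
    have "amap (\<pi> k) (E j (amap (T i j) x)) = amap (\<pi> k) (E i x)" if jk: "(j, k) \<in> r" for k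
      using rI2[OF jk] jk r_trans[OF ij jk] T_comp[OF ij jk x] by (simp add: E_pi x y coord_def)
    then have "E j (amap (T i j) x) \<otimes>\<^bsub>P\<^esub> inv\<^bsub>P\<^esub> E i x \<in> Z"
      using quot[OF rI2 E[OF y] E[OF x]] E[OF y] E[OF x] rI2[OF ij] by (auto simp: Z_def)
    then show ?thesis using q_eq[OF E[OF y] E[OF x]] by (simp add: \<gamma>_def)
  qed
  have gamma_eq: "\<exists>j. (i, j) \<in> r \<and> amap (T i j) x = amap (T i j) y"
    if i: "i \<in> I" and x: "x \<in> carrier (X i)" and y: "y \<in> carrier (X i)" and eq: "\<gamma> i x = \<gamma> i y" for i x y
  proof -
    have "E i x \<otimes>\<^bsub>P\<^esub> inv\<^bsub>P\<^esub> E i y \<in> Z" using eq q_eq[OF E[OF x] E[OF y]] by (simp add: \<gamma>_def)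
    then obtain k where k: "k \<in> I" "\<And>j. (k, j) \<in> r \<Longrightarrow> amap (\<pi> j) (E i x \<otimes>\<^bsub>P\<^esub> inv\<^bsub>P\<^esub> E i y) = \<one>\<^bsub>X j\<^esub>"
      by (auto simp: Z_def)
    obtain u where u: "u \<in> I" "(i, u) \<in> r" "(k, u) \<in> r" using directed_poset_two[OF dir i k(1)] by blast
    have "coord i x u = coord i y u"
      using k(2)[OF u(3)] quot[OF u(1) E[OF x] E[OF y]] E_pi[OF x u(1)] E_pi[OF y u(1)] by simp
    then show ?thesis using u(2) by (auto simp: coord_def)
  qed
  define S where "S = (\<Union>i\<in>I. \<gamma> i ` carrier (X i))"
  define L where "L = H\<lparr>carrier := S\<rparr>"
  have gamma_S: "\<gamma> i x \<in> S" if "i \<in> I" "x \<in> carrier (X i)" for i x using that by (auto simp: S_def)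
  have gh: "group_hom (X i) H (\<gamma> i)" if "i \<in> I" for i
    using Xg[OF that] H.group_axioms gamma_hom[OF that] by (simp add: group_hom_def group_hom_axioms_def)
  have S: "subgroup S H"
  proof (rule H.subgroupI)
    show "S \<subseteq> carrier H" using hom_apply_closed[OF gamma_hom] by (auto simp: S_def)
    obtain i where "i \<in> I" using directed_poset_nonempty[OF dir] by blast
    then show "S \<noteq> {}" using monoid.one_closed[OF group.is_monoid[OF Xg]] by (auto simp: S_def)
    fix a assume "a \<in> S"
    then obtain i x where i: "i \<in> I" "x \<in> carrier (X i)" "a = \<gamma> i x" by (auto simp: S_def)
    show "inv\<^bsub>H\<^esub> a \<in> S"
      using group_hom.hom_inv[OF gh[OF i(1)] i(2), symmetric] group.inv_closed[OF Xg[OF i(1)] i(2)] gamma_S[OF i(1)] i(3)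
      by simp
    fix b assume "b \<in> S"
    then obtain j y where j: "j \<in> I" "y \<in> carrier (X j)" "b = \<gamma> j y" by (auto simp: S_def)
    obtain u where u: "u \<in> I" "(i, u) \<in> r" "(j, u) \<in> r" using directed_poset_two[OF dir i(1) j(1)] by blast
    let ?x = "amap (T i u) x" and ?y = "amap (T j u) y"
    have xy: "?x \<in> carrier (X u)" "?y \<in> carrier (X u)"
      using ab_apply_closed[OF T[OF u(2)] i(2)] ab_apply_closed[OF T[OF u(3)] j(2)] .
    have "a \<otimes>\<^bsub>H\<^esub> b = \<gamma> u (?x \<otimes>\<^bsub>X u\<^esub> ?y)"
      using gamma_T[OF u(2) i(2)] gamma_T[OF u(3) j(2)] i(3) j(3) hom_apply_mult[OF gamma_hom[OF u(1)] xy] by simp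
    then show "a \<otimes>\<^bsub>H\<^esub> b \<in> S"
      using gamma_S[OF u(1)] monoid.m_closed[OF group.is_monoid[OF Xg[OF u(1)]] xy] by simp
  qed
  have L: "L \<in> Obj AbU"
    using H.subgroup_imp_comm_group[OF S] small_subset[OF subgroup.subset[OF S]] H
    by (simp add: AbU_Obj_iff L_def)
  define c where "c i = ab_map (X i) L (\<gamma> i)" for i
  have c: "c i \<in> Hom AbU (X i) L" if "i \<in> I" for i
  proof -
    have "\<gamma> i \<in> hom (X i) L" using gamma_hom[OF that] gamma_S[OF that] by (auto simp: hom_def L_def)
    then show ?thesis unfolding c_def by (rule ab_map_in_Hom[OF X[OF that] L])
  qed
  have "is_cocone AbU I r X T L c"
    unfolding is_cocone_def
  proof (intro conjI ballI, goal_cases)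
    case (3 p)
    obtain i j where p: "p = (i, j)" by (cases p)
    then have ij: "(i, j) \<in> r" using 3 by simp
    then have i: "i \<in> I" and j: "j \<in> I" using rI by auto
    have "Comp AbU (c j) (T i j) = c i"
      by (rule ab_Hom_eqI[OF ab_Comp_in_Hom[OF T[OF ij] c[OF j]] c[OF i]])
        (simp add: ab_Comp_apply[OF T[OF ij]] ab_apply_closed[OF T[OF ij]] c_def gamma_T[OF ij])
    then show ?case by (simp add: p)
  qed (use L c in auto)
  moreover have "elementwise_colimit I r (\<lambda>i. carrier (X i)) (\<lambda>i j. amap (T i j)) (carrier L) (\<lambda>i. amap (c i))"
    unfolding elementwise_colimit_def
  proof (intro conjI ballI impI)
    fix z assume "z \<in> carrier L"
    then show "\<exists>i\<in>I. \<exists>x\<in>carrier (X i). amap (c i) x = z" by (auto simp: L_def S_def c_def)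
  next
    fix i x y assume "i \<in> I" "x \<in> carrier (X i)" "y \<in> carrier (X i)" "amap (c i) x = amap (c i) y"
    then show "\<exists>j. (i, j) \<in> r \<and> amap (T i j) x = amap (T i j) y"
      by (intro gamma_eq) (simp_all add: c_def)
  qed
  ultimately show ?thesis by blast
qed

lemma ab_is_coconeD:
  assumes "is_cocone Ab I r X T L c"
  shows "L \<in> Obj Ab" "i \<in> I \<Longrightarrow> c i \<in> Hom Ab (X i) L"
    "(i, j) \<in> r \<Longrightarrow> Comp Ab (c j) (T i j) = c i"
  using assms unfolding is_cocone_def by auto

lemma ab_cocone_apply:
  assumes "is_cocone Ab I r X T L c" and "(i, j) \<in> r" and "T i j \<in> Hom Ab (X i) (X j)" and "x \<in> carrier (X i)"
  shows "amap (c j) (amap (T i j) x) = amap (c i) x"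
  using ab_Comp_apply[OF assms(3,4), of "c j"] ab_is_coconeD(3)[OF assms(1,2)] by simp

lemma ab_is_colimitI:
  assumes dir: "directed_poset natLeq I r" and diag: "poset_diagram AbU I r X T"
    and cocone: "is_cocone AbU I r X T L c"
    and col: "elementwise_colimit I r (\<lambda>i. carrier (X i)) (\<lambda>i j. amap (T i j)) (carrier L) (\<lambda>i. amap (c i))"
  shows "is_colimit AbU I r X T L c"
  unfolding is_colimit_def
proof (intro conjI allI impI cocone)
  fix Q d assume cone: "is_cocone AbU I r X T Q d"
  note rI = directed_posetD(1)[OF dir]
  note T = ab_poset_diagramD(2)[OF diag rI]
  note L = ab_is_coconeD(1)[OF cocone] and c = ab_is_coconeD(2)[OF cocone]
    and Q = ab_is_coconeD(1)[OF cone] and d = ab_is_coconeD(2)[OF cone]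
  interpret L: group L using L by (rule ab_Obj_group)
  interpret Q: group Q using Q by (rule ab_Obj_group)
  \<comment> \<open>compare both elements at a common later stage\<close>
  have ind: "amap (d i) x = amap (d j) y"
    if i: "i \<in> I" "x \<in> carrier (X i)" and j: "j \<in> I" "y \<in> carrier (X j)" and eq: "amap (c i) x = amap (c j) y" for i j x y
  proof -
    obtain u where u: "u \<in> I" "(i, u) \<in> r" "(j, u) \<in> r" using directed_poset_two[OF dir i(1) j(1)] by blast
    have Tx: "amap (T i u) x \<in> carrier (X u)" and Ty: "amap (T j u) y \<in> carrier (X u)"
      using ab_apply_closed[OF T[OF u(2)] i(2)] ab_apply_closed[OF T[OF u(3)] j(2)] .
    have "amap (c u) (amap (T i u) x) = amap (c u) (amap (T j u) y)"
      using ab_cocone_apply[OF cocone u(2) T[OF u(2)] i(2)] ab_cocone_apply[OF cocone u(3) T[OF u(3)] j(2)] eq by simp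
    then obtain v where v: "(u, v) \<in> r" "amap (T u v) (amap (T i u) x) = amap (T u v) (amap (T j u) y)"
      using elementwise_colimit_eq[OF col u(1) Tx Ty] by blast
    show ?thesis
      using v(2) ab_cocone_apply[OF cone v(1) T[OF v(1)] Tx] ab_cocone_apply[OF cone v(1) T[OF v(1)] Ty]
        ab_cocone_apply[OF cone u(2) T[OF u(2)] i(2)] ab_cocone_apply[OF cone u(3) T[OF u(3)] j(2)] by simp
  qed
  have "\<exists>w. \<exists>i\<in>I. \<exists>x\<in>carrier (X i). amap (c i) x = z \<and> amap (d i) x = w" if "z \<in> carrier L" for z
    using elementwise_colimit_surj[OF col that] by blast
  then obtain h where h: "\<And>z. z \<in> carrier L \<Longrightarrow> \<exists>i\<in>I. \<exists>x\<in>carrier (X i). amap (c i) x = z \<and> amap (d i) x = h z"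
    by metis
  have h_c: "h (amap (c i) x) = amap (d i) x" if i: "i \<in> I" "x \<in> carrier (X i)" for i x
  proof -
    obtain j y where "j \<in> I" "y \<in> carrier (X j)" "amap (c j) y = amap (c i) x" "amap (d j) y = h (amap (c i) x)"
      using h[OF ab_apply_closed[OF c[OF i(1)] i(2)]] by blast
    then show ?thesis using ind[OF i, of j y] by simp
  qed
  have "h \<in> hom L Q"
  proof (rule homI)
    show "h z \<in> carrier Q" if z: "z \<in> carrier L" for z
      using h[OF z] ab_apply_closed[OF d] by metis
    fix z w assume z: "z \<in> carrier L" and w: "w \<in> carrier L"
    obtain i x where i: "i \<in> I" "x \<in> carrier (X i)" "z = amap (c i) x"
      using elementwise_colimit_surj[OF col z] by blast
    obtain j y where j: "j \<in> I" "y \<in> carrier (X j)" "w = amap (c j) y"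
      using elementwise_colimit_surj[OF col w] by blast
    obtain u where u: "u \<in> I" "(i, u) \<in> r" "(j, u) \<in> r" using directed_poset_two[OF dir i(1) j(1)] by blast
    let ?x = "amap (T i u) x" and ?y = "amap (T j u) y"
    have xy: "?x \<in> carrier (X u)" "?y \<in> carrier (X u)"
      using ab_apply_closed[OF T[OF u(2)] i(2)] ab_apply_closed[OF T[OF u(3)] j(2)] .
    have zw: "z = amap (c u) ?x" "w = amap (c u) ?y"
      using ab_cocone_apply[OF cocone u(2) T[OF u(2)] i(2)] ab_cocone_apply[OF cocone u(3) T[OF u(3)] j(2)] i(3) j(3) by auto
    interpret Xu: group "X u" by (rule ab_Obj_group[OF ab_poset_diagramD(1)[OF diag rI u(1)]])
    show "h (z \<otimes>\<^bsub>L\<^esub> w) = h z \<otimes>\<^bsub>Q\<^esub> h w"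
      using ab_apply_mult[OF c[OF u(1)] xy] ab_apply_mult[OF d[OF u(1)] xy]
        h_c[OF u(1) xy(1)] h_c[OF u(1) xy(2)] h_c[OF u(1) Xu.m_closed[OF xy]] zw by simp
  qed
  then have m: "ab_map L Q h \<in> Hom AbU L Q" by (rule ab_map_in_Hom[OF L Q])
  show "\<exists>!h. h \<in> Hom AbU L Q \<and> (\<forall>i\<in>I. Comp AbU h (c i) = d i)"
  proof (rule ex1I[of _ "ab_map L Q h"], intro conjI ballI m)
    fix i assume i: "i \<in> I"
    show "Comp AbU (ab_map L Q h) (c i) = d i"
      by (rule ab_Hom_eqI[OF ab_Comp_in_Hom[OF c[OF i] m] d[OF i]])
        (simp add: ab_Comp_apply[OF c[OF i]] ab_apply_closed[OF c[OF i]] h_c[OF i])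
  next
    fix k assume k: "k \<in> Hom AbU L Q \<and> (\<forall>i\<in>I. Comp AbU k (c i) = d i)"
    then have kL: "k \<in> Hom AbU L Q" by blast
    show "k = ab_map L Q h"
    proof (rule ab_Hom_eqI[OF kL m])
      fix z assume z: "z \<in> carrier L"
      obtain i x where i: "i \<in> I" "x \<in> carrier (X i)" "z = amap (c i) x"
        using elementwise_colimit_surj[OF col z] by blast
      have "amap k z = amap (d i) x" using k i ab_Comp_apply[OF c[OF i(1)] i(2), of k] by simp
      then show "amap k z = amap (ab_map L Q h) z" using z h_c[OF i(1,2)] i(3) by simp
    qed
  qed
qed

theorem ab_is_colimit_iff:
  assumes I: "small I" and dir: "directed_poset natLeq I r" and diag: "poset_diagram AbU I r X T"
    and cocone: "is_cocone AbU I r X T L c"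
  shows "is_colimit AbU I r X T L c \<longleftrightarrow>
    elementwise_colimit I r (\<lambda>i. carrier (X i)) (\<lambda>i j. amap (T i j)) (carrier L) (\<lambda>i. amap (c i))"
proof
  assume colim: "is_colimit AbU I r X T L c"
  obtain M d where cone: "is_cocone AbU I r X T M d"
    and col: "elementwise_colimit I r (\<lambda>i. carrier (X i)) (\<lambda>i j. amap (T i j)) (carrier M) (\<lambda>i. amap (d i))"
    using ab_colimit_exists[OF I dir diag] by blast
  from is_colimit_unique[OF category_Ab colim ab_is_colimitI[OF dir diag cone col]]
  obtain h k where hk: "h \<in> Hom AbU L M" "k \<in> Hom AbU M L" "Comp Ab k h = Ident Ab L"
    "\<And>i. i \<in> I \<Longrightarrow> Comp Ab h (c i) = d i" "\<And>i. i \<in> I \<Longrightarrow> Comp Ab k (d i) = c i"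
    by blast
  show "elementwise_colimit I r (\<lambda>i. carrier (X i)) (\<lambda>i j. amap (T i j)) (carrier L) (\<lambda>i. amap (c i))"
  proof (rule elementwise_colimit_transfer[OF col, where h = "amap h" and k = "amap k"])
    show "amap k (amap h x) = x" if "x \<in> carrier L" for x
      using ab_Comp_apply[OF hk(1) that, of k] hk(3) ab_Ident_apply[OF that] by simp
    show "amap h (amap (c i) x) = amap (d i) x" if "i \<in> I" "x \<in> carrier (X i)" for i x
      using ab_Comp_apply[OF ab_is_coconeD(2)[OF cocone that(1)] that(2), of h] hk(4)[OF that(1)] by simp
    show "amap k (amap (d i) x) = amap (c i) x" if "i \<in> I" "x \<in> carrier (X i)" for i x
      using ab_Comp_apply[OF ab_is_coconeD(2)[OF cone that(1)] that(2), of k] hk(5)[OF that(1)] by simp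
    show "amap h x \<in> carrier M" if "x \<in> carrier L" for x by (rule ab_apply_closed[OF hk(1) that])
  qed
qed (rule ab_is_colimitI[OF dir diag cocone])

end

section \<open>Modules over a small additive category\<close>

abbreviation el :: "('o, 'a, 'u) lmod \<Rightarrow> 'o \<Rightarrow> 'u set" where
  "el M k \<equiv> carrier (ObjMap M k)"

abbreviation act :: "('o, 'a, 'u) lmod \<Rightarrow> 'a \<Rightarrow> 'u \<Rightarrow> 'u" where
  "act M f \<equiv> amap (ArrMap M f)"

abbreviation comp_at :: "('o, 'a, 'u) lmod_arrow \<Rightarrow> 'o \<Rightarrow> 'u \<Rightarrow> 'u" where
  "comp_at t k \<equiv> amap (amap t k)"

locale small_additive_category = universe U + additive_category R
  for U :: "'u itself" and R :: "('o, 'a) additive_precat" +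
  assumes small_Obj: "small (Obj R)" and small_Arr: "small (Arr R)"
begin

abbreviation LM :: "(('o, 'a, 'u) lmod, ('o, 'a, 'u) lmod_arrow) precat" where
  "LM \<equiv> left_modules R"

lemma category_LM: "category LM"
  unfolding left_modules_def
  by (intro category_full_subcat category_functor_cat category_axioms category_Ab)

lemma LM_Obj_iff: "M \<in> Obj LM \<longleftrightarrow> is_additive_functor R AbU M"
  by (auto simp: left_modules_def full_subcat_Obj functor_cat_def is_additive_functor_def)

lemma HomGrp_mult_closed:
  assumes "f \<in> Hom R a b" and "g \<in> Hom R a b"
  shows "f \<otimes>\<^bsub>HomGrp R a b\<^esub> g \<in> Hom R a b"
proof -
  interpret comm_group "HomGrp R a b" by (rule HomGrp_comm_group[OF Hom_Obj[OF assms(1)]])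
  show ?thesis using m_closed assms HomGrp_carrier[OF Hom_Obj[OF assms(1)]] by simp
qed

lemma HomGrp_one_closed: "a \<in> Obj R \<Longrightarrow> b \<in> Obj R \<Longrightarrow> \<one>\<^bsub>HomGrp R a b\<^esub> \<in> Hom R a b"
  using comm_group_is_group[OF HomGrp_comm_group] HomGrp_carrier
  by (metis group.is_monoid monoid.one_closed)

context
  fixes M assumes M: "M \<in> Obj LM"
begin

lemma mod_functor: "is_functor R AbU M"
  using M by (simp add: LM_Obj_iff is_additive_functor_def)

lemma mod_Obj: "k \<in> Obj R \<Longrightarrow> ObjMap M k \<in> Obj AbU"
  by (rule is_functorD(1)[OF mod_functor])

lemma mod_comm_group: "k \<in> Obj R \<Longrightarrow> comm_group (ObjMap M k)"
  by (rule ab_Obj_comm_group[OF mod_Obj])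

lemma mod_group: "k \<in> Obj R \<Longrightarrow> group (ObjMap M k)"
  by (rule ab_Obj_group[OF mod_Obj])

lemma mod_small: "k \<in> Obj R \<Longrightarrow> small (el M k)"
  using mod_Obj AbU_Obj_iff by blast

lemma mod_Arr: "f \<in> Hom R a b \<Longrightarrow> ArrMap M f \<in> Hom AbU (ObjMap M a) (ObjMap M b)"
  using is_functorD(2)[OF mod_functor] Hom_Obj by blast

lemma mod_one_closed: "k \<in> Obj R \<Longrightarrow> \<one>\<^bsub>ObjMap M k\<^esub> \<in> el M k"
  by (rule monoid.one_closed[OF group.is_monoid[OF mod_group]])

lemma mod_mult_closed:
  "k \<in> Obj R \<Longrightarrow> x \<in> el M k \<Longrightarrow> y \<in> el M k \<Longrightarrow> x \<otimes>\<^bsub>ObjMap M k\<^esub> y \<in> el M k"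
  by (rule monoid.m_closed[OF group.is_monoid[OF mod_group]])

lemma act_closed: "f \<in> Hom R a b \<Longrightarrow> x \<in> el M a \<Longrightarrow> act M f x \<in> el M b"
  by (rule ab_apply_closed[OF mod_Arr])

lemma act_mult: "f \<in> Hom R a b \<Longrightarrow> x \<in> el M a \<Longrightarrow> y \<in> el M a \<Longrightarrow>
    act M f (x \<otimes>\<^bsub>ObjMap M a\<^esub> y) = act M f x \<otimes>\<^bsub>ObjMap M b\<^esub> act M f y"
  by (rule ab_apply_mult[OF mod_Arr])

lemma act_one: "f \<in> Hom R a b \<Longrightarrow> act M f \<one>\<^bsub>ObjMap M a\<^esub> = \<one>\<^bsub>ObjMap M b\<^esub>"
  by (rule ab_apply_one[OF mod_Arr])

lemma act_Comp:
  assumes "f \<in> Hom R a b" and "g \<in> Hom R b c" and "x \<in> el M a"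
  shows "act M (Comp R g f) x = act M g (act M f x)"
  using is_functorD(4)[OF mod_functor Hom_Obj[OF assms(1)] Hom_Obj(2)[OF assms(2)] assms(1,2)]
    ab_Comp_apply[OF mod_Arr[OF assms(1)] assms(3)] by simp

lemma act_Ident: "k \<in> Obj R \<Longrightarrow> x \<in> el M k \<Longrightarrow> act M (Ident R k) x = x"
  using is_functorD(3)[OF mod_functor] ab_Ident_apply by simp

lemma act_add:
  assumes f: "f \<in> Hom R a b" and g: "g \<in> Hom R a b" and x: "x \<in> el M a"
  shows "act M (f \<otimes>\<^bsub>HomGrp R a b\<^esub> g) x = act M f x \<otimes>\<^bsub>ObjMap M b\<^esub> act M g x"
proof -
  note ab = Hom_Obj[OF f]
  have "ArrMap M \<in> hom (HomGrp R a b) (HomGrp Ab (ObjMap M a) (ObjMap M b))"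
    using M ab by (simp add: LM_Obj_iff is_additive_functor_def)
  from hom_apply_mult[OF this] have "ArrMap M (f \<otimes>\<^bsub>HomGrp R a b\<^esub> g)
      = ArrMap M f \<otimes>\<^bsub>HomGrp Ab (ObjMap M a) (ObjMap M b)\<^esub> ArrMap M g"
    using f g HomGrp_carrier[OF ab] by simp
  then show ?thesis using x by (simp add: Ab_def)
qed

lemma act_zero:
  assumes a: "a \<in> Obj R" and b: "b \<in> Obj R" and x: "x \<in> el M a"
  shows "act M \<one>\<^bsub>HomGrp R a b\<^esub> x = \<one>\<^bsub>ObjMap M b\<^esub>"
proof -
  interpret H: comm_group "HomGrp R a b" by (rule HomGrp_comm_group[OF a b])
  interpret B: group "ObjMap M b" by (rule mod_group[OF b])
  let ?z = "\<one>\<^bsub>HomGrp R a b\<^esub>"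
  have z: "?z \<in> Hom R a b" by (rule HomGrp_one_closed[OF a b])
  have "act M ?z x \<otimes>\<^bsub>ObjMap M b\<^esub> act M ?z x = act M ?z x"
    using act_add[OF z z x] by simp
  then show ?thesis using B.l_cancel_one act_closed[OF z x] by blast
qed

end

text \<open>Additivity and functoriality of a family of groups with an action of the arrows can be tested on elements.\<close>

lemma LM_intro:
  assumes P: "\<And>k. k \<in> Obj R \<Longrightarrow> P k \<in> Obj AbU"
    and H: "\<And>a b f. f \<in> Hom R a b \<Longrightarrow> H f \<in> Hom AbU (P a) (P b)"
    and Ident: "\<And>k x. k \<in> Obj R \<Longrightarrow> x \<in> carrier (P k) \<Longrightarrow> amap (H (Ident R k)) x = x"
    and Comp: "\<And>a b c f g x. f \<in> Hom R a b \<Longrightarrow> g \<in> Hom R b c \<Longrightarrow> x \<in> carrier (P a) \<Longrightarrow>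
      amap (H (Comp R g f)) x = amap (H g) (amap (H f) x)"
    and add: "\<And>a b f g x. f \<in> Hom R a b \<Longrightarrow> g \<in> Hom R a b \<Longrightarrow> x \<in> carrier (P a) \<Longrightarrow>
      amap (H (f \<otimes>\<^bsub>HomGrp R a b\<^esub> g)) x = amap (H f) x \<otimes>\<^bsub>P b\<^esub> amap (H g) x"
  shows "\<lparr>ObjMap = P, ArrMap = H\<rparr> \<in> Obj LM"
proof -
  have fn: "is_functor R AbU \<lparr>ObjMap = P, ArrMap = H\<rparr>"
    unfolding is_functor_def fctr.simps
  proof (intro conjI ballI P H)
    fix a assume a: "a \<in> Obj R"
    show "H (Ident R a) = Ident AbU (P a)"
      by (rule ab_Hom_eqI[OF H[OF Ident_closed[OF a]] ab_Ident_in_Hom[OF P[OF a]]])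
        (simp add: Ident[OF a] ab_Ident_apply)
    fix b c f g assume f: "f \<in> Hom R a b" and g: "g \<in> Hom R b c"
    show "H (Comp R g f) = Comp AbU (H g) (H f)"
      by (rule ab_Hom_eqI[OF H[OF Comp_closed[OF f g]] ab_Comp_in_Hom[OF H[OF f] H[OF g]]])
        (simp add: Comp[OF f g] ab_Comp_apply[OF H[OF f]])
  qed
  have "H \<in> hom (HomGrp R a b) (HomGrp Ab (P a) (P b))" if a: "a \<in> Obj R" and b: "b \<in> Obj R" for a b
  proof (rule homI)
    fix f assume "f \<in> carrier (HomGrp R a b)"
    then have "f \<in> Hom R a b" using HomGrp_carrier[OF a b] by simp
    from H[OF this] show "H f \<in> carrier (HomGrp Ab (P a) (P b))"
      unfolding ab_Hom_iff by (simp add: Ab_def)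
  next
    fix f g assume "f \<in> carrier (HomGrp R a b)" "g \<in> carrier (HomGrp R a b)"
    then have f: "f \<in> Hom R a b" and g: "g \<in> Hom R a b" using HomGrp_carrier[OF a b] by simp_all
    note fg = H[OF HomGrp_mult_closed[OF f g]]
    have "amap (H (f \<otimes>\<^bsub>HomGrp R a b\<^esub> g)) = (\<lambda>x \<in> carrier (P a). amap (H f) x \<otimes>\<^bsub>P b\<^esub> amap (H g) x)"
      by (rule extensionalityI[of _ "carrier (P a)"]) (use fg add[OF f g] in \<open>auto simp: ab_Hom_iff\<close>)
    then have "H (f \<otimes>\<^bsub>HomGrp R a b\<^esub> g) = Arrow (P a) (P b) (\<lambda>x \<in> carrier (P a). amap (H f) x \<otimes>\<^bsub>P b\<^esub> amap (H g) x)"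
      using fg by (intro arrow.expand) (simp add: ab_Hom_iff)
    then show "H (f \<otimes>\<^bsub>HomGrp R a b\<^esub> g) = H f \<otimes>\<^bsub>HomGrp Ab (P a) (P b)\<^esub> H g"
      by (simp add: Ab_def)
  qed
  then show ?thesis using fn by (simp add: LM_Obj_iff is_additive_functor_def)
qed

subsection \<open>Homomorphisms\<close>

definition mod_map :: "('o, 'a, 'u) lmod \<Rightarrow> ('o, 'a, 'u) lmod \<Rightarrow> ('o \<Rightarrow> 'u ab_arrow) \<Rightarrow> ('o, 'a, 'u) lmod_arrow" where
  "mod_map M N h = Arrow M N (restrict h (Obj R))"

lemma mod_map_apply [simp]: "k \<in> Obj R \<Longrightarrow> amap (mod_map M N h) k = h k"
  by (simp add: mod_map_def)

lemma LM_Hom_iff: "t \<in> Hom LM M N \<longleftrightarrow> M \<in> Obj LM \<and> N \<in> Obj LM \<and> src t = M \<and> tgt t = N \<and>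
    nat_trans R AbU M N (amap t) \<and> amap t \<in> extensional (Obj R)"
proof -
  have "Hom LM M N = (if is_additive_functor R AbU M \<and> is_additive_functor R AbU N
      then Hom (functor_cat R AbU) M N else {})"
    by (simp add: left_modules_def full_subcat_Hom)
  then show ?thesis
    by (auto simp: LM_Obj_iff Hom_def functor_cat_def is_additive_functor_def)
qed

lemma LM_Hom_Obj:
  assumes "t \<in> Hom LM M N"
  shows "M \<in> Obj LM" and "N \<in> Obj LM"
  using assms by (simp_all add: LM_Hom_iff)

lemma LM_comp_at:
  assumes "t \<in> Hom LM M N" and "k \<in> Obj R"
  shows "amap t k \<in> Hom AbU (ObjMap M k) (ObjMap N k)"
  using assms by (simp add: LM_Hom_iff nat_trans_def)

lemma comp_at_closed: "t \<in> Hom LM M N \<Longrightarrow> k \<in> Obj R \<Longrightarrow> x \<in> el M k \<Longrightarrow> comp_at t k x \<in> el N k"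
  by (rule ab_apply_closed[OF LM_comp_at])

lemma comp_at_mult: "t \<in> Hom LM M N \<Longrightarrow> k \<in> Obj R \<Longrightarrow> x \<in> el M k \<Longrightarrow> y \<in> el M k \<Longrightarrow>
    comp_at t k (x \<otimes>\<^bsub>ObjMap M k\<^esub> y) = comp_at t k x \<otimes>\<^bsub>ObjMap N k\<^esub> comp_at t k y"
  by (rule ab_apply_mult[OF LM_comp_at])

lemma comp_at_one: "t \<in> Hom LM M N \<Longrightarrow> k \<in> Obj R \<Longrightarrow> comp_at t k \<one>\<^bsub>ObjMap M k\<^esub> = \<one>\<^bsub>ObjMap N k\<^esub>"
  by (rule ab_apply_one[OF LM_comp_at])

lemma comp_at_natural:
  assumes t: "t \<in> Hom LM M N" and f: "f \<in> Hom R a b" and x: "x \<in> el M a"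
  shows "comp_at t b (act M f x) = act N f (comp_at t a x)"
proof -
  note ab = Hom_Obj[OF f] and MN = LM_Hom_Obj[OF t]
  have "Comp Ab (amap t b) (ArrMap M f) = Comp Ab (ArrMap N f) (amap t a)"
    using t ab f by (simp add: LM_Hom_iff nat_trans_def)
  then show ?thesis
    using ab_Comp_apply[OF mod_Arr[OF MN(1) f] x, of "amap t b"]
      ab_Comp_apply[OF LM_comp_at[OF t ab(1)] x, of "ArrMap N f"] by simp
qed

lemma mod_map_in_Hom:
  assumes M: "M \<in> Obj LM" and N: "N \<in> Obj LM"
    and h: "\<And>k. k \<in> Obj R \<Longrightarrow> h k \<in> Hom AbU (ObjMap M k) (ObjMap N k)"
    and nat: "\<And>a b f x. f \<in> Hom R a b \<Longrightarrow> x \<in> el M a \<Longrightarrow> amap (h b) (act M f x) = act N f (amap (h a) x)"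
  shows "mod_map M N h \<in> Hom LM M N"
proof -
  have "nat_trans R AbU M N (restrict h (Obj R))"
    unfolding nat_trans_def
  proof (intro conjI ballI)
    fix a assume a: "a \<in> Obj R"
    then show "restrict h (Obj R) a \<in> Hom AbU (ObjMap M a) (ObjMap N a)" using h by simp
    fix b f assume b: "b \<in> Obj R" and f: "f \<in> Hom R a b"
    have "Comp AbU (h b) (ArrMap M f) = Comp AbU (ArrMap N f) (h a)"
      by (rule ab_Hom_eqI[OF ab_Comp_in_Hom[OF mod_Arr[OF M f] h[OF b]] ab_Comp_in_Hom[OF h[OF a] mod_Arr[OF N f]]])
        (simp add: ab_Comp_apply[OF mod_Arr[OF M f]] ab_Comp_apply[OF h[OF a]] nat[OF f])
    then show "Comp AbU (restrict h (Obj R) b) (ArrMap M f) = Comp AbU (ArrMap N f) (restrict h (Obj R) a)"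
      using a b by simp
  qed
  then show ?thesis using M N by (simp add: LM_Hom_iff mod_map_def)
qed

lemma LM_Hom_eqI:
  assumes s: "s \<in> Hom LM M N" and t: "t \<in> Hom LM M N"
    and eq: "\<And>k x. k \<in> Obj R \<Longrightarrow> x \<in> el M k \<Longrightarrow> comp_at s k x = comp_at t k x"
  shows "s = t"
proof -
  have "amap s k = amap t k" if "k \<in> Obj R" for k
    by (rule ab_Hom_eqI[OF LM_comp_at[OF s that] LM_comp_at[OF t that] eq[OF that]])
  then have "amap s = amap t"
    using s t by (intro extensionalityI[of _ "Obj R"]) (simp_all add: LM_Hom_iff)
  then show ?thesis using s t by (intro arrow.expand) (simp add: LM_Hom_iff)
qed

lemma LM_Comp_in_Hom: "s \<in> Hom LM M N \<Longrightarrow> t \<in> Hom LM N P \<Longrightarrow> Comp LM t s \<in> Hom LM M P"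
  by (rule category.Comp_closed[OF category_LM])

lemma LM_Comp_apply:
  assumes "s \<in> Hom LM M N" and "k \<in> Obj R" and "x \<in> el M k"
  shows "comp_at (Comp LM t s) k x = comp_at t k (comp_at s k x)"
  using ab_Comp_apply[OF LM_comp_at[OF assms(1,2)] assms(3), of "amap t k"] assms(2)
  by (simp add: left_modules_def full_subcat_Comp functor_cat_def)

lemma LM_Ident_in_Hom: "M \<in> Obj LM \<Longrightarrow> Ident LM M \<in> Hom LM M M"
  by (rule category.Ident_closed[OF category_LM])

lemma LM_Ident_apply: "k \<in> Obj R \<Longrightarrow> x \<in> el M k \<Longrightarrow> comp_at (Ident LM M) k x = x"
  by (simp add: left_modules_def full_subcat_Ident functor_cat_def ab_Ident_apply)

subsection \<open>Pointwise products\<close>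

definition pointwise_product ::
  "'i set \<Rightarrow> ('i \<Rightarrow> ('o, 'a, 'u) lmod) \<Rightarrow> ('o, 'a, 'u) lmod \<Rightarrow> ('i \<Rightarrow> ('o, 'a, 'u) lmod_arrow) \<Rightarrow> bool" where
  "pointwise_product I X P \<pi> \<longleftrightarrow>
     (\<forall>k \<in> Obj R. jointly_bijective I (\<lambda>i. el (X i) k) (el P k) (\<lambda>i. comp_at (\<pi> i) k))"

lemma pointwise_productD:
  "pointwise_product I X P \<pi> \<Longrightarrow> k \<in> Obj R \<Longrightarrow>
    jointly_bijective I (\<lambda>i. el (X i) k) (el P k) (\<lambda>i. comp_at (\<pi> i) k)"
  by (simp add: pointwise_product_def)

text \<open>The action of an arrow on the product of the groups at its source is the map induced on products; it is
  functorial and additive because maps into a product are determined by their components.\<close>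

lemma pointwise_product_exists:
  assumes I: "small I" and X: "\<And>i. i \<in> I \<Longrightarrow> X i \<in> Obj LM"
  shows "\<exists>P \<pi>. P \<in> Obj LM \<and> (\<forall>i \<in> I. \<pi> i \<in> Hom LM P (X i)) \<and> pointwise_product I X P \<pi>"
proof -
  have "\<forall>k \<in> Obj R. \<exists>P \<pi>. P \<in> Obj AbU \<and> (\<forall>i \<in> I. \<pi> i \<in> Hom AbU P (ObjMap (X i) k)) \<and>
      jointly_bijective I (\<lambda>i. el (X i) k) (carrier P) (\<lambda>i. amap (\<pi> i))"
    by (intro ballI ab_product_exists[OF I] mod_Obj[OF X])
  from bchoice[OF this] obtain P where "\<forall>k \<in> Obj R. \<exists>\<pi>. P k \<in> Obj AbU \<and>
      (\<forall>i \<in> I. \<pi> i \<in> Hom AbU (P k) (ObjMap (X i) k)) \<and>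
      jointly_bijective I (\<lambda>i. el (X i) k) (carrier (P k)) (\<lambda>i. amap (\<pi> i))" by blast
  from bchoice[OF this] obtain \<pi> where *: "\<forall>k \<in> Obj R. P k \<in> Obj AbU \<and>
      (\<forall>i \<in> I. \<pi> k i \<in> Hom AbU (P k) (ObjMap (X i) k)) \<and>
      jointly_bijective I (\<lambda>i. el (X i) k) (carrier (P k)) (\<lambda>i. amap (\<pi> k i))" by blast
  have P: "P k \<in> Obj AbU" and pi: "i \<in> I \<Longrightarrow> \<pi> k i \<in> Hom AbU (P k) (ObjMap (X i) k)"
    and bij: "jointly_bijective I (\<lambda>i. el (X i) k) (carrier (P k)) (\<lambda>i. amap (\<pi> k i))"
    if "k \<in> Obj R" for k i
    using * that by auto
  define H where "H f = (SOME h. h \<in> Hom AbU (P (Dom R f)) (P (Cod R f)) \<and>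
      (\<forall>i \<in> I. Comp AbU (\<pi> (Cod R f) i) h = Comp AbU (ArrMap (X i) f) (\<pi> (Dom R f) i)))" for f
  have H_all: "H f \<in> Hom AbU (P a) (P b) \<and> (\<forall>i \<in> I. Comp AbU (\<pi> b i) (H f) = Comp AbU (ArrMap (X i) f) (\<pi> a i))"
    if f: "f \<in> Hom R a b" for f a b
  proof -
    note ab = Hom_Obj[OF f]
    have "is_product AbU I (\<lambda>i. ObjMap (X i) b) (P b) (\<pi> b)"
      by (rule ab_is_productI[OF P[OF ab(2)] pi[OF ab(2)] bij[OF ab(2)]])
    from is_product_universal[OF this P[OF ab(1)], of "\<lambda>i. Comp AbU (ArrMap (X i) f) (\<pi> a i)"]
    have "\<exists>h. h \<in> Hom AbU (P a) (P b) \<and> (\<forall>i \<in> I. Comp AbU (\<pi> b i) h = Comp AbU (ArrMap (X i) f) (\<pi> a i))"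
      using ab_Comp_in_Hom[OF pi[OF ab(1)] mod_Arr[OF X f]] by blast
    from someI_ex[OF this] show ?thesis using f by (simp add: H_def Hom_def)
  qed
  have H: "H f \<in> Hom AbU (P a) (P b)" if "f \<in> Hom R a b" for f a b using H_all[OF that] by blast
  have H_pi: "amap (\<pi> b i) (amap (H f) x) = act (X i) f (amap (\<pi> a i) x)"
    if f: "f \<in> Hom R a b" and i: "i \<in> I" and x: "x \<in> carrier (P a)" for f a b i x
    using H_all[OF f] i ab_Comp_apply[OF H[OF f] x, of "\<pi> b i"]
      ab_Comp_apply[OF pi[OF Hom_Obj(1)[OF f] i] x, of "ArrMap (X i) f"] by simp
  note pi_closed = ab_apply_closed[OF pi] and H_closed = ab_apply_closed[OF H]
  have N: "\<lparr>ObjMap = P, ArrMap = H\<rparr> \<in> Obj LM"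
  proof (rule LM_intro[OF P H])
    fix k x assume k: "k \<in> Obj R" and x: "x \<in> carrier (P k)"
    note id = Ident_closed[OF k]
    show "amap (H (Ident R k)) x = x"
      by (rule jointly_bijective_inj[OF bij[OF k] H_closed[OF id x] x])
        (use H_pi[OF id _ x] act_Ident[OF X k] pi_closed[OF k _ x] in simp)
  next
    fix a b c f g x assume f: "f \<in> Hom R a b" and g: "g \<in> Hom R b c" and x: "x \<in> carrier (P a)"
    note gf = Comp_closed[OF f g] and a = Hom_Obj(1)[OF f] and c = Hom_Obj(2)[OF g]
    show "amap (H (Comp R g f)) x = amap (H g) (amap (H f) x)"
      by (rule jointly_bijective_inj[OF bij[OF c] H_closed[OF gf x] H_closed[OF g H_closed[OF f x]]])
        (use H_pi[OF gf _ x] H_pi[OF f _ x] H_pi[OF g _ H_closed[OF f x]] act_Comp[OF X f g] pi_closed[OF a _ x] in simp)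
  next
    fix a b f g x assume f: "f \<in> Hom R a b" and g: "g \<in> Hom R a b" and x: "x \<in> carrier (P a)"
    note fg = HomGrp_mult_closed[OF f g] and a = Hom_Obj(1)[OF f] and b = Hom_Obj(2)[OF f]
    interpret Pb: group "P b" by (rule ab_Obj_group[OF P[OF b]])
    show "amap (H (f \<otimes>\<^bsub>HomGrp R a b\<^esub> g)) x = amap (H f) x \<otimes>\<^bsub>P b\<^esub> amap (H g) x"
      by (rule jointly_bijective_inj[OF bij[OF b] H_closed[OF fg x] Pb.m_closed[OF H_closed[OF f x] H_closed[OF g x]]])
        (use H_pi[OF fg _ x] H_pi[OF f _ x] H_pi[OF g _ x] ab_apply_mult[OF pi[OF b] H_closed[OF f x] H_closed[OF g x]]
          act_add[OF X f g] pi_closed[OF a _ x] in simp)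
  qed
  let ?P = "\<lparr>ObjMap = P, ArrMap = H\<rparr>"
  let ?\<pi> = "\<lambda>i. mod_map ?P (X i) (\<lambda>k. \<pi> k i)"
  have "\<forall>i \<in> I. ?\<pi> i \<in> Hom LM ?P (X i)"
    by (intro ballI mod_map_in_Hom[OF N X]) (use pi H_pi in simp_all)
  moreover have "pointwise_product I X ?P ?\<pi>"
    using bij by (simp add: pointwise_product_def)
  ultimately show ?thesis using N by (intro exI[of _ ?P] exI[of _ ?\<pi>]) simp
qed

text \<open>The mediating map is assembled from those at the objects of \<open>R\<close>. The predicate \<open>Q\<close> selects a full
  subcategory, in the applications that of all modules or that of product-preserving modules.\<close>

lemma is_product_if_pointwise:
  assumes P: "P \<in> Obj LM" and QP: "Q P" and pi: "\<And>i. i \<in> I \<Longrightarrow> \<pi> i \<in> Hom LM P (X i)"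
    and QX: "\<And>i. i \<in> I \<Longrightarrow> Q (X i)"
    and pw: "pointwise_product I X P \<pi>"
  shows "is_product (full_subcat LM Q) I X P \<pi>"
  unfolding is_product_def full_subcat_Comp full_subcat_Obj
proof (intro conjI ballI allI impI)
  show "\<pi> i \<in> Hom (full_subcat LM Q) P (X i)" if "i \<in> I" for i
    using pi QP QX that by (simp add: full_subcat_Hom)
  fix W f assume W: "W \<in> Obj (full_subcat LM Q)" and f: "\<forall>i\<in>I. f i \<in> Hom (full_subcat LM Q) W (X i)"
  have QW: "Q W" and W: "W \<in> Obj LM" using W by (simp_all add: full_subcat_Obj)
  have f: "f i \<in> Hom LM W (X i)" if "i \<in> I" for i
    using f that by (auto simp: full_subcat_Hom split: if_splits)
  note bij = pointwise_productD[OF pw]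
  have "\<forall>k \<in> Obj R. \<exists>h. h \<in> Hom AbU (ObjMap W k) (ObjMap P k) \<and> (\<forall>i\<in>I. Comp AbU (amap (\<pi> i) k) h = amap (f i) k)"
  proof
    fix k assume k: "k \<in> Obj R"
    have "is_product AbU I (\<lambda>i. ObjMap (X i) k) (ObjMap P k) (\<lambda>i. amap (\<pi> i) k)"
      by (rule ab_is_productI[OF mod_Obj[OF P k] LM_comp_at[OF pi k] bij[OF k]])
    from is_product_universal[OF this mod_Obj[OF W k], of "\<lambda>i. amap (f i) k"]
    show "\<exists>h. h \<in> Hom AbU (ObjMap W k) (ObjMap P k) \<and> (\<forall>i\<in>I. Comp AbU (amap (\<pi> i) k) h = amap (f i) k)"
      using LM_comp_at[OF f k] by blast
  qed
  from bchoice[OF this] obtain h where h_all: "\<forall>k \<in> Obj R. h k \<in> Hom AbU (ObjMap W k) (ObjMap P k) \<and>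
      (\<forall>i\<in>I. Comp AbU (amap (\<pi> i) k) (h k) = amap (f i) k)" by blast
  then have h: "h k \<in> Hom AbU (ObjMap W k) (ObjMap P k)" if "k \<in> Obj R" for k using that by blast
  have h_pi: "comp_at (\<pi> i) k (amap (h k) x) = comp_at (f i) k x" if "k \<in> Obj R" "i \<in> I" "x \<in> el W k" for k i x
    using h_all that ab_Comp_apply[OF h[OF that(1)] that(3), of "amap (\<pi> i) k"] by simp
  have m: "mod_map W P h \<in> Hom LM W P"
  proof (rule mod_map_in_Hom[OF W P h])
    fix a b g x assume g: "g \<in> Hom R a b" and x: "x \<in> el W a"
    note a = Hom_Obj(1)[OF g] and b = Hom_Obj(2)[OF g]
    note hx = ab_apply_closed[OF h[OF a] x] and gx = act_closed[OF W g x]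
    show "amap (h b) (act W g x) = act P g (amap (h a) x)"
      by (rule jointly_bijective_inj[OF bij[OF b] ab_apply_closed[OF h[OF b] gx] act_closed[OF P g hx]])
        (use h_pi[OF b _ gx] h_pi[OF a _ x] comp_at_natural[OF pi g hx] comp_at_natural[OF f g x] in simp)
  qed
  show "\<exists>!h. h \<in> Hom (full_subcat LM Q) W P \<and> (\<forall>i\<in>I. Comp LM (\<pi> i) h = f i)"
  proof (rule ex1I[of _ "mod_map W P h"], intro conjI ballI)
    show "mod_map W P h \<in> Hom (full_subcat LM Q) W P" using m QW QP by (simp add: full_subcat_Hom)
    fix i assume i: "i \<in> I"
    show "Comp LM (\<pi> i) (mod_map W P h) = f i"
      by (rule LM_Hom_eqI[OF LM_Comp_in_Hom[OF m pi[OF i]] f[OF i]])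
        (simp add: LM_Comp_apply[OF m] h_pi i)
  next
    fix t assume t: "t \<in> Hom (full_subcat LM Q) W P \<and> (\<forall>i\<in>I. Comp LM (\<pi> i) t = f i)"
    then have tW: "t \<in> Hom LM W P" by (auto simp: full_subcat_Hom split: if_splits)
    show "t = mod_map W P h"
    proof (rule LM_Hom_eqI[OF tW m])
      fix k x assume k: "k \<in> Obj R" and x: "x \<in> el W k"
      have "comp_at (\<pi> i) k (comp_at t k x) = comp_at (f i) k x" if "i \<in> I" for i
        using t that LM_Comp_apply[OF tW k x, of "\<pi> i"] by simp
      then show "comp_at t k x = comp_at (mod_map W P h) k x"
        using h_pi[OF k _ x] k
        by (intro jointly_bijective_inj[OF bij[OF k] comp_at_closed[OF tW k x] comp_at_closed[OF m k x]]) simp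
    qed
  qed
qed (use P QP in auto)

text \<open>The closure hypothesis says that the pointwise product of the \<open>X i\<close> stays in the subcategory; it is then a product
  there, so that every other product is isomorphic to it.\<close>

theorem is_product_iff_pointwise:
  assumes I: "small I" and X: "\<And>i. i \<in> I \<Longrightarrow> X i \<in> Obj LM" and QX: "\<And>i. i \<in> I \<Longrightarrow> Q (X i)"
    and P: "P \<in> Obj LM" and QP: "Q P" and pi: "\<And>i. i \<in> I \<Longrightarrow> \<pi> i \<in> Hom LM P (X i)"
    and closed: "\<And>P' \<rho>. P' \<in> Obj LM \<Longrightarrow> (\<And>i. i \<in> I \<Longrightarrow> \<rho> i \<in> Hom LM P' (X i)) \<Longrightarrow> pointwise_product I X P' \<rho> \<Longrightarrow> Q P'"
  shows "is_product (full_subcat LM Q) I X P \<pi> \<longleftrightarrow> pointwise_product I X P \<pi>"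
proof
  assume prod: "is_product (full_subcat LM Q) I X P \<pi>"
  obtain P' \<rho> where P': "P' \<in> Obj LM" and rho: "\<forall>i \<in> I. \<rho> i \<in> Hom LM P' (X i)" and pw: "pointwise_product I X P' \<rho>"
    using pointwise_product_exists[of I X, OF I X] by blast
  have QP': "Q P'" using closed[of P' \<rho>] P' rho pw by blast
  have rho: "\<rho> i \<in> Hom LM P' (X i)" if "i \<in> I" for i using rho that by blast
  have "is_product (full_subcat LM Q) I X P' \<rho>"
    by (rule is_product_if_pointwise[where Q = Q, OF P' QP' rho QX pw])
  from is_product_unique[OF category_full_subcat[OF category_LM] prod this]
  obtain h k where h: "h \<in> Hom (full_subcat LM Q) P P'" and k: "k \<in> Hom (full_subcat LM Q) P' P"
    and kh: "Comp LM k h = Ident LM P"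
    and h_rho: "\<And>i. i \<in> I \<Longrightarrow> Comp LM (\<rho> i) h = \<pi> i" and k_pi: "\<And>i. i \<in> I \<Longrightarrow> Comp LM (\<pi> i) k = \<rho> i"
    unfolding full_subcat_Comp full_subcat_Ident by blast
  have h: "h \<in> Hom LM P P'" and k: "k \<in> Hom LM P' P"
    using h k by (auto simp: full_subcat_Hom split: if_splits)
  show "pointwise_product I X P \<pi>"
    unfolding pointwise_product_def
  proof
    fix a assume a: "a \<in> Obj R"
    note bij = pointwise_productD[OF pw a]
    show "jointly_bijective I (\<lambda>i. el (X i) a) (el P a) (\<lambda>i. comp_at (\<pi> i) a)"
    proof (rule jointly_bijective_transfer[OF bij comp_at_closed[OF h a] comp_at_closed[OF k a]])
      show "comp_at k a (comp_at h a x) = x" if "x \<in> el P a" for x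
        using LM_Comp_apply[OF h a that, of k] kh LM_Ident_apply[OF a that] by simp
      show "comp_at (\<rho> i) a (comp_at h a x) = comp_at (\<pi> i) a x" if "i \<in> I" "x \<in> el P a" for i x
        using LM_Comp_apply[OF h a that(2), of "\<rho> i"] h_rho[OF that(1)] by simp
      show "comp_at (\<pi> i) a (comp_at k a x) = comp_at (\<rho> i) a x" if "i \<in> I" "x \<in> el P' a" for i x
        using LM_Comp_apply[OF k a that(2), of "\<pi> i"] k_pi[OF that(1)] by simp
    qed
  qed
qed (rule is_product_if_pointwise[where Q = Q, OF P QP pi QX])

subsection \<open>Pointwise directed colimits\<close>

definition pointwise_colimit ::
  "'i set \<Rightarrow> 'i rel \<Rightarrow> ('i \<Rightarrow> ('o, 'a, 'u) lmod) \<Rightarrow> ('i \<Rightarrow> 'i \<Rightarrow> ('o, 'a, 'u) lmod_arrow) \<Rightarrow>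
     ('o, 'a, 'u) lmod \<Rightarrow> ('i \<Rightarrow> ('o, 'a, 'u) lmod_arrow) \<Rightarrow> bool" where
  "pointwise_colimit I r X T L c \<longleftrightarrow>
     (\<forall>k \<in> Obj R. elementwise_colimit I r (\<lambda>i. el (X i) k) (\<lambda>i j. comp_at (T i j) k) (el L k) (\<lambda>i. comp_at (c i) k))"

lemma pointwise_colimitD:
  "pointwise_colimit I r X T L c \<Longrightarrow> k \<in> Obj R \<Longrightarrow>
    elementwise_colimit I r (\<lambda>i. el (X i) k) (\<lambda>i j. comp_at (T i j) k) (el L k) (\<lambda>i. comp_at (c i) k)"
  by (simp add: pointwise_colimit_def)

lemma LM_poset_diagramD:
  assumes "poset_diagram LM I r X T"
  shows "i \<in> I \<Longrightarrow> X i \<in> Obj LM" "(i, j) \<in> r \<Longrightarrow> T i j \<in> Hom LM (X i) (X j)"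
    "i \<in> I \<Longrightarrow> T i i = Ident LM (X i)"
    "(i, j) \<in> r \<Longrightarrow> (j, k) \<in> r \<Longrightarrow> T i k = Comp LM (T j k) (T i j)"
  using assms unfolding poset_diagram_def by auto

lemma LM_poset_diagram_at:
  assumes diag: "poset_diagram LM I r X T" and rI: "r \<subseteq> I \<times> I" and k: "k \<in> Obj R"
  shows "poset_diagram AbU I r (\<lambda>i. ObjMap (X i) k) (\<lambda>i j. amap (T i j) k)"
  unfolding poset_diagram_def
proof (intro conjI ballI allI impI, goal_cases)
  case (1 i) then show ?case by (rule mod_Obj[OF LM_poset_diagramD(1)[OF diag] k])
next
  case (2 p) then show ?case using LM_comp_at[OF LM_poset_diagramD(2)[OF diag] k] by auto
next
  case (3 i)
  show ?case
    using k unfolding LM_poset_diagramD(3)[OF diag 3]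
    by (simp add: left_modules_def full_subcat_Ident functor_cat_def)
next
  case (4 i j m)
  show ?case
    using k unfolding LM_poset_diagramD(4)[OF diag 4]
    by (simp add: left_modules_def full_subcat_Comp functor_cat_def)
qed

lemma LM_is_coconeD:
  assumes "is_cocone LM I r X T L c"
  shows "L \<in> Obj LM" "i \<in> I \<Longrightarrow> c i \<in> Hom LM (X i) L"
    "(i, j) \<in> r \<Longrightarrow> Comp LM (c j) (T i j) = c i"
  using assms unfolding is_cocone_def by auto

lemma LM_cocone_apply:
  assumes "is_cocone LM I r X T L c" and "(i, j) \<in> r" and "T i j \<in> Hom LM (X i) (X j)" and "k \<in> Obj R" and "x \<in> el (X i) k"
  shows "comp_at (c j) k (comp_at (T i j) k x) = comp_at (c i) k x"
  using LM_Comp_apply[OF assms(3,4,5), of "c j"] LM_is_coconeD(3)[OF assms(1,2)] by simp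

lemma LM_cocone_at:
  assumes cocone: "is_cocone LM I r X T L c" and k: "k \<in> Obj R"
  shows "is_cocone AbU I r (\<lambda>i. ObjMap (X i) k) (\<lambda>i j. amap (T i j) k) (ObjMap L k) (\<lambda>i. amap (c i) k)"
  unfolding is_cocone_def
proof (intro conjI ballI, goal_cases)
  case 1 show ?case by (rule mod_Obj[OF LM_is_coconeD(1)[OF cocone] k])
next
  case (2 i) then show ?case by (rule LM_comp_at[OF LM_is_coconeD(2)[OF cocone] k])
next
  case (3 p)
  obtain i j where p: "p = (i, j)" by (cases p)
  then have "Comp LM (c j) (T i j) = c i" using 3 LM_is_coconeD(3)[OF cocone] by simp
  then have "amap (Comp LM (c j) (T i j)) k = amap (c i) k" by simp
  then show ?case using k p by (simp add: left_modules_def full_subcat_Comp functor_cat_def)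
qed

text \<open>As for products, with the maps induced on colimits; identities between them are checked on elements, all of
  which come from some stage.\<close>

lemma pointwise_colimit_exists:
  assumes I: "small I" and dir: "directed_poset natLeq I r" and diag: "poset_diagram LM I r X T"
  shows "\<exists>L c. is_cocone LM I r X T L c \<and> pointwise_colimit I r X T L c"
proof -
  note rI = directed_posetD(1)[OF dir]
  note X = LM_poset_diagramD(1)[OF diag] and T = LM_poset_diagramD(2)[OF diag]
    and diag_at = LM_poset_diagram_at[OF diag rI]
  have "\<forall>k \<in> Obj R. \<exists>L c. is_cocone AbU I r (\<lambda>i. ObjMap (X i) k) (\<lambda>i j. amap (T i j) k) L c \<and>
      elementwise_colimit I r (\<lambda>i. el (X i) k) (\<lambda>i j. comp_at (T i j) k) (carrier L) (\<lambda>i. amap (c i))"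
    using ab_colimit_exists[OF I dir diag_at] by blast
  from bchoice[OF this] obtain L where "\<forall>k \<in> Obj R. \<exists>c. is_cocone AbU I r (\<lambda>i. ObjMap (X i) k) (\<lambda>i j. amap (T i j) k) (L k) c \<and>
      elementwise_colimit I r (\<lambda>i. el (X i) k) (\<lambda>i j. comp_at (T i j) k) (carrier (L k)) (\<lambda>i. amap (c i))" by blast
  from bchoice[OF this] obtain c where *: "\<forall>k \<in> Obj R. is_cocone AbU I r (\<lambda>i. ObjMap (X i) k) (\<lambda>i j. amap (T i j) k) (L k) (c k) \<and>
      elementwise_colimit I r (\<lambda>i. el (X i) k) (\<lambda>i j. comp_at (T i j) k) (carrier (L k)) (\<lambda>i. amap (c k i))" by blast
  have cocone: "is_cocone AbU I r (\<lambda>i. ObjMap (X i) k) (\<lambda>i j. amap (T i j) k) (L k) (c k)"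
    and col: "elementwise_colimit I r (\<lambda>i. el (X i) k) (\<lambda>i j. comp_at (T i j) k) (carrier (L k)) (\<lambda>i. amap (c k i))"
    if "k \<in> Obj R" for k
    using * that by auto
  have L: "L k \<in> Obj AbU" if "k \<in> Obj R" for k
    by (rule ab_is_coconeD(1)[OF cocone[OF that]])
  have c: "c k i \<in> Hom AbU (ObjMap (X i) k) (L k)" if "k \<in> Obj R" "i \<in> I" for k i
    by (rule ab_is_coconeD(2)[OF cocone[OF that(1)] that(2)])
  define H where "H f = (SOME h. h \<in> Hom AbU (L (Dom R f)) (L (Cod R f)) \<and>
      (\<forall>i \<in> I. Comp AbU h (c (Dom R f) i) = Comp AbU (c (Cod R f) i) (ArrMap (X i) f)))" for f
  have H_all: "H f \<in> Hom AbU (L a) (L b) \<and> (\<forall>i \<in> I. Comp AbU (H f) (c a i) = Comp AbU (c b i) (ArrMap (X i) f))"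
    if f: "f \<in> Hom R a b" for f a b
  proof -
    note ab = Hom_Obj[OF f]
    have colim: "is_colimit AbU I r (\<lambda>i. ObjMap (X i) a) (\<lambda>i j. amap (T i j) a) (L a) (c a)"
      by (rule ab_is_colimitI[OF dir diag_at[OF ab(1)] cocone[OF ab(1)] col[OF ab(1)]])
    have d: "Comp AbU (c b i) (ArrMap (X i) f) \<in> Hom AbU (ObjMap (X i) a) (L b)" if "i \<in> I" for i
      by (rule ab_Comp_in_Hom[OF mod_Arr[OF X[OF that] f] c[OF ab(2) that]])
    have "is_cocone AbU I r (\<lambda>i. ObjMap (X i) a) (\<lambda>i j. amap (T i j) a) (L b) (\<lambda>i. Comp AbU (c b i) (ArrMap (X i) f))"
      unfolding is_cocone_def
    proof (intro conjI ballI, goal_cases)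
      case 1 show ?case by (rule L[OF ab(2)])
    next
      case (2 i) then show ?case by (rule d)
    next
      case (3 p)
      obtain i j where p: "p = (i, j)" by (cases p)
      then have ij: "(i, j) \<in> r" using 3 by simp
      then have i: "i \<in> I" and j: "j \<in> I" using rI by auto
      note Ta = LM_comp_at[OF T[OF ij] ab(1)] and Tb = LM_comp_at[OF T[OF ij] ab(2)]
      have "Comp AbU (Comp AbU (c b j) (ArrMap (X j) f)) (amap (T i j) a) = Comp AbU (c b i) (ArrMap (X i) f)"
      proof (rule ab_Hom_eqI[OF ab_Comp_in_Hom[OF Ta d[OF j]] d[OF i]])
        fix x assume x: "x \<in> carrier (ObjMap (X i) a)"
        note Tx = ab_apply_closed[OF Ta x] and fx = act_closed[OF X[OF i] f x]
        show "amap (Comp AbU (Comp AbU (c b j) (ArrMap (X j) f)) (amap (T i j) a)) x = amap (Comp AbU (c b i) (ArrMap (X i) f)) x"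
          unfolding ab_Comp_apply[OF Ta x] ab_Comp_apply[OF mod_Arr[OF X[OF j] f] Tx] ab_Comp_apply[OF mod_Arr[OF X[OF i] f] x]
            comp_at_natural[OF T[OF ij] f x, symmetric]
          by (rule ab_cocone_apply[OF cocone[OF ab(2)] ij Tb fx])
      qed
      then show ?case by (simp add: p)
    qed
    then have "\<exists>h. h \<in> Hom AbU (L a) (L b) \<and> (\<forall>i \<in> I. Comp AbU h (c a i) = Comp AbU (c b i) (ArrMap (X i) f))"
      using colim unfolding is_colimit_def by blast
    from someI_ex[OF this] show ?thesis using f by (simp add: H_def Hom_def)
  qed
  have H: "H f \<in> Hom AbU (L a) (L b)" if "f \<in> Hom R a b" for f a b using H_all[OF that] by blast
  have H_c: "amap (H f) (amap (c a i) x) = amap (c b i) (act (X i) f x)"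
    if f: "f \<in> Hom R a b" and i: "i \<in> I" and x: "x \<in> el (X i) a" for f a b i x
    using H_all[OF f] i ab_Comp_apply[OF c[OF Hom_Obj(1)[OF f] i] x, of "H f"]
      ab_Comp_apply[OF mod_Arr[OF X[OF i] f] x, of "c b i"] by simp
  have N: "\<lparr>ObjMap = L, ArrMap = H\<rparr> \<in> Obj LM"
  proof (rule LM_intro[OF L H])
    fix k z assume k: "k \<in> Obj R" and z: "z \<in> carrier (L k)"
    obtain i x where i: "i \<in> I" and x: "x \<in> el (X i) k" "z = amap (c k i) x"
      using elementwise_colimit_surj[OF col[OF k] z] by blast
    show "amap (H (Ident R k)) z = z"
      using H_c[OF Ident_closed[OF k] i x(1)] act_Ident[OF X[OF i] k x(1)] x(2) by simp
  next
    fix a b d f g z assume f: "f \<in> Hom R a b" and g: "g \<in> Hom R b d" and z: "z \<in> carrier (L a)"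
    obtain i x where i: "i \<in> I" and x: "x \<in> el (X i) a" "z = amap (c a i) x"
      using elementwise_colimit_surj[OF col[OF Hom_Obj(1)[OF f]] z] by blast
    show "amap (H (Comp R g f)) z = amap (H g) (amap (H f) z)"
      using H_c[OF Comp_closed[OF f g] i x(1)] H_c[OF f i x(1)] H_c[OF g i act_closed[OF X[OF i] f x(1)]]
        act_Comp[OF X[OF i] f g x(1)] x(2) by simp
  next
    fix a b f g z assume f: "f \<in> Hom R a b" and g: "g \<in> Hom R a b" and z: "z \<in> carrier (L a)"
    obtain i x where i: "i \<in> I" and x: "x \<in> el (X i) a" "z = amap (c a i) x"
      using elementwise_colimit_surj[OF col[OF Hom_Obj(1)[OF f]] z] by blast
    show "amap (H (f \<otimes>\<^bsub>HomGrp R a b\<^esub> g)) z = amap (H f) z \<otimes>\<^bsub>L b\<^esub> amap (H g) z"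
      using H_c[OF HomGrp_mult_closed[OF f g] i x(1)] H_c[OF f i x(1)] H_c[OF g i x(1)]
        act_add[OF X[OF i] f g x(1)] x(2)
        ab_apply_mult[OF c[OF Hom_Obj(2)[OF f] i] act_closed[OF X[OF i] f x(1)] act_closed[OF X[OF i] g x(1)]] by simp
  qed
  let ?L = "\<lparr>ObjMap = L, ArrMap = H\<rparr>"
  let ?c = "\<lambda>i. mod_map (X i) ?L (\<lambda>k. c k i)"
  have m: "?c i \<in> Hom LM (X i) ?L" if "i \<in> I" for i
    by (rule mod_map_in_Hom[OF X[OF that] N]) (use c that H_c in simp_all)
  have "is_cocone LM I r X T ?L ?c"
    unfolding is_cocone_def
  proof (intro conjI ballI, goal_cases)
    case (3 p)
    obtain i j where p: "p = (i, j)" by (cases p)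
    then have ij: "(i, j) \<in> r" using 3 by simp
    then have i: "i \<in> I" and j: "j \<in> I" using rI by auto
    have "Comp LM (?c j) (T i j) = ?c i"
    proof (rule LM_Hom_eqI[OF LM_Comp_in_Hom[OF T[OF ij] m[OF j]] m[OF i]])
      fix k x assume k: "k \<in> Obj R" and x: "x \<in> el (X i) k"
      show "comp_at (Comp LM (?c j) (T i j)) k x = comp_at (?c i) k x"
        using LM_Comp_apply[OF T[OF ij] k x, of "?c j"] k
          ab_cocone_apply[OF cocone[OF k] ij LM_comp_at[OF T[OF ij] k] x] by simp
    qed
    then show ?case by (simp add: p)
  qed (use N m in auto)
  moreover have "pointwise_colimit I r X T ?L ?c"
    using col by (simp add: pointwise_colimit_def)
  ultimately show ?thesis by blast
qed

lemma is_cocone_full_subcat: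
  assumes "\<And>i. i \<in> I \<Longrightarrow> Q (X i)"
  shows "is_cocone (full_subcat LM Q) I r X T L c \<longleftrightarrow> is_cocone LM I r X T L c \<and> Q L"
  using assms by (auto simp: is_cocone_def full_subcat_Obj full_subcat_Hom full_subcat_Comp split: if_splits)

lemma is_colimit_if_pointwise:
  assumes dir: "directed_poset natLeq I r" and diag: "poset_diagram LM I r X T"
    and QX: "\<And>i. i \<in> I \<Longrightarrow> Q (X i)"
    and cocone: "is_cocone LM I r X T L c" and QL: "Q L"
    and pw: "pointwise_colimit I r X T L c"
  shows "is_colimit (full_subcat LM Q) I r X T L c"
  unfolding is_colimit_def full_subcat_Comp
proof (intro conjI allI impI)
  show "is_cocone (full_subcat LM Q) I r X T L c"
    using cocone QL is_cocone_full_subcat[of I Q X, OF QX] by blast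
  fix W d assume "is_cocone (full_subcat LM Q) I r X T W d"
  then have cone: "is_cocone LM I r X T W d" and QW: "Q W"
    using is_cocone_full_subcat[of I Q X, OF QX] by blast+
  note rI = directed_posetD(1)[OF dir]
  note X = LM_poset_diagramD(1)[OF diag] and diag_at = LM_poset_diagram_at[OF diag rI]
  note L = LM_is_coconeD(1)[OF cocone] and c = LM_is_coconeD(2)[OF cocone]
    and W = LM_is_coconeD(1)[OF cone] and d = LM_is_coconeD(2)[OF cone]
  note col = pointwise_colimitD[OF pw]
  have "\<forall>k \<in> Obj R. \<exists>h. h \<in> Hom AbU (ObjMap L k) (ObjMap W k) \<and> (\<forall>i\<in>I. Comp AbU h (amap (c i) k) = amap (d i) k)"
  proof
    fix k assume k: "k \<in> Obj R"
    have "is_colimit AbU I r (\<lambda>i. ObjMap (X i) k) (\<lambda>i j. amap (T i j) k) (ObjMap L k) (\<lambda>i. amap (c i) k)"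
      by (rule ab_is_colimitI[OF dir diag_at[OF k] LM_cocone_at[OF cocone k] col[OF k]])
    then show "\<exists>h. h \<in> Hom AbU (ObjMap L k) (ObjMap W k) \<and> (\<forall>i\<in>I. Comp AbU h (amap (c i) k) = amap (d i) k)"
      using LM_cocone_at[OF cone k] unfolding is_colimit_def by blast
  qed
  from bchoice[OF this] obtain h where h_all: "\<forall>k \<in> Obj R. h k \<in> Hom AbU (ObjMap L k) (ObjMap W k) \<and>
      (\<forall>i\<in>I. Comp AbU (h k) (amap (c i) k) = amap (d i) k)" by blast
  then have h: "h k \<in> Hom AbU (ObjMap L k) (ObjMap W k)" if "k \<in> Obj R" for k using that by blast
  have h_c: "amap (h k) (comp_at (c i) k x) = comp_at (d i) k x" if "k \<in> Obj R" "i \<in> I" "x \<in> el (X i) k" for k i x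
    using h_all that ab_Comp_apply[OF LM_comp_at[OF c[OF that(2)] that(1)] that(3), of "h k"] by simp
  have m: "mod_map L W h \<in> Hom LM L W"
  proof (rule mod_map_in_Hom[OF L W h])
    fix a b g z assume g: "g \<in> Hom R a b" and z: "z \<in> el L a"
    note a = Hom_Obj(1)[OF g] and b = Hom_Obj(2)[OF g]
    obtain i x where i: "i \<in> I" and x: "x \<in> el (X i) a" "z = comp_at (c i) a x"
      using elementwise_colimit_surj[OF col[OF a] z] by blast
    show "amap (h b) (act L g z) = act W g (amap (h a) z)"
      using h_c[OF b i act_closed[OF X[OF i] g x(1)]] h_c[OF a i x(1)]
        comp_at_natural[OF c[OF i] g x(1)] comp_at_natural[OF d[OF i] g x(1)] x(2) by simp
  qed
  show "\<exists>!h. h \<in> Hom (full_subcat LM Q) L W \<and> (\<forall>i\<in>I. Comp LM h (c i) = d i)"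
  proof (rule ex1I[of _ "mod_map L W h"], intro conjI ballI)
    show "mod_map L W h \<in> Hom (full_subcat LM Q) L W" using m QW QL by (simp add: full_subcat_Hom)
    fix i assume i: "i \<in> I"
    show "Comp LM (mod_map L W h) (c i) = d i"
      by (rule LM_Hom_eqI[OF LM_Comp_in_Hom[OF c[OF i] m] d[OF i]])
        (simp add: LM_Comp_apply[OF c[OF i]] h_c i)
  next
    fix t assume t: "t \<in> Hom (full_subcat LM Q) L W \<and> (\<forall>i\<in>I. Comp LM t (c i) = d i)"
    then have tL: "t \<in> Hom LM L W" by (auto simp: full_subcat_Hom split: if_splits)
    show "t = mod_map L W h"
    proof (rule LM_Hom_eqI[OF tL m])
      fix k z assume k: "k \<in> Obj R" and z: "z \<in> el L k"
      obtain i x where i: "i \<in> I" and x: "x \<in> el (X i) k" "z = comp_at (c i) k x"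
        using elementwise_colimit_surj[OF col[OF k] z] by blast
      have "comp_at t k z = comp_at (d i) k x"
        using t i x LM_Comp_apply[OF c[OF i] k x(1), of t] by simp
      then show "comp_at t k z = comp_at (mod_map L W h) k z"
        using h_c[OF k i x(1)] k x(2) by simp
    qed
  qed
qed

theorem is_colimit_iff_pointwise:
  assumes I: "small I" and dir: "directed_poset natLeq I r" and diag: "poset_diagram LM I r X T"
    and QX: "\<And>i. i \<in> I \<Longrightarrow> Q (X i)"
    and cocone: "is_cocone LM I r X T L c" and QL: "Q L"
    and closed: "\<And>L' d. is_cocone LM I r X T L' d \<Longrightarrow> pointwise_colimit I r X T L' d \<Longrightarrow> Q L'"
  shows "is_colimit (full_subcat LM Q) I r X T L c \<longleftrightarrow> pointwise_colimit I r X T L c"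
proof
  assume colim: "is_colimit (full_subcat LM Q) I r X T L c"
  obtain L' d where cone: "is_cocone LM I r X T L' d" and pw: "pointwise_colimit I r X T L' d"
    using pointwise_colimit_exists[OF I dir diag] by blast
  have "is_colimit (full_subcat LM Q) I r X T L' d"
    by (rule is_colimit_if_pointwise[where Q = Q, OF dir diag QX cone closed[OF cone pw] pw])
  from is_colimit_unique[OF category_full_subcat[OF category_LM] colim this]
  obtain h k where h: "h \<in> Hom (full_subcat LM Q) L L'" and k: "k \<in> Hom (full_subcat LM Q) L' L"
    and kh: "Comp LM k h = Ident LM L"
    and h_c: "\<And>i. i \<in> I \<Longrightarrow> Comp LM h (c i) = d i" and k_d: "\<And>i. i \<in> I \<Longrightarrow> Comp LM k (d i) = c i"
    unfolding full_subcat_Comp full_subcat_Ident by blast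
  have h: "h \<in> Hom LM L L'" and k: "k \<in> Hom LM L' L"
    using h k by (auto simp: full_subcat_Hom split: if_splits)
  show "pointwise_colimit I r X T L c"
    unfolding pointwise_colimit_def
  proof
    fix a assume a: "a \<in> Obj R"
    note col = pointwise_colimitD[OF pw a]
    show "elementwise_colimit I r (\<lambda>i. el (X i) a) (\<lambda>i j. comp_at (T i j) a) (el L a) (\<lambda>i. comp_at (c i) a)"
    proof (rule elementwise_colimit_transfer[OF col comp_at_closed[OF h a]])
      show "comp_at k a (comp_at h a x) = x" if "x \<in> el L a" for x
        using LM_Comp_apply[OF h a that, of k] kh LM_Ident_apply[OF a that] by simp
      show "comp_at h a (comp_at (c i) a x) = comp_at (d i) a x" if "i \<in> I" "x \<in> el (X i) a" for i x
        using LM_Comp_apply[OF LM_is_coconeD(2)[OF cocone that(1)] a that(2), of h] h_c[OF that(1)] by simp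
      show "comp_at k a (comp_at (d i) a x) = comp_at (c i) a x" if "i \<in> I" "x \<in> el (X i) a" for i x
        using LM_Comp_apply[OF LM_is_coconeD(2)[OF cone that(1)] a that(2), of k] k_d[OF that(1)] by simp
    qed
  qed
qed (rule is_colimit_if_pointwise[where Q = Q, OF dir diag QX cocone QL])

end

section \<open>Modules that preserve small products\<close>

locale small_additive_category_with_products = small_additive_category U R
  for U :: "'u itself" and R :: "('o, 'a) additive_precat" +
  fixes lam :: "'u rel"
  assumes Cinfinite_lam: "Cinfinite lam" and regularCard_lam: "regularCard lam"
    and lam_less: "lam <o |UNIV :: 'u set|" and has_products_lam: "has_products lam R"
begin

abbreviation NM :: "(('o, 'a, 'u) lmod, ('o, 'a, 'u) lmod_arrow) precat" where
  "NM \<equiv> product_preserving_modules lam R"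

lemma small_if_lam: "|A| <o lam \<Longrightarrow> small A"
  by (rule small_ordLess[OF _ lam_less])

lemma lam_UNION: "|I| <o lam \<Longrightarrow> (\<And>i. i \<in> I \<Longrightarrow> |A i| <o lam) \<Longrightarrow> |\<Union>i\<in>I. A i| <o lam"
  by (rule regularCard_UNION_bound[OF Cinfinite_lam regularCard_lam])

lemma lam_finite: "finite A \<Longrightarrow> |A| <o lam"
  using ordLess_ordLeq_trans[OF _ natLeq_ordLeq_cinfinite[OF Cinfinite_lam]]
  by (simp add: finite_iff_ordLess_natLeq)

lemma directed_lam_natLeq: "directed_poset lam I r \<Longrightarrow> directed_poset natLeq I r"
  by (rule directed_poset_mono[OF _ natLeq_ordLeq_cinfinite[OF Cinfinite_lam]])

text \<open>Index sets over other types are transported into the universe, over which \<^const>\<open>has_products\<close> quantifies.\<close>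

lemma R_product_exists:
  fixes S :: "'s set"
  assumes S: "|S| <o lam" and K: "\<And>s. s \<in> S \<Longrightarrow> K s \<in> Obj R"
  shows "\<exists>p \<rho>. is_product R S K p \<rho>"
proof -
  obtain e :: "'s \<Rightarrow> 'u" where e: "inj_on e S" using small_inj_into[OF small_if_lam[OF S]] by blast
  have "|e ` S| <o lam" using ordLeq_ordLess_trans[OF card_of_image S] .
  moreover have "\<forall>i \<in> e ` S. K (inv_into S e i) \<in> Obj R" using K e by simp
  ultimately obtain p \<rho> where p: "is_product R (e ` S) (\<lambda>i. K (inv_into S e i)) p \<rho>"
    using has_products_lam[unfolded has_products_def, rule_format, of "e ` S" "\<lambda>i. K (inv_into S e i)"] by blast
  have "is_product R S (\<lambda>s. K (inv_into S e (e s))) p (\<lambda>s. \<rho> (e s))"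
    by (rule is_product_reindex[OF inj_on_imp_bij_betw[OF e] p])
  then have "is_product R S K p (\<lambda>s. \<rho> (e s))"
    using is_product_cong[of S "\<lambda>s. K (inv_into S e (e s))" K "\<lambda>s. \<rho> (e s)" "\<lambda>s. \<rho> (e s)" R p] e by simp
  then show ?thesis by blast
qed

lemma NM_eq: "NM = full_subcat LM (preserves_products lam R AbU)"
  by (simp add: product_preserving_modules_def)

lemma category_NM: "category NM"
  unfolding NM_eq by (rule category_full_subcat[OF category_LM])

lemma NM_Obj_LM: "X \<in> Obj NM \<Longrightarrow> X \<in> Obj LM"
  by (simp add: NM_eq full_subcat_Obj)

lemma NM_preserves_products: "X \<in> Obj NM \<Longrightarrow> preserves_products lam R AbU X"
  by (simp add: NM_eq full_subcat_Obj)

lemma NM_Hom: "X \<in> Obj NM \<Longrightarrow> Y \<in> Obj NM \<Longrightarrow> Hom NM X Y = Hom LM X Y"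
  by (simp add: NM_eq full_subcat_Obj full_subcat_Hom)

lemma preserves_products_iff:
  assumes X: "X \<in> Obj LM"
  shows "preserves_products lam R AbU X \<longleftrightarrow> (\<forall>(J :: 'u set) K p \<rho>. |J| <o lam \<longrightarrow> (\<forall>j \<in> J. K j \<in> Obj R) \<longrightarrow>
    is_product R J K p \<rho> \<longrightarrow> jointly_bijective J (\<lambda>j. el X (K j)) (el X p) (\<lambda>j. act X (\<rho> j)))"
proof -
  have "is_product AbU J (\<lambda>j. ObjMap X (K j)) (ObjMap X p) (\<lambda>j. ArrMap X (\<rho> j)) \<longleftrightarrow>
      jointly_bijective J (\<lambda>j. el X (K j)) (el X p) (\<lambda>j. act X (\<rho> j))"
    if "|J| <o lam" "\<forall>j \<in> J. K j \<in> Obj R" "is_product R J K p \<rho>" for J :: "'u set" and K p \<rho>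
    using that is_productD[OF that(3)]
    by (intro ab_is_product_iff small_if_lam mod_Obj[OF X] mod_Arr[OF X]) auto
  then show ?thesis unfolding preserves_products_def by (simp cong: imp_cong)
qed

lemma NM_product:
  fixes S :: "'s set"
  assumes X: "X \<in> Obj NM" and S: "|S| <o lam" and K: "\<And>s. s \<in> S \<Longrightarrow> K s \<in> Obj R"
    and p: "is_product R S K p \<rho>"
  shows "jointly_bijective S (\<lambda>s. el X (K s)) (el X p) (\<lambda>s. act X (\<rho> s))"
proof -
  obtain e :: "'s \<Rightarrow> 'u" where e: "inj_on e S" using small_inj_into[OF small_if_lam[OF S]] by blast
  let ?d = "inv_into S e"
  have "|e ` S| <o lam" using ordLeq_ordLess_trans[OF card_of_image S] .
  moreover have "\<forall>i \<in> e ` S. K (?d i) \<in> Obj R" using K e by simp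
  moreover have "is_product R (e ` S) (\<lambda>i. K (?d i)) p (\<lambda>i. \<rho> (?d i))"
    by (rule is_product_reindex[OF bij_betw_inv_into[OF inj_on_imp_bij_betw[OF e]] p])
  moreover have "preserves_products lam R AbU X" using X by (simp add: NM_eq full_subcat_Obj)
  ultimately have "jointly_bijective (e ` S) (\<lambda>i. el X (K (?d i))) (el X p) (\<lambda>i. act X (\<rho> (?d i)))"
    by (intro preserves_products_iff[OF NM_Obj_LM[OF X], THEN iffD1, rule_format]) auto
  then show ?thesis by (rule jointly_bijective_inj_image[OF e])
qed

lemma NM_ObjI:
  assumes "X \<in> Obj LM" and "\<And>(J :: 'u set) K p \<rho>. |J| <o lam \<Longrightarrow> (\<And>j. j \<in> J \<Longrightarrow> K j \<in> Obj R) \<Longrightarrow>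
    is_product R J K p \<rho> \<Longrightarrow> jointly_bijective J (\<lambda>j. el X (K j)) (el X p) (\<lambda>j. act X (\<rho> j))"
  shows "X \<in> Obj NM"
  using assms by (simp add: NM_eq full_subcat_Obj preserves_products_iff)

text \<open>Products commute with products: an element of \<open>P q\<close> is a family of elements of the \<open>X i q\<close>, each of which is a
  family of elements of the \<open>X i (K j)\<close>.\<close>

lemma NM_closed_products:
  assumes X: "\<And>i. i \<in> I \<Longrightarrow> X i \<in> Obj NM" and P: "P \<in> Obj LM"
    and pi: "\<And>i. i \<in> I \<Longrightarrow> \<pi> i \<in> Hom LM P (X i)" and pw: "pointwise_product I X P \<pi>"
  shows "P \<in> Obj NM"
proof (rule NM_ObjI[OF P])
  fix J :: "'u set" and K q \<rho>
  assume J: "|J| <o lam" and K: "\<And>j. j \<in> J \<Longrightarrow> K j \<in> Obj R" and prod: "is_product R J K q \<rho>"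
  note q = is_productD(1)[OF prod] and rho = is_productD(2)[OF prod]
  note bij = pointwise_productD[OF pw]
  note jX = NM_product[OF X J K prod]
  have nat: "act (X i) (\<rho> j) (comp_at (\<pi> i) q x) = comp_at (\<pi> i) (K j) (act P (\<rho> j) x)"
    if "i \<in> I" "j \<in> J" "x \<in> el P q" for i j x
    by (rule comp_at_natural[OF pi rho, symmetric]) (use that in auto)
  show "jointly_bijective J (\<lambda>j. el P (K j)) (el P q) (\<lambda>j. act P (\<rho> j))"
    unfolding jointly_bijective_def
  proof (intro conjI ballI allI impI)
    fix x y assume x: "x \<in> el P q" and y: "y \<in> el P q" and eq: "\<forall>j\<in>J. act P (\<rho> j) x = act P (\<rho> j) y"
    show "x = y"
    proof (rule jointly_bijective_inj[OF bij[OF q] x y])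
      fix i assume i: "i \<in> I"
      show "comp_at (\<pi> i) q x = comp_at (\<pi> i) q y"
        by (rule jointly_bijective_inj[OF jX[OF i]])
          (use nat[OF i] x y eq comp_at_closed[OF pi[OF i] q] in auto)
    qed
  next
    fix z assume z: "\<forall>j\<in>J. z j \<in> el P (K j)"
    have "\<exists>w \<in> el (X i) q. \<forall>j\<in>J. act (X i) (\<rho> j) w = comp_at (\<pi> i) (K j) (z j)" if "i \<in> I" for i
      by (rule jointly_bijective_surj[OF jX[OF that]]) (use z comp_at_closed[OF pi[OF that] K] in auto)
    then have "\<forall>i\<in>I. \<exists>w. w \<in> el (X i) q \<and> (\<forall>j\<in>J. act (X i) (\<rho> j) w = comp_at (\<pi> i) (K j) (z j))" by blast
    from bchoice[OF this] obtain w where w: "\<forall>i\<in>I. w i \<in> el (X i) q \<and> (\<forall>j\<in>J. act (X i) (\<rho> j) (w i) = comp_at (\<pi> i) (K j) (z j))"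
      by blast
    have "\<exists>x \<in> el P q. \<forall>i\<in>I. comp_at (\<pi> i) q x = w i"
      by (rule jointly_bijective_surj[OF bij[OF q]]) (use w in blast)
    then obtain x where x: "x \<in> el P q" "\<forall>i\<in>I. comp_at (\<pi> i) q x = w i" by blast
    have "act P (\<rho> j) x = z j" if j: "j \<in> J" for j
      by (rule jointly_bijective_inj[OF bij[OF K[OF j]] act_closed[OF P rho[OF j] x(1)]])
        (use nat[OF _ j x(1)] x(2) w z j in auto)
    then show "\<exists>x \<in> el P q. \<forall>j \<in> J. act P (\<rho> j) x = z j" using x(1) by blast
  qed
qed

text \<open>Directed colimits over a \<open>lam\<close>-directed poset commute with products over index sets \<open>J\<close> of size less than
  \<open>lam\<close>: whatever happens at a stage depending on \<open>j\<close> happens, for all \<open>j\<close> in \<open>J\<close> at once, at an upper bound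
  of these stages.\<close>

lemma NM_closed_colimits:
  assumes dir: "directed_poset lam I r" and diag: "poset_diagram LM I r X T"
    and X: "\<And>i. i \<in> I \<Longrightarrow> X i \<in> Obj NM"
    and cocone: "is_cocone LM I r X T L c" and pw: "pointwise_colimit I r X T L c"
  shows "L \<in> Obj NM"
proof (rule NM_ObjI)
  note L = LM_is_coconeD(1)[OF cocone] and c = LM_is_coconeD(2)[OF cocone]
  note T = LM_poset_diagramD(2)[OF diag] and XL = LM_poset_diagramD(1)[OF diag]
  have rI: "i \<in> I" "j \<in> I" if "(i, j) \<in> r" for i j using directed_posetD(1)[OF dir] that by auto
  note T_c = LM_cocone_apply[OF cocone _ T]
  show "L \<in> Obj LM" by (rule L)
  fix J :: "'u set" and K q \<rho>
  assume J: "|J| <o lam" and K: "\<And>j. j \<in> J \<Longrightarrow> K j \<in> Obj R" and prod: "is_product R J K q \<rho>"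
  note q = is_productD(1)[OF prod] and rho = is_productD(2)[OF prod]
  note col = pointwise_colimitD[OF pw]
  note jX = NM_product[OF X J K prod]
  have bound: "\<exists>u \<in> I. \<forall>j \<in> J. (s j, u) \<in> r" if "\<And>j. j \<in> J \<Longrightarrow> s j \<in> I" for s
    using directed_poset_bound[OF dir, of "s ` J"] that ordLeq_ordLess_trans[OF card_of_image J, of s] by auto
  have c_nat: "act L (\<rho> j) (comp_at (c i) q x) = comp_at (c i) (K j) (act (X i) (\<rho> j) x)"
    if "i \<in> I" "j \<in> J" "x \<in> el (X i) q" for i j x
    by (rule comp_at_natural[OF c rho, symmetric]) (use that in auto)
  show "jointly_bijective J (\<lambda>j. el L (K j)) (el L q) (\<lambda>j. act L (\<rho> j))"
    unfolding jointly_bijective_def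
  proof (intro conjI ballI allI impI)
    fix z w assume z: "z \<in> el L q" and w: "w \<in> el L q" and eq: "\<forall>j\<in>J. act L (\<rho> j) z = act L (\<rho> j) w"
    obtain i x where i: "i \<in> I" and x: "x \<in> el (X i) q" "comp_at (c i) q x = z"
      using elementwise_colimit_surj[OF col[OF q] z] by blast
    obtain i' y where i': "i' \<in> I" and y: "y \<in> el (X i') q" "comp_at (c i') q y = w"
      using elementwise_colimit_surj[OF col[OF q] w] by blast
    obtain u where u: "u \<in> I" "(i, u) \<in> r" "(i', u) \<in> r"
      using directed_poset_two[OF directed_lam_natLeq[OF dir] i i'] by blast
    let ?x = "comp_at (T i u) q x" and ?y = "comp_at (T i' u) q y"
    have xu: "?x \<in> el (X u) q" "comp_at (c u) q ?x = z" and yu: "?y \<in> el (X u) q" "comp_at (c u) q ?y = w"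
      using comp_at_closed[OF T[OF u(2)] q x(1)] comp_at_closed[OF T[OF u(3)] q y(1)]
        T_c[OF u(2) u(2) q x(1)] T_c[OF u(3) u(3) q y(1)] x(2) y(2) by auto
    have "\<exists>v. (u, v) \<in> r \<and> comp_at (T u v) (K j) (act (X u) (\<rho> j) ?x) = comp_at (T u v) (K j) (act (X u) (\<rho> j) ?y)" if j: "j \<in> J" for j
    proof (rule elementwise_colimit_eq[OF col[OF K[OF j]] u(1)])
      show "act (X u) (\<rho> j) ?x \<in> el (X u) (K j)" "act (X u) (\<rho> j) ?y \<in> el (X u) (K j)"
        using act_closed[OF XL[OF u(1)] rho[OF j]] xu yu by auto
      show "comp_at (c u) (K j) (act (X u) (\<rho> j) ?x) = comp_at (c u) (K j) (act (X u) (\<rho> j) ?y)"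
        using c_nat[OF u(1) j xu(1)] c_nat[OF u(1) j yu(1)] xu(2) yu(2) eq j by simp
    qed
    then have "\<forall>j\<in>J. \<exists>v. (u, v) \<in> r \<and> comp_at (T u v) (K j) (act (X u) (\<rho> j) ?x) = comp_at (T u v) (K j) (act (X u) (\<rho> j) ?y)" by blast
    from bchoice[OF this] obtain v where v: "\<forall>j\<in>J. (u, v j) \<in> r \<and>
        comp_at (T u (v j)) (K j) (act (X u) (\<rho> j) ?x) = comp_at (T u (v j)) (K j) (act (X u) (\<rho> j) ?y)" by blast
    obtain b' where b': "b' \<in> I" "\<forall>j \<in> J. (v j, b') \<in> r" using bound[of v] v rI by blast
    obtain b where b: "b \<in> I" "(u, b) \<in> r" "(b', b) \<in> r"
      using directed_poset_two[OF directed_lam_natLeq[OF dir] u(1) b'(1)] by blast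
    have vb: "(v j, b) \<in> r" if "j \<in> J" for j
      using transD[OF directed_posetD(3)[OF dir]] b(3) b'(2) that by blast
    have T2: "comp_at (T u b) k x = comp_at (T (v j) b) k (comp_at (T u (v j)) k x)"
      if "j \<in> J" "k \<in> Obj R" "x \<in> el (X u) k" for j k x
    proof -
      have uv: "(u, v j) \<in> r" using v that(1) by blast
      show ?thesis
        unfolding LM_poset_diagramD(4)[OF diag uv vb[OF that(1)]]
        by (rule LM_Comp_apply[OF T[OF uv] that(2,3)])
    qed
    have "comp_at (T u b) q ?x = comp_at (T u b) q ?y"
    proof (rule jointly_bijective_inj[OF jX[OF b(1)] comp_at_closed[OF T[OF b(2)] q xu(1)] comp_at_closed[OF T[OF b(2)] q yu(1)]])
      fix j assume j: "j \<in> J"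
      note rx = act_closed[OF XL[OF u(1)] rho[OF j] xu(1)] and ry = act_closed[OF XL[OF u(1)] rho[OF j] yu(1)]
      show "act (X b) (\<rho> j) (comp_at (T u b) q ?x) = act (X b) (\<rho> j) (comp_at (T u b) q ?y)"
        unfolding comp_at_natural[OF T[OF b(2)] rho[OF j] xu(1), symmetric]
          comp_at_natural[OF T[OF b(2)] rho[OF j] yu(1), symmetric]
          T2[OF j K[OF j] rx] T2[OF j K[OF j] ry] using v j by simp
    qed
    then show "z = w"
      using T_c[OF b(2) b(2) q xu(1)] T_c[OF b(2) b(2) q yu(1)] xu(2) yu(2) by simp
  next
    fix z assume z: "\<forall>j\<in>J. z j \<in> el L (K j)"
    have "\<forall>j\<in>J. \<exists>ix. fst ix \<in> I \<and> snd ix \<in> el (X (fst ix)) (K j) \<and> comp_at (c (fst ix)) (K j) (snd ix) = z j"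
    proof
      fix j assume j: "j \<in> J"
      obtain i x where "i \<in> I" "x \<in> el (X i) (K j)" "comp_at (c i) (K j) x = z j"
        using elementwise_colimit_surj[OF col[OF K[OF j]]] z j by blast
      then show "\<exists>ix. fst ix \<in> I \<and> snd ix \<in> el (X (fst ix)) (K j) \<and> comp_at (c (fst ix)) (K j) (snd ix) = z j"
        by (intro exI[of _ "(i, x)"]) simp
    qed
    from bchoice[OF this] obtain ix where ix: "\<forall>j\<in>J. fst (ix j) \<in> I \<and> snd (ix j) \<in> el (X (fst (ix j))) (K j) \<and>
        comp_at (c (fst (ix j))) (K j) (snd (ix j)) = z j" by blast
    obtain b where b: "b \<in> I" "\<forall>j \<in> J. (fst (ix j), b) \<in> r" using bound[of "\<lambda>j. fst (ix j)"] ix by blast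
    let ?w = "\<lambda>j. comp_at (T (fst (ix j)) b) (K j) (snd (ix j))"
    have w: "?w j \<in> el (X b) (K j)" "comp_at (c b) (K j) (?w j) = z j" if j: "j \<in> J" for j
    proof -
      have jb: "(fst (ix j), b) \<in> r" using b(2) j by blast
      show "?w j \<in> el (X b) (K j)" "comp_at (c b) (K j) (?w j) = z j"
        using comp_at_closed[OF T[OF jb] K[OF j]] T_c[OF jb jb K[OF j]] ix j by auto
    qed
    have "\<exists>x \<in> el (X b) q. \<forall>j\<in>J. act (X b) (\<rho> j) x = ?w j"
      by (rule jointly_bijective_surj[OF jX[OF b(1)]]) (use w in auto)
    then obtain x where x: "x \<in> el (X b) q" "\<forall>j\<in>J. act (X b) (\<rho> j) x = ?w j" by blast
    then show "\<exists>x \<in> el L q. \<forall>j \<in> J. act L (\<rho> j) x = z j"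
      using comp_at_closed[OF c[OF b(1)] q x(1)] c_nat[OF b(1) _ x(1)] w by auto
  qed
qed

subsection \<open>Cokernels of maps between representable modules\<close>

lemma postcomp_hom:
  assumes g: "g \<in> Hom R k l" and n: "n \<in> Obj R"
  shows "group_hom (HomGrp R n k) (HomGrp R n l) (Comp R g)"
proof -
  note kl = Hom_Obj[OF g]
  have "Comp R g \<in> hom (HomGrp R n k) (HomGrp R n l)"
    by (rule homI) (use Comp_add_right[OF _ _ g] Comp_closed[OF _ g] HomGrp_carrier n kl in auto)
  then show ?thesis using comm_group_is_group[OF HomGrp_comm_group] n kl
    by (simp add: group_hom_def group_hom_axioms_def)
qed

lemma precomp_hom:
  assumes f: "f \<in> Hom R n m" and k: "k \<in> Obj R"
  shows "group_hom (HomGrp R m k) (HomGrp R n k) (\<lambda>h. Comp R h f)"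
proof -
  note nm = Hom_Obj[OF f]
  have "(\<lambda>h. Comp R h f) \<in> hom (HomGrp R m k) (HomGrp R n k)"
    by (rule homI) (use Comp_add_left[OF f] Comp_closed[OF f] HomGrp_carrier k nm in auto)
  then show ?thesis using comm_group_is_group[OF HomGrp_comm_group] k nm
    by (simp add: group_hom_def group_hom_axioms_def)
qed

text \<open>The module \<open>C\<close> with the element \<open>u\<close> is the cokernel of the map \<open>R(Cod f, -) \<rightarrow> R(Dom f, -)\<close> given by \<open>f\<close>: it
  is generated by \<open>u\<close>, and \<open>g u\<close> vanishes exactly when \<open>g\<close> factors through \<open>f\<close>.\<close>

definition presents :: "'a \<Rightarrow> ('o, 'a, 'u) lmod \<Rightarrow> 'u \<Rightarrow> bool" where
  "presents f C u \<longleftrightarrow> C \<in> Obj LM \<and> u \<in> el C (Dom R f) \<and>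
     (\<forall>k \<in> Obj R. \<forall>z \<in> el C k. \<exists>g \<in> Hom R (Dom R f) k. z = act C g u) \<and>
     (\<forall>k \<in> Obj R. \<forall>g \<in> Hom R (Dom R f) k. act C g u = \<one>\<^bsub>ObjMap C k\<^esub> \<longleftrightarrow> (\<exists>h \<in> Hom R (Cod R f) k. g = Comp R h f))"

lemma presents_exists:
  assumes f: "f \<in> Hom R n m"
  shows "\<exists>C u. presents f C u"
proof -
  note nm = Hom_Obj[OF f]
  have fd: "Dom R f = n" "Cod R f = m" using f by (auto simp: Hom_def)
  have "\<exists>P q. P \<in> Obj AbU \<and> q \<in> hom (HomGrp R n k) P \<and> q ` Hom R n k = carrier P \<and>
      (\<forall>g \<in> Hom R n k. q g = \<one>\<^bsub>P\<^esub> \<longleftrightarrow> (\<exists>h \<in> Hom R m k. g = Comp R h f))" if k: "k \<in> Obj R" for k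
  proof -
    interpret g: group_hom "HomGrp R m k" "HomGrp R n k" "\<lambda>h. Comp R h f" by (rule precomp_hom[OF f k])
    have sm: "small (carrier (HomGrp R n k))"
      using small_subset[OF _ small_Arr, of "Hom R n k"] HomGrp_carrier[OF nm(1) k] by (auto simp: Hom_def)
    obtain P q where "P \<in> Obj AbU" "q \<in> hom (HomGrp R n k) P" "q ` carrier (HomGrp R n k) = carrier P"
      "\<And>x. x \<in> carrier (HomGrp R n k) \<Longrightarrow> q x = \<one>\<^bsub>P\<^esub> \<longleftrightarrow> x \<in> (\<lambda>h. Comp R h f) ` carrier (HomGrp R m k)"
      using ab_quotient_exists[OF HomGrp_comm_group[OF nm(1) k] sm g.img_is_subgroup] by blast
    then show ?thesis
      using HomGrp_carrier[OF nm(1) k] HomGrp_carrier[OF nm(2) k] by (intro exI[of _ P] exI[of _ q]) auto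
  qed
  then have "\<forall>k \<in> Obj R. \<exists>P q. P \<in> Obj AbU \<and> q \<in> hom (HomGrp R n k) P \<and> q ` Hom R n k = carrier P \<and>
      (\<forall>g \<in> Hom R n k. q g = \<one>\<^bsub>P\<^esub> \<longleftrightarrow> (\<exists>h \<in> Hom R m k. g = Comp R h f))" by blast
  from bchoice[OF this] obtain P where "\<forall>k \<in> Obj R. \<exists>q. P k \<in> Obj AbU \<and> q \<in> hom (HomGrp R n k) (P k) \<and> q ` Hom R n k = carrier (P k) \<and>
      (\<forall>g \<in> Hom R n k. q g = \<one>\<^bsub>P k\<^esub> \<longleftrightarrow> (\<exists>h \<in> Hom R m k. g = Comp R h f))" by blast
  from bchoice[OF this] obtain q where *: "\<forall>k \<in> Obj R. P k \<in> Obj AbU \<and> q k \<in> hom (HomGrp R n k) (P k) \<and> q k ` Hom R n k = carrier (P k) \<and>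
      (\<forall>g \<in> Hom R n k. q k g = \<one>\<^bsub>P k\<^esub> \<longleftrightarrow> (\<exists>h \<in> Hom R m k. g = Comp R h f))" by blast
  have P: "P k \<in> Obj AbU" and q_hom: "q k \<in> hom (HomGrp R n k) (P k)"
    and q_img: "q k ` Hom R n k = carrier (P k)"
    and q_one: "g \<in> Hom R n k \<Longrightarrow> q k g = \<one>\<^bsub>P k\<^esub> \<longleftrightarrow> (\<exists>h \<in> Hom R m k. g = Comp R h f)"
    if "k \<in> Obj R" for k g
    using * that by auto
  have q_closed: "q k g \<in> carrier (P k)" if "g \<in> Hom R n k" for k g
    using q_img[OF Hom_Obj(2)[OF that]] that by blast
  have q_mult: "q k (g \<otimes>\<^bsub>HomGrp R n k\<^esub> h) = q k g \<otimes>\<^bsub>P k\<^esub> q k h" if "g \<in> Hom R n k" "h \<in> Hom R n k" for k g h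
    using hom_apply_mult[OF q_hom[OF Hom_Obj(2)[OF that(1)]]] that HomGrp_carrier[OF Hom_Obj[OF that(1)]] by simp
  have q_gh: "group_hom (HomGrp R n k) (P k) (q k)" if "k \<in> Obj R" for k
    using q_hom[OF that] comm_group_is_group[OF HomGrp_comm_group[OF nm(1) that]] ab_Obj_group[OF P[OF that]]
    by (simp add: group_hom_def group_hom_axioms_def)
  define rep where "rep k z = (SOME g. g \<in> Hom R n k \<and> q k g = z)" for k z
  have rep: "rep k z \<in> Hom R n k \<and> q k (rep k z) = z" if "k \<in> Obj R" "z \<in> carrier (P k)" for k z
  proof -
    have "\<exists>g. g \<in> Hom R n k \<and> q k g = z"
      using that(2) unfolding q_img[OF that(1), symmetric] by auto
    from someI_ex[OF this] show ?thesis by (simp add: rep_def)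
  qed
  \<comment> \<open>composition with \<open>g\<close> is well defined on classes, as it preserves the arrows that factor through \<open>f\<close>\<close>
  have q_Comp_cong: "q l (Comp R g h) = q l (Comp R g h')"
    if g: "g \<in> Hom R k l" and h: "h \<in> Hom R n k" "h' \<in> Hom R n k" and eq: "q k h = q k h'" for g k l h h'
  proof -
    note kl = Hom_Obj[OF g]
    interpret G: comm_group "HomGrp R n k" by (rule HomGrp_comm_group[OF nm(1) kl(1)])
    interpret C: group_hom "HomGrp R n k" "HomGrp R n l" "Comp R g" by (rule postcomp_hom[OF g nm(1)])
    note car = HomGrp_carrier[OF nm(1) kl(1)]
    let ?d = "h \<otimes>\<^bsub>HomGrp R n k\<^esub> inv\<^bsub>HomGrp R n k\<^esub> h'"
    have d: "?d \<in> Hom R n k" using G.m_closed G.inv_closed h car by simp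
    have "q k ?d = \<one>\<^bsub>P k\<^esub>" using group_hom_eq_iff[OF q_gh[OF kl(1)], of h h'] h car eq by simp
    then obtain e where e: "e \<in> Hom R m k" "?d = Comp R e f" using q_one[OF kl(1) d] by blast
    have "Comp R g ?d = Comp R (Comp R g e) f" using Comp_assoc[OF f e(1) g] e(2) by simp
    then have "q l (Comp R g ?d) = \<one>\<^bsub>P l\<^esub>"
      using q_one[OF kl(2) Comp_closed[OF d g]] Comp_closed[OF e(1) g] by blast
    moreover have "h \<in> carrier (HomGrp R n k)" "h' \<in> carrier (HomGrp R n k)" using h car by simp_all
    then have "Comp R g ?d = Comp R g h \<otimes>\<^bsub>HomGrp R n l\<^esub> inv\<^bsub>HomGrp R n l\<^esub> Comp R g h'"
      by (simp add: C.hom_mult C.hom_inv)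
    ultimately show ?thesis
      using group_hom_eq_iff[OF q_gh[OF kl(2)], of "Comp R g h" "Comp R g h'"]
        Comp_closed[OF h(1) g] Comp_closed[OF h(2) g] HomGrp_carrier[OF nm(1) kl(2)] by simp
  qed
  define H where "H g = ab_map (P (Dom R g)) (P (Cod R g)) (\<lambda>z. q (Cod R g) (Comp R g (rep (Dom R g) z)))" for g
  have H_q: "amap (H g) (q k h) = q l (Comp R g h)" if g: "g \<in> Hom R k l" and h: "h \<in> Hom R n k" for g h k l
  proof -
    note r = rep[OF Hom_Obj(1)[OF g] q_closed[OF h]]
    have "Dom R g = k" "Cod R g = l" using g by (auto simp: Hom_def)
    then show ?thesis using q_closed[OF h] q_Comp_cong[OF g _ h] r by (simp add: H_def)
  qed
  have q_cases: "\<exists>h \<in> Hom R n k. z = q k h" if "k \<in> Obj R" "z \<in> carrier (P k)" for k z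
    using q_img[OF that(1)] that(2) by blast
  have H: "H g \<in> Hom AbU (P k) (P l)" if g: "g \<in> Hom R k l" for g k l
  proof -
    note kl = Hom_Obj[OF g]
    have gd: "Dom R g = k" "Cod R g = l" using g by (auto simp: Hom_def)
    have "(\<lambda>z. q l (Comp R g (rep k z))) \<in> hom (P k) (P l)"
    proof (rule homI)
      show "q l (Comp R g (rep k z)) \<in> carrier (P l)" if "z \<in> carrier (P k)" for z
        using q_closed[OF Comp_closed[OF _ g]] rep[OF kl(1) that] by blast
      fix z w assume z: "z \<in> carrier (P k)" and w: "w \<in> carrier (P k)"
      have zr: "rep k z \<in> Hom R n k" "q k (rep k z) = z" and wr: "rep k w \<in> Hom R n k" "q k (rep k w) = w"
        using rep[OF kl(1) z] rep[OF kl(1) w] by auto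
      let ?m = "rep k z \<otimes>\<^bsub>HomGrp R n k\<^esub> rep k w"
      note m = HomGrp_mult_closed[OF zr(1) wr(1)]
      have qm: "q k ?m = z \<otimes>\<^bsub>P k\<^esub> w" using q_mult[OF zr(1) wr(1)] zr(2) wr(2) by simp
      have zwr: "rep k (z \<otimes>\<^bsub>P k\<^esub> w) \<in> Hom R n k" "q k (rep k (z \<otimes>\<^bsub>P k\<^esub> w)) = z \<otimes>\<^bsub>P k\<^esub> w"
        using rep[OF kl(1), of "z \<otimes>\<^bsub>P k\<^esub> w"] q_closed[OF m] qm by auto
      have "q l (Comp R g (rep k (z \<otimes>\<^bsub>P k\<^esub> w))) = q l (Comp R g ?m)"
        by (rule q_Comp_cong[OF g zwr(1) m]) (use zwr(2) qm in simp)
      then show "q l (Comp R g (rep k (z \<otimes>\<^bsub>P k\<^esub> w))) = q l (Comp R g (rep k z)) \<otimes>\<^bsub>P l\<^esub> q l (Comp R g (rep k w))"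
        using Comp_add_right[OF zr(1) wr(1) g] q_mult[OF Comp_closed[OF zr(1) g] Comp_closed[OF wr(1) g]] by simp
    qed
    then show ?thesis unfolding H_def gd by (rule ab_map_in_Hom[OF P[OF kl(1)] P[OF kl(2)]])
  qed
  let ?C = "\<lparr>ObjMap = P, ArrMap = H\<rparr>"
  have C: "?C \<in> Obj LM"
  proof (rule LM_intro[OF P H])
    fix k z assume k: "k \<in> Obj R" and z: "z \<in> carrier (P k)"
    then obtain h where "h \<in> Hom R n k" "z = q k h" using q_cases by blast
    then show "amap (H (Ident R k)) z = z" using H_q[OF Ident_closed[OF k]] Ident_Comp by simp
  next
    fix a b c g g' z assume g: "g \<in> Hom R a b" and g': "g' \<in> Hom R b c" and z: "z \<in> carrier (P a)"
    obtain h where h: "h \<in> Hom R n a" "z = q a h" using q_cases[OF Hom_Obj(1)[OF g] z] by blast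
    show "amap (H (Comp R g' g)) z = amap (H g') (amap (H g) z)"
      using H_q[OF Comp_closed[OF g g'] h(1)] H_q[OF g h(1)] H_q[OF g' Comp_closed[OF h(1) g]] Comp_assoc[OF h(1) g g'] h(2)
      by simp
  next
    fix a b g g' z assume g: "g \<in> Hom R a b" and g': "g' \<in> Hom R a b" and z: "z \<in> carrier (P a)"
    obtain h where h: "h \<in> Hom R n a" "z = q a h" using q_cases[OF Hom_Obj(1)[OF g] z] by blast
    show "amap (H (g \<otimes>\<^bsub>HomGrp R a b\<^esub> g')) z = amap (H g) z \<otimes>\<^bsub>P b\<^esub> amap (H g') z"
      using H_q[OF HomGrp_mult_closed[OF g g'] h(1)] H_q[OF g h(1)] H_q[OF g' h(1)] Comp_add_left[OF h(1) g g'] h(2)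
        q_mult[OF Comp_closed[OF h(1) g] Comp_closed[OF h(1) g']] by simp
  qed
  note id = Ident_closed[OF nm(1)]
  have u: "amap (H g) (q n (Ident R n)) = q k g" if "g \<in> Hom R n k" for g k
    using H_q[OF that id] Comp_Ident[OF that] by simp
  have "presents f ?C (q n (Ident R n))"
    unfolding presents_def fd fctr.simps
  proof (intro conjI ballI C)
    show "q n (Ident R n) \<in> carrier (P n)" by (rule q_closed[OF id])
    show "\<exists>g\<in>Hom R n k. z = amap (H g) (q n (Ident R n))" if "k \<in> Obj R" "z \<in> carrier (P k)" for k z
      using q_cases[OF that] u by force
    show "amap (H g) (q n (Ident R n)) = \<one>\<^bsub>P k\<^esub> \<longleftrightarrow> (\<exists>h\<in>Hom R m k. g = Comp R h f)"
      if "k \<in> Obj R" "g \<in> Hom R n k" for k g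
      using u[OF that(2)] q_one[OF that] by simp
  qed
  then show ?thesis by blast
qed

definition coker :: "'a \<Rightarrow> ('o, 'a, 'u) lmod" where
  "coker f = (SOME C. \<exists>u. presents f C u)"

definition gen :: "'a \<Rightarrow> 'u" where
  "gen f = (SOME u. presents f (coker f) u)"

lemma presents_coker:
  assumes "f \<in> Hom R n m"
  shows "presents f (coker f) (gen f)"
proof -
  have "\<exists>u. presents f (coker f) u"
    unfolding coker_def by (rule someI_ex) (rule presents_exists[OF assms])
  then show ?thesis unfolding gen_def by (rule someI_ex)
qed

context
  fixes f n m assumes f: "f \<in> Hom R n m"
begin

lemma Dom_Cod: "Dom R f = n" "Cod R f = m"
  using f by (auto simp: Hom_def)

lemma coker_LM: "coker f \<in> Obj LM"
  and gen_closed: "gen f \<in> el (coker f) n"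
  and coker_cases: "k \<in> Obj R \<Longrightarrow> z \<in> el (coker f) k \<Longrightarrow> \<exists>g \<in> Hom R n k. z = act (coker f) g (gen f)"
  and act_gen_one_iff: "g \<in> Hom R n k \<Longrightarrow>
    act (coker f) g (gen f) = \<one>\<^bsub>ObjMap (coker f) k\<^esub> \<longleftrightarrow> (\<exists>h \<in> Hom R m k. g = Comp R h f)"
  using presents_coker[OF f] Hom_Obj(2)[of g n k] unfolding presents_def Dom_Cod by auto

lemma act_gen_relation: "act (coker f) f (gen f) = \<one>\<^bsub>ObjMap (coker f) m\<^esub>"
  using act_gen_one_iff[OF f] Ident_closed[OF Hom_Obj(2)[OF f]] Ident_Comp[OF f, symmetric] by blast

lemma coker_Hom_eqI:
  assumes s: "s \<in> Hom LM (coker f) M" and t: "t \<in> Hom LM (coker f) M"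
    and eq: "comp_at s n (gen f) = comp_at t n (gen f)"
  shows "s = t"
proof (rule LM_Hom_eqI[OF s t])
  fix k z assume k: "k \<in> Obj R" and z: "z \<in> el (coker f) k"
  obtain g where g: "g \<in> Hom R n k" "z = act (coker f) g (gen f)" using coker_cases[OF k z] by blast
  show "comp_at s k z = comp_at t k z"
    unfolding g(2) comp_at_natural[OF s g(1) gen_closed] comp_at_natural[OF t g(1) gen_closed] eq ..
qed

text \<open>One half of the Yoneda lemma for cokernels, the map being \<open>g u \<mapsto> g x\<close> for the generator \<open>u\<close>; uniqueness is
  lemma \<open>coker_Hom_eqI\<close>.\<close>

lemma coker_map_exists:
  assumes M: "M \<in> Obj LM" and x: "x \<in> el M n" and fx: "act M f x = \<one>\<^bsub>ObjMap M m\<^esub>"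
  shows "\<exists>t \<in> Hom LM (coker f) M. comp_at t n (gen f) = x"
proof -
  note n = Hom_Obj(1)[OF f] and C = coker_LM
  have cong: "act M g x = act M g' x"
    if k: "k \<in> Obj R" and g: "g \<in> Hom R n k" and g': "g' \<in> Hom R n k"
      and eq: "act (coker f) g (gen f) = act (coker f) g' (gen f)" for k g g'
  proof -
    interpret G: comm_group "HomGrp R n k" by (rule HomGrp_comm_group[OF n k])
    interpret Mk: group "ObjMap M k" by (rule mod_group[OF M k])
    interpret Ck: group "ObjMap (coker f) k" by (rule mod_group[OF C k])
    let ?d = "g \<otimes>\<^bsub>HomGrp R n k\<^esub> inv\<^bsub>HomGrp R n k\<^esub> g'"
    have car: "carrier (HomGrp R n k) = Hom R n k" by (rule HomGrp_carrier[OF n k])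
    have d: "?d \<in> Hom R n k" using G.m_closed G.inv_closed g g' car by simp
    have "g \<in> carrier (HomGrp R n k)" "g' \<in> carrier (HomGrp R n k)" using g g' car by simp_all
    then have dg: "?d \<otimes>\<^bsub>HomGrp R n k\<^esub> g' = g" by (simp add: G.m_assoc)
    have "act (coker f) ?d (gen f) \<otimes>\<^bsub>ObjMap (coker f) k\<^esub> act (coker f) g' (gen f) = act (coker f) g (gen f)"
      using act_add[OF C d g' gen_closed] dg by simp
    then have "act (coker f) ?d (gen f) = \<one>\<^bsub>ObjMap (coker f) k\<^esub>"
      using eq act_closed[OF C d gen_closed] act_closed[OF C g' gen_closed] Ck.r_cancel_one by simp
    then obtain h where h: "h \<in> Hom R m k" "?d = Comp R h f" using act_gen_one_iff[OF d] by blast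
    have "act M ?d x = \<one>\<^bsub>ObjMap M k\<^esub>"
      unfolding h(2) using act_Comp[OF M f h(1) x] fx act_one[OF M h(1)] by simp
    then show ?thesis using act_add[OF M d g' x] dg act_closed[OF M g' x] by simp
  qed
  define rep where "rep k z = (SOME g. g \<in> Hom R n k \<and> z = act (coker f) g (gen f))" for k z
  have rep: "rep k z \<in> Hom R n k \<and> z = act (coker f) (rep k z) (gen f)" if "k \<in> Obj R" "z \<in> el (coker f) k" for k z
    unfolding rep_def by (rule someI_ex[OF coker_cases[OF that, unfolded Bex_def]])
  define h where "h k = ab_map (ObjMap (coker f) k) (ObjMap M k) (\<lambda>z. act M (rep k z) x)" for k
  have h_act: "amap (h k) (act (coker f) g (gen f)) = act M g x" if g: "g \<in> Hom R n k" for g k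
  proof -
    note k = Hom_Obj(2)[OF g] and z = act_closed[OF C g gen_closed]
    show ?thesis using z rep[OF k z] cong[OF k _ g] by (simp add: h_def)
  qed
  have h: "h k \<in> Hom AbU (ObjMap (coker f) k) (ObjMap M k)" if k: "k \<in> Obj R" for k
  proof -
    have "(\<lambda>z. act M (rep k z) x) \<in> hom (ObjMap (coker f) k) (ObjMap M k)"
    proof (rule homI)
      show "act M (rep k z) x \<in> el M k" if "z \<in> el (coker f) k" for z
        using act_closed[OF M _ x] rep[OF k that] by blast
      fix z w assume z: "z \<in> el (coker f) k" and w: "w \<in> el (coker f) k"
      obtain a where a: "a \<in> Hom R n k" "z = act (coker f) a (gen f)" using coker_cases[OF k z] by blast
      obtain b where b: "b \<in> Hom R n k" "w = act (coker f) b (gen f)" using coker_cases[OF k w] by blast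
      have "z \<otimes>\<^bsub>ObjMap (coker f) k\<^esub> w = act (coker f) (a \<otimes>\<^bsub>HomGrp R n k\<^esub> b) (gen f)"
        using act_add[OF C a(1) b(1) gen_closed] a(2) b(2) by simp
      moreover have "act M (rep k y) x = amap (h k) y" if "y \<in> el (coker f) k" for y
        using that by (simp add: h_def)
      ultimately show "act M (rep k (z \<otimes>\<^bsub>ObjMap (coker f) k\<^esub> w)) x
          = act M (rep k z) x \<otimes>\<^bsub>ObjMap M k\<^esub> act M (rep k w) x"
        using z w mod_mult_closed[OF C k z w] h_act[OF HomGrp_mult_closed[OF a(1) b(1)]] h_act[OF a(1)] h_act[OF b(1)]
          a(2) b(2) act_add[OF M a(1) b(1) x] by simp
    qed
    then show ?thesis unfolding h_def by (rule ab_map_in_Hom[OF mod_Obj[OF C k] mod_Obj[OF M k]])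
  qed
  have t: "mod_map (coker f) M h \<in> Hom LM (coker f) M"
  proof (rule mod_map_in_Hom[OF C M h])
    fix a b g z assume g: "g \<in> Hom R a b" and z: "z \<in> el (coker f) a"
    obtain e where e: "e \<in> Hom R n a" "z = act (coker f) e (gen f)" using coker_cases[OF Hom_Obj(1)[OF g] z] by blast
    show "amap (h b) (act (coker f) g z) = act M g (amap (h a) z)"
      unfolding e(2) act_Comp[OF C e(1) g gen_closed, symmetric] h_act[OF Comp_closed[OF e(1) g]] h_act[OF e(1)]
      by (rule act_Comp[OF M e(1) g x])
  qed
  have "comp_at (mod_map (coker f) M h) n (gen f) = x"
    using h_act[OF Ident_closed[OF n]] act_Ident[OF C n gen_closed] act_Ident[OF M n x] n by simp
  then show ?thesis using t by blast
qed

text \<open>A cokernel of maps between product-preserving modules preserves products. Directly: a family of elements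
  \<open>g j u\<close> lifts to \<open>g u\<close>, where \<open>g\<close> has components \<open>g j\<close>; and if all components of \<open>g\<close> factor through \<open>f\<close>,
  then the factors assemble to a factorisation of \<open>g\<close>.\<close>

lemma coker_NM: "coker f \<in> Obj NM"
proof (rule NM_ObjI[OF coker_LM])
  note C = coker_LM
  fix J :: "'u set" and K p \<rho>
  assume J: "|J| <o lam" and K: "\<And>j. j \<in> J \<Longrightarrow> K j \<in> Obj R" and prod: "is_product R J K p \<rho>"
  note p = is_productD(1)[OF prod] and rho = is_productD(2)[OF prod]
  note n = Hom_Obj(1)[OF f] and m = Hom_Obj(2)[OF f]
  show "jointly_bijective J (\<lambda>j. el (coker f) (K j)) (el (coker f) p) (\<lambda>j. act (coker f) (\<rho> j))"
    unfolding jointly_bijective_def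
  proof (intro conjI ballI allI impI)
    fix x y assume x: "x \<in> el (coker f) p" and y: "y \<in> el (coker f) p"
      and eq: "\<forall>j\<in>J. act (coker f) (\<rho> j) x = act (coker f) (\<rho> j) y"
    interpret Cp: group "ObjMap (coker f) p" by (rule mod_group[OF C p])
    let ?w = "x \<otimes>\<^bsub>ObjMap (coker f) p\<^esub> inv\<^bsub>ObjMap (coker f) p\<^esub> y"
    obtain g where g: "g \<in> Hom R n p" "?w = act (coker f) g (gen f)"
      using coker_cases[OF p, of ?w] x y by auto
    have "\<forall>j\<in>J. \<exists>h. h \<in> Hom R m (K j) \<and> Comp R (\<rho> j) g = Comp R h f"
    proof
      fix j assume j: "j \<in> J"
      have "act (coker f) (\<rho> j) ?w = \<one>\<^bsub>ObjMap (coker f) (K j)\<^esub>"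
        using group_hom_eq_iff[OF ab_apply_hom[OF mod_Arr[OF C rho[OF j]]] x y] eq j by simp
      then show "\<exists>h. h \<in> Hom R m (K j) \<and> Comp R (\<rho> j) g = Comp R h f"
        using act_gen_one_iff[OF Comp_closed[OF g(1) rho[OF j]]] act_Comp[OF C g(1) rho[OF j] gen_closed] g(2) by auto
    qed
    from bchoice[OF this] obtain h where h: "\<forall>j\<in>J. h j \<in> Hom R m (K j) \<and> Comp R (\<rho> j) g = Comp R (h j) f" by blast
    obtain h' where h': "h' \<in> Hom R m p" "\<forall>j\<in>J. Comp R (\<rho> j) h' = h j"
      using ex1_implies_ex[OF is_product_universal[OF prod m, of h]] h by blast
    have "Comp R h' f = g"
      by (rule is_product_Hom_eqI[OF category_axioms prod Comp_closed[OF f h'(1)] g(1)])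
        (use Comp_assoc[OF f h'(1) rho] h'(2) h in simp)
    then have "?w = \<one>\<^bsub>ObjMap (coker f) p\<^esub>" using act_gen_one_iff[OF g(1)] h'(1) g(2) by auto
    then show "x = y" using x y Cp.inv_equality[of x "inv\<^bsub>ObjMap (coker f) p\<^esub> y"] by simp
  next
    fix z assume z: "\<forall>j\<in>J. z j \<in> el (coker f) (K j)"
    have "\<forall>j\<in>J. \<exists>g. g \<in> Hom R n (K j) \<and> z j = act (coker f) g (gen f)"
      using coker_cases[OF K] z by blast
    from bchoice[OF this] obtain g where g: "\<forall>j\<in>J. g j \<in> Hom R n (K j) \<and> z j = act (coker f) (g j) (gen f)" by blast
    obtain e where e: "e \<in> Hom R n p" "\<forall>j\<in>J. Comp R (\<rho> j) e = g j"
      using ex1_implies_ex[OF is_product_universal[OF prod n, of g]] g by blast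
    have "act (coker f) (\<rho> j) (act (coker f) e (gen f)) = z j" if "j \<in> J" for j
      using act_Comp[OF C e(1) rho[OF that] gen_closed] e(2) g that by simp
    then show "\<exists>x \<in> el (coker f) p. \<forall>j \<in> J. act (coker f) (\<rho> j) x = z j"
      using act_closed[OF C e(1) gen_closed] by blast
  qed
qed

end

section \<open>Presentation by a directed system of cokernels\<close>

definition left_ideal :: "'a \<Rightarrow> 'a set" where
  "left_ideal f = {Comp R h f | h k. h \<in> Hom R (Cod R f) k}"

lemma left_ideal_self: "f \<in> Hom R n m \<Longrightarrow> f \<in> left_ideal f"
  using Ident_closed[OF Hom_Obj(2)] Ident_Comp[of f n m]
  by (auto simp: left_ideal_def Hom_def intro!: exI[of _ "Ident R m"])

lemma left_ideal_Comp:
  assumes f: "f \<in> Hom R n m" and g: "g \<in> left_ideal f" and h: "h \<in> Hom R (Cod R g) l"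
  shows "Comp R h g \<in> left_ideal f"
proof -
  have m: "Cod R f = m" using f by (simp add: Hom_def)
  obtain e k where e: "e \<in> Hom R m k" "g = Comp R e f" using g by (auto simp: left_ideal_def m)
  have "Cod R g = k" using Comp_closed[OF f e(1)] e(2) by (simp add: Hom_def)
  then have h: "h \<in> Hom R k l" using h by simp
  have "Comp R h g = Comp R (Comp R h e) f" using Comp_assoc[OF f e(1) h] e(2) by simp
  then show ?thesis using Comp_closed[OF e(1) h] m unfolding left_ideal_def by blast
qed

lemma left_ideal_Hom: "f \<in> Hom R n m \<Longrightarrow> g \<in> left_ideal f \<Longrightarrow> g \<in> Hom R n (Cod R g)"
  using Comp_closed[of f n m] by (auto simp: left_ideal_def Hom_def)

lemma left_ideal_iff: "f \<in> Hom R n m \<Longrightarrow> g \<in> Hom R n k \<Longrightarrow> g \<in> left_ideal f \<longleftrightarrow> (\<exists>h \<in> Hom R m k. g = Comp R h f)"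
  using Comp_closed[of f n m] by (fastforce simp: left_ideal_def Hom_def)

text \<open>The stages are pairs \<open>(S, J)\<close>. Here \<open>S\<close> is a set of fewer than \<open>lam\<close> elements of \<open>X\<close>, a pair \<open>(k, z)\<close> standing for
  the element \<open>z\<close> of \<open>X k\<close>. As \<open>X\<close> preserves the product \<open>p S\<close> of the sorts, \<open>S\<close> corresponds to one
  element \<open>x S\<close> of \<open>X (p S)\<close>. The set \<open>J\<close> consists of the left multiples of an arrow \<open>f\<close> that annihilates
  \<open>x S\<close>, and the module at this stage is the cokernel of \<open>f\<close>, mapped to \<open>X\<close> by sending its generator to
  \<open>x S\<close>. Larger stages have more generators and more relations; recording \<open>J\<close>
  instead of \<open>f\<close> makes this order antisymmetric. Fewer than \<open>lam\<close> stages are bounded by the union of their sets of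
  generators together with the arrow into a product whose components are all their relations. Every
  element of \<open>X\<close> is the image of a generator, and every relation that holds in \<open>X\<close> can be added
  to a stage, so the colimit is \<open>X\<close>.\<close>

theorem directed_presentation:
  assumes X: "X \<in> Obj NM"
  shows "\<exists>(I :: (('o \<times> 'u) set \<times> 'a set) set) r f T c. small I \<and> directed_poset lam I r \<and>
    (\<forall>i \<in> I. f i \<in> Arr R) \<and> poset_diagram LM I r (\<lambda>i. coker (f i)) T \<and>
    is_cocone LM I r (\<lambda>i. coker (f i)) T X c \<and> pointwise_colimit I r (\<lambda>i. coker (f i)) T X c"
proof -
  note XL = NM_Obj_LM[OF X]
  define G where "G = Sigma (Obj R) (el X)"
  define Fam where "Fam = {S. S \<subseteq> G \<and> |S| <o lam}"
  have Fam_fst: "fst s \<in> Obj R" "snd s \<in> el X (fst s)" if "S \<in> Fam" "s \<in> S" for S s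
    using that by (auto simp: Fam_def G_def)
  have Fam_lam: "|S| <o lam" if "S \<in> Fam" for S using that by (simp add: Fam_def)
  have "\<forall>S\<in>Fam. \<exists>p \<rho>. is_product R S fst p \<rho>"
    by (intro ballI R_product_exists Fam_lam Fam_fst(1))
  from bchoice[OF this] obtain p where "\<forall>S\<in>Fam. \<exists>\<rho>. is_product R S fst (p S) \<rho>" by blast
  from bchoice[OF this] obtain \<rho> where "\<forall>S\<in>Fam. is_product R S fst (p S) (\<rho> S)" by blast
  then have prod: "is_product R S fst (p S) (\<rho> S)" if "S \<in> Fam" for S using that by blast
  note p_Obj = is_productD(1)[OF prod] and rho = is_productD(2)[OF prod]
  have jb: "jointly_bijective S (\<lambda>s. el X (fst s)) (el X (p S)) (\<lambda>s. act X (\<rho> S s))" if S: "S \<in> Fam" for S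
    by (rule NM_product[OF X Fam_lam[OF S] Fam_fst(1)[OF S] prod[OF S]])
  have "\<forall>S\<in>Fam. \<exists>x. x \<in> el X (p S) \<and> (\<forall>s\<in>S. act X (\<rho> S s) x = snd s)"
    using jointly_bijective_surj[OF jb, of _ snd] Fam_fst(2) by blast
  from bchoice[OF this] obtain x where x_all: "\<forall>S\<in>Fam. x S \<in> el X (p S) \<and> (\<forall>s\<in>S. act X (\<rho> S s) (x S) = snd s)" by blast
  then have x: "x S \<in> el X (p S)" and rho_x: "s \<in> S \<Longrightarrow> act X (\<rho> S s) (x S) = snd s" if "S \<in> Fam" for S s
    using that by auto
  \<comment> \<open>the projection of \<open>p S'\<close> onto the factors in \<open>S\<close>\<close>
  define pr where "pr S' S = (SOME h. h \<in> Hom R (p S') (p S) \<and> (\<forall>s\<in>S. Comp R (\<rho> S s) h = \<rho> S' s))" for S' S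
  have pr_all: "pr S' S \<in> Hom R (p S') (p S) \<and> (\<forall>s\<in>S. Comp R (\<rho> S s) (pr S' S) = \<rho> S' s)"
    if S: "S \<in> Fam" and S': "S' \<in> Fam" and sub: "S \<subseteq> S'" for S S'
  proof -
    have "\<exists>!h. h \<in> Hom R (p S') (p S) \<and> (\<forall>s\<in>S. Comp R (\<rho> S s) h = \<rho> S' s)"
      by (rule is_product_universal[OF prod[OF S] p_Obj[OF S']]) (use rho[OF S'] sub in blast)
    from someI_ex[OF ex1_implies_ex[OF this]] show ?thesis by (simp add: pr_def)
  qed
  have pr: "pr S' S \<in> Hom R (p S') (p S)" and rho_pr: "s \<in> S \<Longrightarrow> Comp R (\<rho> S s) (pr S' S) = \<rho> S' s"
    if "S \<in> Fam" "S' \<in> Fam" "S \<subseteq> S'" for S S' s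
    using pr_all[OF that] by auto
  have pr_id: "pr S S = Ident R (p S)" if S: "S \<in> Fam" for S
    by (rule is_product_Hom_eqI[OF category_axioms prod[OF S] pr[OF S S order_refl] Ident_closed[OF p_Obj[OF S]]])
      (simp add: rho_pr[OF S S order_refl] Comp_Ident[OF rho[OF S]])
  have pr_Comp: "Comp R (pr S' S) (pr S'' S') = pr S'' S"
    if S: "S \<in> Fam" "S' \<in> Fam" "S'' \<in> Fam" and sub: "S \<subseteq> S'" "S' \<subseteq> S''" for S S' S''
  proof (rule is_product_Hom_eqI[OF category_axioms prod[OF S(1)]])
    note a = pr[OF S(1,2) sub(1)] and b = pr[OF S(2,3) sub(2)] and ab = subset_trans[OF sub]
    show "Comp R (pr S' S) (pr S'' S') \<in> Hom R (p S'') (p S)" by (rule Comp_closed[OF b a])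
    show "pr S'' S \<in> Hom R (p S'') (p S)" by (rule pr[OF S(1,3) ab])
    fix s assume s: "s \<in> S"
    then have s': "s \<in> S'" using sub by blast
    show "Comp R (\<rho> S s) (Comp R (pr S' S) (pr S'' S')) = Comp R (\<rho> S s) (pr S'' S)"
      using Comp_assoc[OF b a rho[OF S(1) s]] rho_pr[OF S(1,2) sub(1) s] rho_pr[OF S(2,3) sub(2) s'] rho_pr[OF S(1,3) ab s] by simp
  qed
  have pr_x: "act X (pr S' S) (x S') = x S" if S: "S \<in> Fam" "S' \<in> Fam" and sub: "S \<subseteq> S'" for S S'
  proof (rule jointly_bijective_inj[OF jb[OF S(1)] act_closed[OF XL pr[OF S sub] x[OF S(2)]] x[OF S(1)]])
    fix s assume s: "s \<in> S"
    then have s': "s \<in> S'" using sub by blast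
    show "act X (\<rho> S s) (act X (pr S' S) (x S')) = act X (\<rho> S s) (x S)"
      using act_Comp[OF XL pr[OF S sub] rho[OF S(1) s] x[OF S(2)]] rho_pr[OF S sub s] rho_x[OF S(1) s] rho_x[OF S(2) s'] by simp
  qed
  define relation where "relation S f m \<longleftrightarrow> f \<in> Hom R (p S) m \<and> act X f (x S) = \<one>\<^bsub>ObjMap X m\<^esub>" for S f m
  define I where "I = {(S, J). S \<in> Fam \<and> (\<exists>f m. relation S f m \<and> J = left_ideal f)}"
  define \<phi> where "\<phi> i = (SOME f. \<exists>m. relation (fst i) f m \<and> snd i = left_ideal f)" for i
  have I_intro: "(S, left_ideal f) \<in> I" if "S \<in> Fam" "relation S f m" for S f m
    using that by (auto simp: I_def)
  have I_Fam: "fst i \<in> Fam" if "i \<in> I" for i using that by (auto simp: I_def)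
  have phi_all: "\<phi> i \<in> Hom R (p (fst i)) (Cod R (\<phi> i)) \<and>
      act X (\<phi> i) (x (fst i)) = \<one>\<^bsub>ObjMap X (Cod R (\<phi> i))\<^esub> \<and> snd i = left_ideal (\<phi> i)" if "i \<in> I" for i
  proof -
    have "\<exists>f m. relation (fst i) f m \<and> snd i = left_ideal f"
      using that unfolding I_def case_prod_unfold by blast
    from someI_ex[OF this] obtain m where m: "relation (fst i) (\<phi> i) m" "snd i = left_ideal (\<phi> i)"
      unfolding \<phi>_def by blast
    then have "Cod R (\<phi> i) = m" by (simp add: relation_def Hom_def)
    then show ?thesis using m by (simp add: relation_def)
  qed
  then have phi: "\<phi> i \<in> Hom R (p (fst i)) (Cod R (\<phi> i))"
    and phi_x: "act X (\<phi> i) (x (fst i)) = \<one>\<^bsub>ObjMap X (Cod R (\<phi> i))\<^esub>"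
    and snd_I: "snd i = left_ideal (\<phi> i)" if "i \<in> I" for i
    using phi_all[OF that] by blast+
  define r where "r = {(i, j). i \<in> I \<and> j \<in> I \<and> fst i \<subseteq> fst j \<and> (\<forall>g \<in> snd i. Comp R g (pr (fst j) (fst i)) \<in> snd j)}"
  have rD: "i \<in> I" "j \<in> I" "fst i \<subseteq> fst j" "fst i \<in> Fam" "fst j \<in> Fam" if "(i, j) \<in> r" for i j
    using that I_Fam by (auto simp: r_def)
  have pr_r: "pr (fst j) (fst i) \<in> Hom R (p (fst j)) (p (fst i))" if "(i, j) \<in> r" for i j
    by (rule pr[OF rD(4,5,3)[OF that]])
  have snd_Hom: "g \<in> Hom R (p (fst i)) (Cod R g)" if "i \<in> I" "g \<in> snd i" for i g
    using left_ideal_Hom[OF phi] that snd_I by simp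
  have r_phi: "Comp R (\<phi> i) (pr (fst j) (fst i)) \<in> left_ideal (\<phi> j)" if ij: "(i, j) \<in> r" for i j
    using ij snd_I[OF rD(1)[OF ij]] snd_I[OF rD(2)[OF ij]] left_ideal_self[OF phi[OF rD(1)[OF ij]]] by (simp add: r_def)
  have r_intro: "(i, j) \<in> r" if i: "i \<in> I" and j: "j \<in> I" and sub: "fst i \<subseteq> fst j"
    and le: "Comp R (\<phi> i) (pr (fst j) (fst i)) \<in> snd j" for i j
  proof -
    note P = pr[OF I_Fam[OF i] I_Fam[OF j] sub]
    have "Comp R g (pr (fst j) (fst i)) \<in> snd j" if g: "g \<in> snd i" for g
    proof -
      obtain h k where h: "h \<in> Hom R (Cod R (\<phi> i)) k" "g = Comp R h (\<phi> i)"
        using g unfolding snd_I[OF i] left_ideal_def by blast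
      have "Cod R (Comp R (\<phi> i) (pr (fst j) (fst i))) = Cod R (\<phi> i)"
        using Comp_closed[OF P phi[OF i]] by (simp add: Hom_def)
      then have "Comp R h (Comp R (\<phi> i) (pr (fst j) (fst i))) \<in> snd j"
        using left_ideal_Comp[OF phi[OF j]] le h(1) snd_I[OF j] by simp
      then show ?thesis using Comp_assoc[OF P phi[OF i] h(1)] h(2) by simp
    qed
    then show ?thesis using i j sub by (simp add: r_def)
  qed
  have "small I"
  proof -
    have "small G" unfolding G_def by (rule small_Sigma[OF small_Obj mod_small[OF XL]])
    then have "small (Pow G \<times> Pow (Arr R))" by (intro small_Sigma small_Pow small_Arr)
    moreover have "I \<subseteq> Pow G \<times> Pow (Arr R)"
    proof
      fix i assume i: "i \<in> I"
      have "fst i \<subseteq> G" using I_Fam[OF i] by (simp add: Fam_def)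
      moreover have "snd i \<subseteq> Arr R" using snd_Hom[OF i] by (auto simp: Hom_def)
      ultimately show "i \<in> Pow G \<times> Pow (Arr R)" by (simp add: mem_Times_iff)
    qed
    ultimately show ?thesis using small_subset by blast
  qed
  moreover have "directed_poset lam I r"
    unfolding directed_poset_def
  proof (intro conjI allI impI)
    have "(i, i) \<in> r" if "i \<in> I" for i
      using that pr_id[OF I_Fam[OF that]] Comp_Ident[OF snd_Hom[OF that]] by (simp add: r_def)
    moreover have "trans r"
    proof (rule transI)
      fix i j k assume ij: "(i, j) \<in> r" and jk: "(j, k) \<in> r"
      have "Comp R g (pr (fst k) (fst i)) \<in> snd k" if g: "g \<in> snd i" for g
      proof -
        have "Comp R (Comp R g (pr (fst j) (fst i))) (pr (fst k) (fst j)) \<in> snd k"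
          using ij jk g by (simp add: r_def)
        then show ?thesis
          using Comp_assoc[OF pr_r[OF jk] pr_r[OF ij] snd_Hom[OF rD(1)[OF ij] g]]
            pr_Comp[OF rD(4)[OF ij] rD(5)[OF ij] rD(5)[OF jk] rD(3)[OF ij] rD(3)[OF jk]] by simp
      qed
      then show "(i, k) \<in> r" using ij jk by (auto simp: r_def)
    qed
    moreover have "antisym r"
    proof (rule antisymI)
      fix i j assume ij: "(i, j) \<in> r" and ji: "(j, i) \<in> r"
      have eq: "fst i = fst j" using rD(3)[OF ij] rD(3)[OF ji] by blast
      have "g \<in> snd j" if g: "g \<in> snd i" for g
        using ij g Comp_Ident[OF snd_Hom[OF rD(1)[OF ij] g]] pr_id[OF rD(4)[OF ij]] eq by (auto simp: r_def)
      moreover have "g \<in> snd i" if g: "g \<in> snd j" for g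
        using ji g Comp_Ident[OF snd_Hom[OF rD(1)[OF ji] g]] pr_id[OF rD(4)[OF ji]] eq by (auto simp: r_def)
      ultimately show "i = j" using eq by (intro prod_eqI) auto
    qed
    moreover have "r \<subseteq> I \<times> I" by (auto simp: r_def)
    ultimately show "partial_order_on I r"
      by (simp add: partial_order_on_def preorder_on_def refl_on_def)
    fix A assume A: "A \<subseteq> I" "|A| <o lam"
    define S where "S = (\<Union>a\<in>A. fst a)"
    have A_Fam: "fst a \<in> Fam" if "a \<in> A" for a using I_Fam A(1) that by blast
    have S: "S \<in> Fam"
      using lam_UNION[OF A(2), of fst] A_Fam by (auto simp: S_def Fam_def)
    have sub: "fst a \<subseteq> S" if "a \<in> A" for a using that by (auto simp: S_def)
    have P: "pr S (fst a) \<in> Hom R (p S) (p (fst a))" if "a \<in> A" for a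
      by (rule pr[OF A_Fam[OF that] S sub[OF that]])
    note A_phi = phi[OF subsetD[OF A(1)]]
    \<comment> \<open>collect the relations of all stages in \<open>A\<close> in one arrow\<close>
    obtain q \<sigma> where q: "is_product R A (\<lambda>a. Cod R (\<phi> a)) q \<sigma>"
      using R_product_exists[OF A(2), of "\<lambda>a. Cod R (\<phi> a)"] Hom_Obj(2)[OF A_phi] by blast
    note sigma = is_productD(2)[OF q]
    obtain f where f: "f \<in> Hom R (p S) q" and sigma_f: "\<And>a. a \<in> A \<Longrightarrow> Comp R (\<sigma> a) f = Comp R (\<phi> a) (pr S (fst a))"
      using ex1_implies_ex[OF is_product_universal[OF q p_Obj[OF S], of "\<lambda>a. Comp R (\<phi> a) (pr S (fst a))"]] Comp_closed[OF P A_phi]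
      by blast
    have "act X f (x S) = \<one>\<^bsub>ObjMap X q\<^esub>"
    proof (rule jointly_bijective_inj[OF NM_product[OF X A(2) Hom_Obj(2)[OF A_phi] q] act_closed[OF XL f x[OF S]] mod_one_closed[OF XL is_productD(1)[OF q]]])
      fix a assume a: "a \<in> A"
      have "act X (\<sigma> a) (act X f (x S)) = act X (\<phi> a) (act X (pr S (fst a)) (x S))"
        using act_Comp[OF XL f sigma[OF a] x[OF S]] act_Comp[OF XL P[OF a] A_phi[OF a] x[OF S]] sigma_f[OF a] by simp
      also have "\<dots> = \<one>\<^bsub>ObjMap X (Cod R (\<phi> a))\<^esub>"
        using pr_x[OF A_Fam[OF a] S sub[OF a]] phi_x[OF subsetD[OF A(1) a]] by simp
      finally show "act X (\<sigma> a) (act X f (x S)) = act X (\<sigma> a) \<one>\<^bsub>ObjMap X q\<^esub>"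
        using act_one[OF XL sigma[OF a]] by simp
    qed
    then have "relation S f q" using f by (simp add: relation_def)
    then have u: "(S, left_ideal f) \<in> I" by (rule I_intro[OF S])
    have "(a, (S, left_ideal f)) \<in> r" if a: "a \<in> A" for a
    proof (rule r_intro[OF _ u])
      show "a \<in> I" "fst a \<subseteq> fst (S, left_ideal f)" using a A(1) sub by auto
      have "Comp R (\<sigma> a) f \<in> left_ideal f"
        using left_ideal_Comp[OF f left_ideal_self[OF f]] sigma[OF a] f by (auto simp: Hom_def)
      then show "Comp R (\<phi> a) (pr (fst (S, left_ideal f)) (fst a)) \<in> snd (S, left_ideal f)"
        using sigma_f[OF a] by simp
    qed
    then show "\<exists>u\<in>I. \<forall>a\<in>A. (a, u) \<in> r" using u by blast
  qed
  moreover have "\<forall>i\<in>I. \<phi> i \<in> Arr R" using phi by (simp add: Hom_def)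
  moreover
  let ?C = "\<lambda>i. coker (\<phi> i)" and ?u = "\<lambda>i. gen (\<phi> i)"
  note C = coker_LM[OF phi] and u = gen_closed[OF phi]
  define T where "T i j = (SOME t. t \<in> Hom LM (?C i) (?C j) \<and>
      comp_at t (p (fst i)) (?u i) = act (?C j) (pr (fst j) (fst i)) (?u j))" for i j
  have T_all: "T i j \<in> Hom LM (?C i) (?C j) \<and> comp_at (T i j) (p (fst i)) (?u i) = act (?C j) (pr (fst j) (fst i)) (?u j)"
    if ij: "(i, j) \<in> r" for i j
  proof -
    note i = rD(1)[OF ij] and j = rD(2)[OF ij]
    note P = pr_r[OF ij]
    have "act (?C j) (\<phi> i) (act (?C j) (pr (fst j) (fst i)) (?u j)) = \<one>\<^bsub>ObjMap (?C j) (Cod R (\<phi> i))\<^esub>"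
      using act_Comp[OF C[OF j] P phi[OF i] u[OF j]] r_phi[OF ij] act_gen_one_iff[OF phi[OF j] Comp_closed[OF P phi[OF i]]]
        left_ideal_iff[OF phi[OF j] Comp_closed[OF P phi[OF i]]] by simp
    from coker_map_exists[OF phi[OF i] C[OF j] act_closed[OF C[OF j] P u[OF j]] this]
    have "\<exists>t. t \<in> Hom LM (?C i) (?C j) \<and> comp_at t (p (fst i)) (?u i) = act (?C j) (pr (fst j) (fst i)) (?u j)" by blast
    from someI_ex[OF this] show ?thesis by (simp add: T_def)
  qed
  have T: "T i j \<in> Hom LM (?C i) (?C j)" and T_u: "comp_at (T i j) (p (fst i)) (?u i) = act (?C j) (pr (fst j) (fst i)) (?u j)"
    if "(i, j) \<in> r" for i j
    using T_all[OF that] by auto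
  define c where "c i = (SOME t. t \<in> Hom LM (?C i) X \<and> comp_at t (p (fst i)) (?u i) = x (fst i))" for i
  have c_all: "c i \<in> Hom LM (?C i) X \<and> comp_at (c i) (p (fst i)) (?u i) = x (fst i)" if i: "i \<in> I" for i
  proof -
    have "\<exists>t. t \<in> Hom LM (?C i) X \<and> comp_at t (p (fst i)) (?u i) = x (fst i)"
      using coker_map_exists[OF phi[OF i] XL x[OF I_Fam[OF i]] phi_x[OF i]] by blast
    from someI_ex[OF this] show ?thesis by (simp add: c_def)
  qed
  have c: "c i \<in> Hom LM (?C i) X" and c_u: "comp_at (c i) (p (fst i)) (?u i) = x (fst i)" if "i \<in> I" for i
    using c_all[OF that] by auto
  have c_act: "comp_at (c i) k (act (?C i) g (?u i)) = act X g (x (fst i))" if "i \<in> I" "g \<in> Hom R (p (fst i)) k" for i g k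
    using comp_at_natural[OF c[OF that(1)] that(2) u[OF that(1)]] c_u[OF that(1)] by simp
  have T_act: "comp_at (T i j) k (act (?C i) g (?u i)) = act (?C j) (Comp R g (pr (fst j) (fst i))) (?u j)"
    if "(i, j) \<in> r" "g \<in> Hom R (p (fst i)) k" for i j g k
    using comp_at_natural[OF T[OF that(1)] that(2) u[OF rD(1)[OF that(1)]]] T_u[OF that(1)]
      act_Comp[OF C[OF rD(2)[OF that(1)]] pr_r[OF that(1)] that(2) u[OF rD(2)[OF that(1)]]] by simp
  have r_refl: "(i, i) \<in> r" if "i \<in> I" for i
    using directed_posetD(2)[OF \<open>directed_poset lam I r\<close> that] .
  have "poset_diagram LM I r ?C T"
    unfolding poset_diagram_def
  proof (intro conjI ballI allI impI, goal_cases)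
    case (1 i) then show ?case by (rule C)
  next
    case (2 ij) then show ?case using T by auto
  next
    case (3 i)
    show ?case
      by (rule coker_Hom_eqI[OF phi[OF 3] T[OF r_refl[OF 3]] LM_Ident_in_Hom[OF C[OF 3]]])
        (use T_u[OF r_refl[OF 3]] pr_id[OF I_Fam[OF 3]] act_Ident[OF C[OF 3] p_Obj[OF I_Fam[OF 3]] u[OF 3]]
          LM_Ident_apply[OF p_Obj[OF I_Fam[OF 3]] u[OF 3]] in simp)
  next
    case (4 i j k)
    have ik: "(i, k) \<in> r" using directed_posetD(3)[OF \<open>directed_poset lam I r\<close>] 4 by (rule transD)
    note i = rD(1)[OF 4(1)]
    have "comp_at (Comp LM (T j k) (T i j)) (p (fst i)) (?u i) = comp_at (T j k) (p (fst i)) (act (?C j) (pr (fst j) (fst i)) (?u j))"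
      using LM_Comp_apply[OF T[OF 4(1)] p_Obj[OF I_Fam[OF i]] u[OF i]] T_u[OF 4(1)] by simp
    also have "\<dots> = act (?C k) (pr (fst k) (fst i)) (?u k)"
      using T_act[OF 4(2) pr_r[OF 4(1)]] pr_Comp[OF rD(4)[OF 4(1)] rD(5)[OF 4(1)] rD(5)[OF 4(2)] rD(3)[OF 4(1)] rD(3)[OF 4(2)]] by simp
    finally show ?case
      by (intro coker_Hom_eqI[OF phi[OF i] T[OF ik] LM_Comp_in_Hom[OF T[OF 4(1)] T[OF 4(2)]]]) (simp add: T_u[OF ik])
  qed
  moreover have "is_cocone LM I r ?C T X c"
    unfolding is_cocone_def
  proof (intro conjI ballI, goal_cases)
    case 1 show ?case by (rule XL)
  next
    case (2 i) then show ?case by (rule c)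
  next
    case (3 ij)
    obtain i j where p: "ij = (i, j)" by (cases ij)
    then have ij: "(i, j) \<in> r" using 3 by simp
    note i = rD(1)[OF ij] and j = rD(2)[OF ij]
    have "comp_at (Comp LM (c j) (T i j)) (p (fst i)) (?u i) = act X (pr (fst j) (fst i)) (x (fst j))"
      using LM_Comp_apply[OF T[OF ij] p_Obj[OF I_Fam[OF i]] u[OF i]] T_u[OF ij] c_act[OF j pr_r[OF ij]] by simp
    then have "Comp LM (c j) (T i j) = c i"
      using pr_x[OF rD(4,5,3)[OF ij]] c_u[OF i]
      by (intro coker_Hom_eqI[OF phi[OF i] LM_Comp_in_Hom[OF T[OF ij] c[OF j]] c[OF i]]) simp
    then show ?case by (simp add: p)
  qed
  moreover have "pointwise_colimit I r ?C T X c"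
    unfolding pointwise_colimit_def elementwise_colimit_def
  proof (intro ballI conjI impI)
    fix k z assume k: "k \<in> Obj R" and z: "z \<in> el X k"
    have S: "{(k, z)} \<in> Fam" using k z lam_finite[of "{(k, z)}"] by (simp add: Fam_def G_def)
    \<comment> \<open>the element \<open>z\<close> is the only generator, and the zero arrow imposes no relation\<close>
    let ?o = "\<one>\<^bsub>HomGrp R (p {(k, z)}) (p {(k, z)})\<^esub>"
    have "relation {(k, z)} ?o (p {(k, z)})"
      using HomGrp_one_closed[OF p_Obj[OF S] p_Obj[OF S]] act_zero[OF XL p_Obj[OF S] p_Obj[OF S] x[OF S]]
      by (simp add: relation_def)
    then have i: "({(k, z)}, left_ideal ?o) \<in> I" (is "?i \<in> I") by (rule I_intro[OF S])
    have g: "\<rho> {(k, z)} (k, z) \<in> Hom R (p {(k, z)}) k" using rho[OF S, of "(k, z)"] by simp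
    have "comp_at (c ?i) k (act (?C ?i) (\<rho> {(k, z)} (k, z)) (?u ?i)) = z"
      using c_act[OF i, of "\<rho> {(k, z)} (k, z)" k] g rho_x[OF S, of "(k, z)"] by simp
    moreover have "act (?C ?i) (\<rho> {(k, z)} (k, z)) (?u ?i) \<in> el (?C ?i) k"
      using act_closed[OF C[OF i] _ u[OF i]] g by simp
    ultimately show "\<exists>i\<in>I. \<exists>y\<in>el (?C i) k. comp_at (c i) k y = z" using i by blast
  next
    fix k i y y' assume k: "k \<in> Obj R" and i: "i \<in> I" and y: "y \<in> el (?C i) k" and y': "y' \<in> el (?C i) k"
      and eq: "comp_at (c i) k y = comp_at (c i) k y'"
    let ?S = "fst i"
    note S = I_Fam[OF i]
    interpret Ck: group "ObjMap (?C i) k" by (rule mod_group[OF C[OF i] k])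
    let ?w = "y \<otimes>\<^bsub>ObjMap (?C i) k\<^esub> inv\<^bsub>ObjMap (?C i) k\<^esub> y'"
    obtain e where e: "e \<in> Hom R (p ?S) k" "?w = act (?C i) e (?u i)"
      using coker_cases[OF phi[OF i] k, of ?w] y y' by auto
    have ex: "act X e (x ?S) = \<one>\<^bsub>ObjMap X k\<^esub>"
      using group_hom_eq_iff[OF ab_apply_hom[OF LM_comp_at[OF c[OF i] k]] y y'] eq c_act[OF i e(1)] e(2) by simp
    \<comment> \<open>adjoin the relation \<open>e\<close> to the relation of stage \<open>i\<close>\<close>
    let ?K = "\<lambda>b. if b then k else Cod R (\<phi> i)" and ?f = "\<lambda>b. if b then e else \<phi> i"
    have K: "?K b \<in> Obj R" for b using k Hom_Obj(2)[OF phi[OF i]] by simp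
    have two: "|UNIV :: bool set| <o lam" by (rule lam_finite) simp
    obtain q \<sigma> where q: "is_product R (UNIV :: bool set) ?K q \<sigma>"
      using R_product_exists[OF two, of ?K, OF K] by blast
    note sigma = is_productD(2)[OF q UNIV_I]
    have "?f b \<in> Hom R (p ?S) (?K b)" for b using e(1) phi[OF i] by simp
    then obtain f where f: "f \<in> Hom R (p ?S) q" and sigma_f: "\<And>b. Comp R (\<sigma> b) f = ?f b"
      using ex1_implies_ex[OF is_product_universal[OF q p_Obj[OF S], of ?f]] by blast
    have "act X f (x ?S) = \<one>\<^bsub>ObjMap X q\<^esub>"
    proof (rule jointly_bijective_inj[OF NM_product[OF X two K q] act_closed[OF XL f x[OF S]] mod_one_closed[OF XL is_productD(1)[OF q]]])
      fix b :: bool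
      have "act X (\<sigma> b) (act X f (x ?S)) = act X (?f b) (x ?S)"
        using act_Comp[OF XL f sigma[of b] x[OF S]] sigma_f[of b] by simp
      also have "\<dots> = \<one>\<^bsub>ObjMap X (?K b)\<^esub>" using ex phi_x[OF i] by simp
      finally show "act X (\<sigma> b) (act X f (x ?S)) = act X (\<sigma> b) \<one>\<^bsub>ObjMap X q\<^esub>"
        using act_one[OF XL sigma[of b]] by simp
    qed
    then have "relation ?S f q" using f by (simp add: relation_def)
    then have j: "(?S, left_ideal f) \<in> I" (is "?j \<in> I") by (rule I_intro[OF S])
    have sigma_ideal: "Comp R (\<sigma> b) f \<in> left_ideal f" for b
      using left_ideal_Comp[OF f left_ideal_self[OF f]] sigma[of b] f by (auto simp: Hom_def)
    have id: "pr (fst ?j) (fst i) = Ident R (p ?S)" using pr_id[OF S] by simp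
    have ij: "(i, ?j) \<in> r"
      by (rule r_intro[OF i j]) (use sigma_ideal[of False] sigma_f[of False] id Comp_Ident[OF phi[OF i]] in auto)
    have "e \<in> left_ideal (\<phi> ?j)" using sigma_ideal[of True] sigma_f[of True] snd_I[OF j] by simp
    then have "comp_at (T i ?j) k ?w = \<one>\<^bsub>ObjMap (?C ?j) k\<^esub>"
      using T_act[OF ij e(1)] e(2) id Comp_Ident[OF e(1)] act_gen_one_iff[OF phi[OF j], of e k] left_ideal_iff[OF phi[OF j], of e k] e(1)
      by simp
    then have "comp_at (T i ?j) k y = comp_at (T i ?j) k y'"
      using group_hom_eq_iff[OF ab_apply_hom[OF LM_comp_at[OF T[OF ij] k]] y y'] by simp
    then show "\<exists>j. (i, j) \<in> r \<and> comp_at (T i j) k y = comp_at (T i j) k y'" using ij by blast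
  qed
  ultimately show ?thesis by blast
qed

end

section \<open>Reindexing directed diagrams\<close>

text \<open>The functors in \<^const>\<open>Fun\<close> preserve colimits indexed by posets on subsets of the universe, while the diagrams
  to which they are applied are indexed by posets over other types.\<close>

definition image_rel :: "('i \<Rightarrow> 'j) \<Rightarrow> 'i rel \<Rightarrow> 'j rel" where
  "image_rel e r = {(e i, e j) | i j. (i, j) \<in> r}"

context
  fixes e :: "'i \<Rightarrow> 'j" and I :: "'i set" and r :: "'i rel"
  assumes e: "inj_on e I" and rI: "r \<subseteq> I \<times> I"
begin

lemma image_rel_iff: "i \<in> I \<Longrightarrow> j \<in> I \<Longrightarrow> (e i, e j) \<in> image_rel e r \<longleftrightarrow> (i, j) \<in> r"
proof -
  assume i: "i \<in> I" and j: "j \<in> I"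
  have "(i, j) \<in> r" if "e i = e i'" "e j = e j'" "(i', j') \<in> r" for i' j'
  proof -
    have "i' \<in> I" "j' \<in> I" using that(3) rI by auto
    then show ?thesis using inj_onD[OF e that(1) i] inj_onD[OF e that(2) j] that(3) by simp
  qed
  then show ?thesis by (auto simp: image_rel_def)
qed

lemma image_rel_cases:
  assumes "p \<in> image_rel e r"
  obtains i j where "p = (e i, e j)" "(i, j) \<in> r" "i \<in> I" "j \<in> I"
  using assms rI by (auto simp: image_rel_def)

lemma directed_poset_image_rel:
  assumes dir: "directed_poset m I r"
  shows "directed_poset m (e ` I) (image_rel e r)"
  unfolding directed_poset_def
proof (intro conjI allI impI)
  note d = directed_posetD[OF dir]
  have "image_rel e r \<subseteq> e ` I \<times> e ` I" using rI by (auto simp: image_rel_def)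
  moreover have "refl_on (e ` I) (image_rel e r)" using d(2) by (auto simp: refl_on_def image_rel_def)
  moreover have "trans (image_rel e r)"
  proof (rule transI)
    fix x y z assume "(x, y) \<in> image_rel e r" and yz: "(y, z) \<in> image_rel e r"
    then obtain i j where ij: "x = e i" "y = e j" "(i, j) \<in> r" "i \<in> I" "j \<in> I" by (auto elim!: image_rel_cases)
    obtain j' k where jk: "y = e j'" "z = e k" "(j', k) \<in> r" "j' \<in> I" "k \<in> I" using yz by (auto elim!: image_rel_cases)
    have "j = j'" using inj_onD[OF e _ ij(5) jk(4)] ij(2) jk(1) by simp
    then have "(i, k) \<in> r" using transD[OF d(3) ij(3)] jk(3) by simp
    then show "(x, z) \<in> image_rel e r" using ij(1) jk(2) by (auto simp: image_rel_def)
  qed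
  moreover have "antisym (image_rel e r)"
  proof (rule antisymI)
    fix x y assume "(x, y) \<in> image_rel e r" and yx: "(y, x) \<in> image_rel e r"
    then obtain i j where ij: "x = e i" "y = e j" "(i, j) \<in> r" "i \<in> I" "j \<in> I" by (auto elim!: image_rel_cases)
    have "(j, i) \<in> r" using yx image_rel_iff[OF ij(5,4)] ij(1,2) by simp
    then show "x = y" using antisymD[OF d(4) ij(3)] ij(1,2) by simp
  qed
  ultimately show "partial_order_on (e ` I) (image_rel e r)"
    by (simp add: partial_order_on_def preorder_on_def)
  fix A assume A: "A \<subseteq> e ` I" "|A| <o m"
  let ?B = "inv_into I e ` A"
  have "?B \<subseteq> I" using A(1) by (auto intro: inv_into_into)
  moreover have "|?B| <o m" by (rule ordLeq_ordLess_trans[OF card_of_image A(2)])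
  ultimately obtain u where u: "u \<in> I" "\<forall>b \<in> ?B. (b, u) \<in> r" using directed_poset_bound[OF dir] by blast
  have "(a, e u) \<in> image_rel e r" if a: "a \<in> A" for a
  proof -
    have "(e (inv_into I e a), e u) \<in> image_rel e r" using u(2) a unfolding image_rel_def by blast
    then show ?thesis using f_inv_into_f[OF subsetD[OF A(1) a]] by simp
  qed
  then show "\<exists>u\<in>e ` I. \<forall>a\<in>A. (a, u) \<in> image_rel e r" using u(1) by blast
qed

context
  fixes C :: "('o, 'a, 'z) precat_scheme" and X :: "'i \<Rightarrow> 'o" and T :: "'i \<Rightarrow> 'i \<Rightarrow> 'a"
begin

lemma poset_diagram_image_rel:
  assumes diag: "poset_diagram C I r X T"
  shows "poset_diagram C (e ` I) (image_rel e r) (\<lambda>a. X (inv_into I e a)) (\<lambda>a b. T (inv_into I e a) (inv_into I e b))"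
  unfolding poset_diagram_def
proof (intro conjI ballI allI impI, goal_cases)
  case (1 a) then show ?case using diag e by (auto simp: poset_diagram_def)
next
  case (2 p) then show ?case using diag e by (auto simp: poset_diagram_def elim!: image_rel_cases)
next
  case (3 a) then show ?case using diag e by (auto simp: poset_diagram_def)
next
  case (4 a b c)
  obtain i j where ij: "a = e i" "b = e j" "(i, j) \<in> r" "i \<in> I" "j \<in> I" using 4(1) by (auto elim!: image_rel_cases)
  obtain j' k where jk: "b = e j'" "c = e k" "(j', k) \<in> r" "j' \<in> I" "k \<in> I" using 4(2) by (auto elim!: image_rel_cases)
  have "j = j'" using inj_onD[OF e _ ij(5) jk(4)] ij(2) jk(1) by simp
  then have "T i k = Comp C (T j k) (T i j)" using diag ij(3) jk(3) unfolding poset_diagram_def by blast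
  then show ?case using ij jk e by simp
qed

lemma is_cocone_image_rel:
  "is_cocone C (e ` I) (image_rel e r) (\<lambda>a. X (inv_into I e a)) (\<lambda>a b. T (inv_into I e a) (inv_into I e b)) q d \<longleftrightarrow> is_cocone C I r X T q (\<lambda>i. d (e i))"
proof -
  have "(\<forall>a \<in> e ` I. d a \<in> Hom C (X (inv_into I e a)) q) \<longleftrightarrow> (\<forall>i \<in> I. d (e i) \<in> Hom C (X i) q)" using e by simp
  moreover have "(\<forall>(a, b) \<in> image_rel e r. Comp C (d b) (T (inv_into I e a) (inv_into I e b)) = d a) \<longleftrightarrow>
      (\<forall>(i, j) \<in> r. Comp C (d (e j)) (T i j) = d (e i))"
  proof -
    have 1: "Comp C (d (e j)) (T i j) = d (e i)" if all: "\<forall>(a, b) \<in> image_rel e r. Comp C (d b) (T (inv_into I e a) (inv_into I e b)) = d a" and ij: "(i, j) \<in> r" for i j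
    proof -
      have "i \<in> I" "j \<in> I" using ij rI by auto
      moreover have "(e i, e j) \<in> image_rel e r" using ij by (auto simp: image_rel_def)
      ultimately show ?thesis using all e by fastforce
    qed
    have 2: "Comp C (d b) (T (inv_into I e a) (inv_into I e b)) = d a" if all: "\<forall>(i, j) \<in> r. Comp C (d (e j)) (T i j) = d (e i)" and ab: "(a, b) \<in> image_rel e r" for a b
    proof -
      obtain i j where ij: "a = e i" "b = e j" "(i, j) \<in> r" "i \<in> I" "j \<in> I" using ab by (auto elim!: image_rel_cases)
      then show ?thesis using all e by auto
    qed
    show ?thesis using 1 2 by blast
  qed
  ultimately show ?thesis by (simp add: is_cocone_def)
qed

lemma is_colimit_image_rel:
  assumes colim: "is_colimit C I r X T l c"
  shows "is_colimit C (e ` I) (image_rel e r) (\<lambda>a. X (inv_into I e a)) (\<lambda>a b. T (inv_into I e a) (inv_into I e b)) l (\<lambda>a. c (inv_into I e a))"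
  unfolding is_colimit_def
proof (intro conjI allI impI)
  have "is_cocone C I r X T l (\<lambda>i. c (inv_into I e (e i)))"
    unfolding is_cocone_def
  proof (intro conjI ballI, goal_cases)
    case 1 show ?case using colim by (simp add: is_colimit_def is_cocone_def)
  next
    case (2 i) then show ?case using colim e by (simp add: is_colimit_def is_cocone_def)
  next
    case (3 p)
    obtain i j where p: "p = (i, j)" by (cases p)
    then have "i \<in> I" "j \<in> I" "Comp C (c j) (T i j) = c i"
      using 3 rI colim by (auto simp: is_colimit_def is_cocone_def)
    then show ?case using p e by simp
  qed
  then show "is_cocone C (e ` I) (image_rel e r) (\<lambda>a. X (inv_into I e a)) (\<lambda>a b. T (inv_into I e a) (inv_into I e b)) l (\<lambda>a. c (inv_into I e a))"
    unfolding is_cocone_image_rel .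
  fix q d assume "is_cocone C (e ` I) (image_rel e r) (\<lambda>a. X (inv_into I e a)) (\<lambda>a b. T (inv_into I e a) (inv_into I e b)) q d"
  then have "is_cocone C I r X T q (\<lambda>i. d (e i))" unfolding is_cocone_image_rel .
  then have "\<exists>!h. h \<in> Hom C l q \<and> (\<forall>i\<in>I. Comp C h (c i) = d (e i))"
    using colim unfolding is_colimit_def by simp
  then show "\<exists>!h. h \<in> Hom C l q \<and> (\<forall>a\<in>e ` I. Comp C h (c (inv_into I e a)) = d a)" using e by simp
qed

end

lemma elementwise_colimit_image_rel:
  assumes col: "elementwise_colimit (e ` I) (image_rel e r) (\<lambda>a. X (inv_into I e a))
      (\<lambda>a b. T (inv_into I e a) (inv_into I e b)) L (\<lambda>a. c (inv_into I e a))"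
  shows "elementwise_colimit I r X T L c"
  unfolding elementwise_colimit_def
proof (intro conjI ballI impI)
  fix z assume "z \<in> L"
  from elementwise_colimit_surj[OF col this]
  show "\<exists>i\<in>I. \<exists>x\<in>X i. c i x = z" using e by auto
next
  fix i x y assume i: "i \<in> I" and x: "x \<in> X i" "y \<in> X i" "c i x = c i y"
  have "\<exists>b. (e i, b) \<in> image_rel e r \<and> T (inv_into I e (e i)) (inv_into I e b) x = T (inv_into I e (e i)) (inv_into I e b) y"
    by (rule elementwise_colimit_eq[OF col]) (use i x e in auto)
  then obtain b where b: "(e i, b) \<in> image_rel e r" "T i (inv_into I e b) x = T i (inv_into I e b) y" using e i by auto
  obtain i' j where ij: "e i = e i'" "b = e j" "(i', j) \<in> r" "i' \<in> I" "j \<in> I"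
    using image_rel_cases[OF b(1)] by blast
  have "i' = i" using inj_onD[OF e _ ij(4) i] ij(1) by simp
  then show "\<exists>j. (i, j) \<in> r \<and> T i j x = T i j y" using b(2) ij e by auto
qed

end

section \<open>Functors to abelian groups\<close>

context
  fixes C :: "('o, 'a, 'z) precat_scheme" and F :: "('o, 'a, 'u) lmod"
  assumes C: "category C" and F: "is_functor C Ab F"
begin

lemma functor_Arr: "t \<in> Hom C X Y \<Longrightarrow> ArrMap F t \<in> Hom Ab (ObjMap F X) (ObjMap F Y)"
  using is_functorD(2)[OF F] category.Hom_Obj[OF C] by blast

lemma functor_Comp:
  assumes "s \<in> Hom C X Y" and "t \<in> Hom C Y Z" and "z \<in> el F X"
  shows "act F (Comp C t s) z = act F t (act F s z)"
  using is_functorD(4)[OF F category.Hom_Obj[OF C assms(1)] category.Hom_Obj(2)[OF C assms(2)] assms(1,2)]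
    ab_Comp_apply[OF functor_Arr[OF assms(1)] assms(3)] by simp

lemma functor_Ident: "X \<in> Obj C \<Longrightarrow> z \<in> el F X \<Longrightarrow> act F (Ident C X) z = z"
  using is_functorD(3)[OF F] ab_Ident_apply by simp

end

lemma functor_poset_diagram:
  assumes C: "category C" and G: "is_functor C Ab G" and diag: "poset_diagram C I r X T"
  shows "poset_diagram Ab I r (\<lambda>i. ObjMap G (X i)) (\<lambda>i j. ArrMap G (T i j))"
  unfolding poset_diagram_def
proof (intro conjI ballI allI impI, goal_cases)
  case (1 i) then show ?case using diag is_functorD(1)[OF G] by (auto simp: poset_diagram_def)
next
  case (2 p) then show ?case using diag functor_Arr[OF C G] by (auto simp: poset_diagram_def)
next
  case (3 i) then show ?case using diag is_functorD(3)[OF G] by (auto simp: poset_diagram_def)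
next
  case (4 i j k)
  have T: "T i k = Comp C (T j k) (T i j)" "T i j \<in> Hom C (X i) (X j)" "T j k \<in> Hom C (X j) (X k)"
    using diag 4 unfolding poset_diagram_def by auto
  show ?case unfolding T(1)
    by (rule is_functorD(4)[OF G category.Hom_Obj[OF C T(2)] category.Hom_Obj(2)[OF C T(3)] T(2,3)])
qed

context small_additive_category_with_products
begin

lemma NM_Comp: "Comp NM = Comp LM"
  and NM_Ident: "Ident NM = Ident LM"
  by (simp_all add: NM_eq full_subcat_Comp full_subcat_Ident)

lemma NM_poset_diagram_iff:
  assumes X: "\<And>i. i \<in> I \<Longrightarrow> X i \<in> Obj NM" and rI: "r \<subseteq> I \<times> I"
  shows "poset_diagram NM I r X T \<longleftrightarrow> poset_diagram LM I r X T"
proof -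
  have "(\<forall>(i, j) \<in> r. T i j \<in> Hom NM (X i) (X j)) \<longleftrightarrow> (\<forall>(i, j) \<in> r. T i j \<in> Hom LM (X i) (X j))"
    using NM_Hom[OF X X] rI by blast
  then show ?thesis using X NM_Obj_LM[OF X] by (simp add: poset_diagram_def NM_Comp NM_Ident)
qed

context
  fixes F :: "('o, 'a, 'u) lmod_functor"
  assumes F: "F \<in> Fun lam NM"
begin

lemma F_functor: "is_functor NM AbU F"
  using F by (simp add: Fun_def)

lemma F_Obj: "X \<in> Obj NM \<Longrightarrow> ObjMap F X \<in> Obj AbU"
  by (rule is_functorD(1)[OF F_functor])

context
  fixes X Y assumes X: "X \<in> Obj NM" and Y: "Y \<in> Obj NM"
begin

lemma F_Arr: "t \<in> Hom LM X Y \<Longrightarrow> ArrMap F t \<in> Hom AbU (ObjMap F X) (ObjMap F Y)"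
  using functor_Arr[OF category_NM F_functor] NM_Hom[OF X Y] by blast

lemma F_closed: "t \<in> Hom LM X Y \<Longrightarrow> z \<in> el F X \<Longrightarrow> act F t z \<in> el F Y"
  by (rule ab_apply_closed[OF F_Arr])

lemma F_Comp:
  assumes "Z \<in> Obj NM" and "s \<in> Hom LM X Y" and "t \<in> Hom LM Y Z" and "z \<in> el F X"
  shows "act F (Comp LM t s) z = act F t (act F s z)"
  using functor_Comp[OF category_NM F_functor, of s X Y t Z z] assms NM_Hom X Y by (simp add: NM_Comp)

lemma F_Ident: "z \<in> el F X \<Longrightarrow> act F (Ident LM X) z = z"
  using functor_Ident[OF category_NM F_functor X] by (simp add: NM_Ident)

end

lemma Fun_product:
  fixes I :: "'i set"
  assumes I: "small I" and X: "\<And>i. i \<in> I \<Longrightarrow> X i \<in> Obj NM" and P: "P \<in> Obj NM"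
    and pi: "\<And>i. i \<in> I \<Longrightarrow> \<pi> i \<in> Hom LM P (X i)" and pw: "pointwise_product I X P \<pi>"
  shows "jointly_bijective I (\<lambda>i. el F (X i)) (el F P) (\<lambda>i. act F (\<pi> i))"
proof -
  obtain e :: "'i \<Rightarrow> 'u" where e: "inj_on e I" using small_inj_into[OF I] by blast
  let ?d = "inv_into I e"
  have d: "?d a \<in> I" if "a \<in> e ` I" for a using that by (rule inv_into_into)
  note Q = NM_preserves_products
  have "is_product NM I X P \<pi>"
    unfolding NM_eq by (rule is_product_if_pointwise) (use P X pi pw Q NM_Obj_LM in auto)
  from is_product_reindex[OF bij_betw_inv_into[OF inj_on_imp_bij_betw[OF e]] this]
  have prod: "is_product NM (e ` I) (\<lambda>a. X (?d a)) P (\<lambda>a. \<pi> (?d a))" .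
  have sm: "small (e ` I)" by (rule small_image[OF I])
  have "preserves_products |UNIV :: 'u set| NM AbU F" using F by (simp add: Fun_def)
  from this[unfolded preserves_products_def, rule_format, OF sm[unfolded small_def] _ prod]
  have "is_product AbU (e ` I) (\<lambda>a. ObjMap F (X (?d a))) (ObjMap F P) (\<lambda>a. ArrMap F (\<pi> (?d a)))"
    using X d by blast
  moreover have "ArrMap F (\<pi> (?d a)) \<in> Hom AbU (ObjMap F P) (ObjMap F (X (?d a)))" if "a \<in> e ` I" for a
    by (rule F_Arr[OF P X[OF d[OF that]] pi[OF d[OF that]]])
  ultimately have "jointly_bijective (e ` I) (\<lambda>a. el F (X (?d a))) (el F P) (\<lambda>a. act F (\<pi> (?d a)))"
    by (intro ab_is_product_iff[THEN iffD1, OF sm F_Obj[OF X[OF d]] F_Obj[OF P]])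
  then show ?thesis by (rule jointly_bijective_inj_image[OF e])
qed

lemma Fun_colimit:
  fixes I :: "'i set"
  assumes I: "small I" and dir: "directed_poset lam I r" and diag: "poset_diagram LM I r X T"
    and X: "\<And>i. i \<in> I \<Longrightarrow> X i \<in> Obj NM" and L: "L \<in> Obj NM"
    and cocone: "is_cocone LM I r X T L c" and pw: "pointwise_colimit I r X T L c"
  shows "elementwise_colimit I r (\<lambda>i. el F (X i)) (\<lambda>i j. act F (T i j)) (el F L) (\<lambda>i. act F (c i))"
proof -
  obtain e :: "'i \<Rightarrow> 'u" where e: "inj_on e I" using small_inj_into[OF I] by blast
  let ?d = "inv_into I e" and ?r = "image_rel e r"
  note rI = directed_posetD(1)[OF dir]
  note Q = NM_preserves_products
  have colim: "is_colimit NM I r X T L c"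
    unfolding NM_eq
    by (rule is_colimit_if_pointwise[where Q = "preserves_products lam R AbU", OF directed_lam_natLeq[OF dir] diag Q[OF X] cocone Q[OF L] pw])
  have diagN: "poset_diagram NM I r X T" using diag NM_poset_diagram_iff[of I X r T, OF X rI] by simp
  note dirU = directed_poset_image_rel[OF e rI dir] and diagU = poset_diagram_image_rel[OF e rI diagN]
    and colimU = is_colimit_image_rel[OF e rI colim]
  have sm: "small (e ` I)" by (rule small_image[OF I])
  have "preserves_directed_colimits |UNIV :: 'u set| lam NM AbU F" using F by (simp add: Fun_def)
  from this[unfolded preserves_directed_colimits_def, rule_format, OF sm[unfolded small_def] dirU diagU colimU]
  have Fcolim: "is_colimit AbU (e ` I) ?r (\<lambda>a. ObjMap F (X (?d a))) (\<lambda>a b. ArrMap F (T (?d a) (?d b))) (ObjMap F L) (\<lambda>a. ArrMap F (c (?d a)))" .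
  note Fdiag = functor_poset_diagram[OF category_NM F_functor diagU]
  have "is_cocone AbU (e ` I) ?r (\<lambda>a. ObjMap F (X (?d a))) (\<lambda>a b. ArrMap F (T (?d a) (?d b))) (ObjMap F L) (\<lambda>a. ArrMap F (c (?d a)))"
    using Fcolim by (simp add: is_colimit_def)
  from ab_is_colimit_iff[OF sm directed_lam_natLeq[OF dirU] Fdiag this] Fcolim
  have "elementwise_colimit (e ` I) ?r (\<lambda>a. el F (X (?d a))) (\<lambda>a b. act F (T (?d a) (?d b))) (el F L) (\<lambda>a. act F (c (?d a)))"
    by blast
  from elementwise_colimit_image_rel[OF e rI, of "\<lambda>i. el F (X i)" "\<lambda>i j. act F (T i j)" "el F L" "\<lambda>i. act F (c i)", OF this]
  show ?thesis .
qed

text \<open>Evaluate at the colimit of cokernels that presents \<open>X\<close>.\<close>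

lemma Fun_element_from_coker:
  assumes X: "X \<in> Obj NM" and z: "z \<in> el F X"
  shows "\<exists>f \<in> Arr R. \<exists>t \<in> Hom LM (coker f) X. \<exists>y \<in> el F (coker f). act F t y = z"
proof -
  obtain I :: "(('o \<times> 'u) set \<times> 'a set) set" and r f T c where I: "small I" "directed_poset lam I r" and f: "\<forall>i \<in> I. f i \<in> Arr R"
    and diag: "poset_diagram LM I r (\<lambda>i. coker (f i)) T"
    and cocone: "is_cocone LM I r (\<lambda>i. coker (f i)) T X c" and pw: "pointwise_colimit I r (\<lambda>i. coker (f i)) T X c"
    using directed_presentation[OF X] by blast
  have C: "coker (f i) \<in> Obj NM" if "i \<in> I" for i
    using coker_NM[of "f i" "Dom R (f i)" "Cod R (f i)"] f that by (simp add: Hom_def)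
  obtain i y where "i \<in> I" "y \<in> el F (coker (f i))" "act F (c i) y = z"
    using elementwise_colimit_surj[OF Fun_colimit[OF I diag C X cocone pw] z] by blast
  then show ?thesis using f LM_is_coconeD(2)[OF cocone] by blast
qed

text \<open>The element \<open>y\<close> dies at some stage of the directed system of cokernels presenting \<open>X\<close>. For this to make sense, \<open>t\<close>
  has to factor through a stage; it does since the image of the generator comes from a stage, and the relation
  \<open>f\<close> holds for it at a later one.\<close>

lemma Fun_element_dies_in_coker:
  assumes X: "X \<in> Obj NM" and f: "f \<in> Hom R n m" and t: "t \<in> Hom LM (coker f) X"
    and y: "y \<in> el F (coker f)" and ty: "act F t y = \<one>\<^bsub>ObjMap F X\<^esub>"
  shows "\<exists>g \<in> Arr R. \<exists>s \<in> Hom LM (coker f) (coker g). \<exists>t' \<in> Hom LM (coker g) X.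
    Comp LM t' s = t \<and> act F s y = \<one>\<^bsub>ObjMap F (coker g)\<^esub>"
proof -
  obtain I :: "(('o \<times> 'u) set \<times> 'a set) set" and r \<phi> T c where I: "small I" "directed_poset lam I r" and phi: "\<forall>i \<in> I. \<phi> i \<in> Arr R"
    and diag: "poset_diagram LM I r (\<lambda>i. coker (\<phi> i)) T"
    and cocone: "is_cocone LM I r (\<lambda>i. coker (\<phi> i)) T X c" and pw: "pointwise_colimit I r (\<lambda>i. coker (\<phi> i)) T X c"
    using directed_presentation[OF X] by blast
  let ?C = "\<lambda>i. coker (\<phi> i)"
  have C: "?C i \<in> Obj NM" if "i \<in> I" for i
    using coker_NM[of "\<phi> i" "Dom R (\<phi> i)" "Cod R (\<phi> i)"] phi that by (simp add: Hom_def)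
  note CL = NM_Obj_LM[OF C]
  note c = LM_is_coconeD(2)[OF cocone] and T = LM_poset_diagramD(2)[OF diag] and T_c = LM_cocone_apply[OF cocone _ T]
  have rI: "i \<in> I" "j \<in> I" if "(i, j) \<in> r" for i j using directed_posetD(1)[OF I(2)] that by auto
  note col = pointwise_colimitD[OF pw]
  note n = Hom_Obj(1)[OF f] and m = Hom_Obj(2)[OF f]
  have u: "comp_at t n (gen f) \<in> el X n" by (rule comp_at_closed[OF t n gen_closed[OF f]])
  obtain i x where i: "i \<in> I" and x: "x \<in> el (?C i) n" "comp_at (c i) n x = comp_at t n (gen f)"
    using elementwise_colimit_surj[OF col[OF n] u] by blast
  have "comp_at (c i) m (act (?C i) f x) = comp_at (c i) m \<one>\<^bsub>ObjMap (?C i) m\<^esub>"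
    using comp_at_natural[OF c[OF i] f x(1)] x(2) comp_at_natural[OF t f gen_closed[OF f]] act_gen_relation[OF f]
      comp_at_one[OF t m] comp_at_one[OF c[OF i] m] by simp
  then obtain j where ij: "(i, j) \<in> r" and eq: "comp_at (T i j) m (act (?C i) f x) = comp_at (T i j) m \<one>\<^bsub>ObjMap (?C i) m\<^esub>"
    using elementwise_colimit_eq[OF col[OF m] i act_closed[OF CL[OF i] f x(1)] mod_one_closed[OF CL[OF i] m]] by blast
  note j = rI(2)[OF ij]
  let ?x = "comp_at (T i j) n x"
  have xj: "?x \<in> el (?C j) n" by (rule comp_at_closed[OF T[OF ij] n x(1)])
  have "act (?C j) f ?x = \<one>\<^bsub>ObjMap (?C j) m\<^esub>"
    using comp_at_natural[OF T[OF ij] f x(1)] eq comp_at_one[OF T[OF ij] m] by simp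
  then obtain s where s: "s \<in> Hom LM (coker f) (?C j)" "comp_at s n (gen f) = ?x"
    using coker_map_exists[OF f CL[OF j] xj] by blast
  have "comp_at (Comp LM (c j) s) n (gen f) = comp_at t n (gen f)"
    using LM_Comp_apply[OF s(1) n gen_closed[OF f], of "c j"] s(2) T_c[OF ij ij n x(1)] x(2) by simp
  then have cs: "Comp LM (c j) s = t"
    by (rule coker_Hom_eqI[OF f LM_Comp_in_Hom[OF s(1) c[OF j]] t])
  note Cf = coker_NM[OF f]
  let ?y = "act F s y"
  have yj: "?y \<in> el F (?C j)" by (rule F_closed[OF Cf C[OF j] s(1) y])
  interpret FC: group "ObjMap F (?C j)" by (rule ab_Obj_group[OF F_Obj[OF C[OF j]]])
  have "act F (c j) ?y = act F (c j) \<one>\<^bsub>ObjMap F (?C j)\<^esub>"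
    using F_Comp[OF Cf C[OF j] X s(1) c[OF j] y] cs ty ab_apply_one[OF F_Arr[OF C[OF j] X c[OF j]]] by simp
  then obtain k where jk: "(j, k) \<in> r" and eqk: "act F (T j k) ?y = act F (T j k) \<one>\<^bsub>ObjMap F (?C j)\<^esub>"
    using elementwise_colimit_eq[OF Fun_colimit[OF I diag C X cocone pw] j yj FC.one_closed] by blast
  note k = rI(2)[OF jk]
  have s': "Comp LM (T j k) s \<in> Hom LM (coker f) (?C k)" by (rule LM_Comp_in_Hom[OF s(1) T[OF jk]])
  have "act F (Comp LM (T j k) s) y = \<one>\<^bsub>ObjMap F (?C k)\<^esub>"
    using F_Comp[OF Cf C[OF j] C[OF k] s(1) T[OF jk] y] eqk ab_apply_one[OF F_Arr[OF C[OF j] C[OF k] T[OF jk]]] by simp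
  moreover have "Comp LM (c k) (Comp LM (T j k) s) = t"
    using category.Comp_assoc[OF category_LM s(1) T[OF jk] c[OF k]] LM_is_coconeD(3)[OF cocone jk] cs by simp
  ultimately show ?thesis using phi k s' c[OF k] by blast
qed

end

section \<open>Functors on product-preserving modules are finitely presented\<close>

text \<open>
  One element of the product of all cokernels, repeated for each of their elements, projects to all of these
  elements. It comes from a single cokernel, which therefore maps onto everything. The statement is about
  set-valued functors \<open>E\<close>, with action \<open>ea\<close>, so that it applies both to \<open>F\<close> and to the kernel of an epimorphism
  onto \<open>F\<close>.
\<close>

lemma single_generator:
  fixes E :: "('o, 'a, 'u) lmod \<Rightarrow> 'u set" and ea :: "('o, 'a, 'u) lmod_arrow \<Rightarrow> 'u \<Rightarrow> 'u"
  assumes ea_Comp: "\<And>X Y Z s t z. X \<in> Obj NM \<Longrightarrow> Y \<in> Obj NM \<Longrightarrow> Z \<in> Obj NM \<Longrightarrow> s \<in> Hom LM X Y \<Longrightarrow> t \<in> Hom LM Y Z \<Longrightarrow>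
      z \<in> E X \<Longrightarrow> ea (Comp LM t s) z = ea t (ea s z)"
    and small_E: "\<And>X. X \<in> Obj NM \<Longrightarrow> small (E X)"
    and cover: "\<And>X z. X \<in> Obj NM \<Longrightarrow> z \<in> E X \<Longrightarrow> \<exists>f \<in> Arr R. \<exists>t \<in> Hom LM (coker f) X. \<exists>y \<in> E (coker f). ea t y = z"
    and product: "\<And>(I :: ('a \<times> 'u) set) X P \<pi> z. small I \<Longrightarrow> (\<And>i. i \<in> I \<Longrightarrow> X i \<in> Obj NM) \<Longrightarrow> P \<in> Obj NM \<Longrightarrow>
      (\<And>i. i \<in> I \<Longrightarrow> \<pi> i \<in> Hom LM P (X i)) \<Longrightarrow> pointwise_product I X P \<pi> \<Longrightarrow> (\<And>i. i \<in> I \<Longrightarrow> z i \<in> E (X i)) \<Longrightarrow>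
      \<exists>w \<in> E P. \<forall>i \<in> I. ea (\<pi> i) w = z i"
  shows "\<exists>f \<in> Arr R. \<exists>y \<in> E (coker f). \<forall>X \<in> Obj NM. \<forall>z \<in> E X. \<exists>t \<in> Hom LM (coker f) X. ea t y = z"
proof -
  have C: "coker f \<in> Obj NM" if "f \<in> Arr R" for f
    using coker_NM[of f "Dom R f" "Cod R f"] that by (simp add: Hom_def)
  define I where "I = Sigma (Arr R) (\<lambda>f. E (coker f))"
  have I: "small I" unfolding I_def by (rule small_Sigma[OF small_Arr small_E[OF C]])
  have I_D: "fst i \<in> Arr R" "snd i \<in> E (coker (fst i))" if "i \<in> I" for i using that by (auto simp: I_def)
  have X: "coker (fst i) \<in> Obj NM" if "i \<in> I" for i by (rule C[OF I_D(1)[OF that]])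
  obtain P \<pi> where P: "P \<in> Obj LM" and pi: "\<forall>i \<in> I. \<pi> i \<in> Hom LM P (coker (fst i))"
    and pw: "pointwise_product I (\<lambda>i. coker (fst i)) P \<pi>"
    using pointwise_product_exists[of I "\<lambda>i. coker (fst i)", OF I NM_Obj_LM[OF X]] by blast
  have pi: "\<pi> i \<in> Hom LM P (coker (fst i))" if "i \<in> I" for i using pi that by blast
  have PN: "P \<in> Obj NM" by (rule NM_closed_products[OF X P pi pw])
  obtain w where w: "w \<in> E P" "\<forall>i \<in> I. ea (\<pi> i) w = snd i"
    using product[OF I X PN pi pw I_D(2)] by blast
  obtain f t y where f: "f \<in> Arr R" and t: "t \<in> Hom LM (coker f) P" and y: "y \<in> E (coker f)" "ea t y = w"
    using cover[OF PN w(1)] by blast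
  have "\<exists>t \<in> Hom LM (coker f) X. ea t y = z" if X': "X \<in> Obj NM" and z: "z \<in> E X" for X z
  proof -
    obtain g s v where g: "g \<in> Arr R" and s: "s \<in> Hom LM (coker g) X" and v: "v \<in> E (coker g)" "ea s v = z"
      using cover[OF X' z] by blast
    have i: "(g, v) \<in> I" using g v by (simp add: I_def)
    have pg: "\<pi> (g, v) \<in> Hom LM P (coker g)" and wg: "ea (\<pi> (g, v)) w = v" using pi[OF i] w(2) i by auto
    have pt: "Comp LM (\<pi> (g, v)) t \<in> Hom LM (coker f) (coker g)" by (rule LM_Comp_in_Hom[OF t pg])
    have "ea (Comp LM s (Comp LM (\<pi> (g, v)) t)) y = z"
      using ea_Comp[OF C[OF f] C[OF g] X' pt s y(1)] ea_Comp[OF C[OF f] PN C[OF g] t pg y(1)] y(2) wg v(2) by simp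
    then show ?thesis using LM_Comp_in_Hom[OF pt s] by blast
  qed
  then show ?thesis using f y(1) by blast
qed

definition zero_map :: "('o, 'a, 'u) lmod \<Rightarrow> ('o, 'a, 'u) lmod \<Rightarrow> ('o, 'a, 'u) lmod_arrow" where
  "zero_map X Y = mod_map X Y (\<lambda>k. ab_map (ObjMap X k) (ObjMap Y k) (\<lambda>_. \<one>\<^bsub>ObjMap Y k\<^esub>))"

lemma zero_map_apply: "k \<in> Obj R \<Longrightarrow> x \<in> el X k \<Longrightarrow> comp_at (zero_map X Y) k x = \<one>\<^bsub>ObjMap Y k\<^esub>"
  by (simp add: zero_map_def)

lemma zero_map_in_Hom:
  assumes X: "X \<in> Obj LM" and Y: "Y \<in> Obj LM"
  shows "zero_map X Y \<in> Hom LM X Y"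
  unfolding zero_map_def
proof (rule mod_map_in_Hom[OF X Y])
  fix k assume k: "k \<in> Obj R"
  interpret Yk: group "ObjMap Y k" by (rule mod_group[OF Y k])
  show "ab_map (ObjMap X k) (ObjMap Y k) (\<lambda>_. \<one>\<^bsub>ObjMap Y k\<^esub>) \<in> Hom AbU (ObjMap X k) (ObjMap Y k)"
    by (rule ab_map_in_Hom[OF mod_Obj[OF X k] mod_Obj[OF Y k]]) (simp add: hom_def)
next
  fix a b f x assume f: "f \<in> Hom R a b" and x: "x \<in> el X a"
  show "amap (ab_map (ObjMap X b) (ObjMap Y b) (\<lambda>_. \<one>\<^bsub>ObjMap Y b\<^esub>)) (act X f x)
      = act Y f (amap (ab_map (ObjMap X a) (ObjMap Y a) (\<lambda>_. \<one>\<^bsub>ObjMap Y a\<^esub>)) x)"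
    using x act_closed[OF X f x] act_one[OF Y f] by simp
qed

context
  fixes F :: "('o, 'a, 'u) lmod_functor"
  assumes F: "F \<in> Fun lam NM"
begin

text \<open>The zero map factors through the empty product, and a functor preserving products sends the latter to the trivial
  group.\<close>

lemma Fun_zero_map:
  assumes X: "X \<in> Obj NM" and Y: "Y \<in> Obj NM" and z: "z \<in> el F X"
  shows "act F (zero_map X Y) z = \<one>\<^bsub>ObjMap F Y\<^esub>"
proof -
  note XL = NM_Obj_LM[OF X] and YL = NM_Obj_LM[OF Y]
  have sm: "small ({} :: 'u set)" by (rule small_finite) simp
  obtain Z \<pi> where Z: "Z \<in> Obj LM" and pw: "pointwise_product ({} :: 'u set) (\<lambda>_. X) Z \<pi>"
    using pointwise_product_exists[OF sm, of "\<lambda>_. X"] by blast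
  have ZN: "Z \<in> Obj NM" by (rule NM_closed_products[OF _ Z _ pw]) simp_all
  have jb: "jointly_bijective ({} :: 'u set) (\<lambda>_. el F X) (el F Z) (\<lambda>i. act F (\<pi> i))"
    by (rule Fun_product[OF F sm _ ZN _ pw]) simp_all
  interpret FZ: group "ObjMap F Z" by (rule ab_Obj_group[OF F_Obj[OF F ZN]])
  note a = zero_map_in_Hom[OF XL Z] and b = zero_map_in_Hom[OF Z YL]
  have "act F (zero_map X Z) z = \<one>\<^bsub>ObjMap F Z\<^esub>"
    by (rule jointly_bijective_inj[OF jb F_closed[OF F X ZN a z]]) simp_all
  moreover have "Comp LM (zero_map Z Y) (zero_map X Z) = zero_map X Y"
    by (rule LM_Hom_eqI[OF LM_Comp_in_Hom[OF a b] zero_map_in_Hom[OF XL YL]])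
      (simp add: LM_Comp_apply[OF a] zero_map_apply mod_one_closed[OF Z])
  ultimately show ?thesis
    using F_Comp[OF F X ZN Y a b z] ab_apply_one[OF F_Arr[OF F ZN Y b]] by simp
qed

text \<open>A natural map between product-preserving functors is compatible with the group structures, because addition on
  \<open>X\<close> is a homomorphism \<open>\<sigma>\<close> from the product of two copies of \<open>X\<close>. In particular
  preservation of products makes \<open>F\<close> additive. The subsets \<open>S Y\<close> of \<open>Y k\<close> play the role of a subfunctor of
  evaluation at \<open>k\<close> that is compatible with this product.\<close>

lemma natural_map_multiplicative:
  assumes X: "X \<in> Obj NM" and k: "k \<in> Obj R"
    and S_closed: "\<And>Y. Y \<in> Obj NM \<Longrightarrow> S Y \<subseteq> el Y k"
    and S_product: "\<And>P (\<pi> :: bool \<Rightarrow> _) w. P \<in> Obj NM \<Longrightarrow> (\<And>b. \<pi> b \<in> Hom LM P X) \<Longrightarrow> pointwise_product UNIV (\<lambda>_. X) P \<pi> \<Longrightarrow>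
      w \<in> el P k \<Longrightarrow> (\<And>b. comp_at (\<pi> b) k w \<in> S X) \<Longrightarrow> w \<in> S P"
    and theta_closed: "\<And>Y y. Y \<in> Obj NM \<Longrightarrow> y \<in> S Y \<Longrightarrow> \<theta> Y y \<in> el F Y"
    and theta_natural: "\<And>Y Z t y. Y \<in> Obj NM \<Longrightarrow> Z \<in> Obj NM \<Longrightarrow> t \<in> Hom LM Y Z \<Longrightarrow> y \<in> S Y \<Longrightarrow> \<theta> Z (comp_at t k y) = act F t (\<theta> Y y)"
    and x: "x \<in> S X" and y: "y \<in> S X"
  shows "\<theta> X (x \<otimes>\<^bsub>ObjMap X k\<^esub> y) = \<theta> X x \<otimes>\<^bsub>ObjMap F X\<^esub> \<theta> X y"
proof -
  note XL = NM_Obj_LM[OF X]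
  have two: "small (UNIV :: bool set)" by (rule small_finite) simp
  obtain P and \<pi> :: "bool \<Rightarrow> _" where P: "P \<in> Obj LM" and pi_all: "\<forall>b \<in> UNIV. \<pi> b \<in> Hom LM P X"
    and pw: "pointwise_product (UNIV :: bool set) (\<lambda>_. X) P \<pi>"
    using pointwise_product_exists[OF two, of "\<lambda>_. X"] XL by blast
  have pi: "\<pi> b \<in> Hom LM P X" for b using pi_all by blast
  have PN: "P \<in> Obj NM" by (rule NM_closed_products[OF X P pi pw])
  have bij: "jointly_bijective UNIV (\<lambda>_. el X a) (el P a) (\<lambda>b. comp_at (\<pi> b) a)" if "a \<in> Obj R" for a
    using pw that by (simp add: pointwise_product_def)
  have xy_el: "x \<in> el X k" "y \<in> el X k" using S_closed[OF X] x y by auto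
  have "\<exists>w \<in> el P k. \<forall>b \<in> UNIV. comp_at (\<pi> b) k w = (if b then x else y)"
    by (rule jointly_bijective_surj[OF bij[OF k]]) (use xy_el in simp)
  then obtain w where w: "w \<in> el P k" and pi_w: "\<And>b. comp_at (\<pi> b) k w = (if b then x else y)" by blast
  have wS: "w \<in> S P" by (rule S_product[OF PN pi pw w]) (use pi_w x y in simp)
  have prod: "is_product NM (UNIV :: bool set) (\<lambda>_. X) P \<pi>"
    unfolding NM_eq by (intro is_product_if_pointwise P pi pw NM_preserves_products PN X)
  \<comment> \<open>the two inclusions of \<open>X\<close> into the product\<close>
  have "\<exists>i. i \<in> Hom LM X P \<and> (\<forall>b. Comp LM (\<pi> b) i = (if b = c then Ident LM X else zero_map X X))" for c
    using ex1_implies_ex[OF is_product_universal[OF prod X, of "\<lambda>b. if b = c then Ident LM X else zero_map X X"]]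
      LM_Ident_in_Hom[OF XL] zero_map_in_Hom[OF XL XL] NM_Hom[OF X PN] NM_Hom[OF X X] by (auto simp: NM_Comp)
  then have "\<forall>c \<in> UNIV. \<exists>i. i \<in> Hom LM X P \<and> (\<forall>b. Comp LM (\<pi> b) i = (if b = c then Ident LM X else zero_map X X))" by blast
  from bchoice[OF this] obtain i where i_all: "\<forall>c \<in> UNIV. i c \<in> Hom LM X P \<and> (\<forall>b. Comp LM (\<pi> b) (i c) = (if b = c then Ident LM X else zero_map X X))"
    by blast
  then have i: "i c \<in> Hom LM X P" and pi_i: "Comp LM (\<pi> b) (i c) = (if b = c then Ident LM X else zero_map X X)" for b c
    by auto
  have pi_i_apply: "comp_at (\<pi> b) a (comp_at (i c) a v) = (if b = c then v else \<one>\<^bsub>ObjMap X a\<^esub>)"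
    if "a \<in> Obj R" "v \<in> el X a" for a b c v
  proof -
    have "comp_at (\<pi> b) a (comp_at (i c) a v) = comp_at (if b = c then Ident LM X else zero_map X X) a v"
      using LM_Comp_apply[OF i that, of "\<pi> b" c] pi_i[of b c] by simp
    then show ?thesis using LM_Ident_apply[OF that] zero_map_apply[OF that] by (simp del: not_False_eq_True split: if_splits)
  qed
  interpret FX: group "ObjMap F X" by (rule ab_Obj_group[OF F_Obj[OF F X]])
  interpret FP: group "ObjMap F P" by (rule ab_Obj_group[OF F_Obj[OF F PN]])
  have tx: "\<theta> X x \<in> el F X" and ty: "\<theta> X y \<in> el F X" and tw: "\<theta> P w \<in> el F P"
    using theta_closed X PN x y wS by auto
  have Fi: "act F (i c) z \<in> el F P" if "z \<in> el F X" for c z by (rule F_closed[OF F X PN i that])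
  have Fpi_i: "act F (\<pi> b) (act F (i c) z) = (if b = c then z else \<one>\<^bsub>ObjMap F X\<^esub>)" if "z \<in> el F X" for b c z
    using F_Comp[OF F X PN X i pi that, of b c] pi_i[of b c] F_Ident[OF F X X that] Fun_zero_map[OF X X that] by auto
  have jbF: "jointly_bijective UNIV (\<lambda>_. el F X) (el F P) (\<lambda>b. act F (\<pi> b))"
    by (rule Fun_product[OF F two X PN pi pw])
  \<comment> \<open>an element of \<open>F P\<close> is determined by its two projections\<close>
  have theta_w: "\<theta> P w = act F (i True) (\<theta> X x) \<otimes>\<^bsub>ObjMap F P\<^esub> act F (i False) (\<theta> X y)"
  proof (rule jointly_bijective_inj[OF jbF tw FP.m_closed[OF Fi[OF tx] Fi[OF ty]]])
    fix b :: bool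
    have "act F (\<pi> b) (\<theta> P w) = (if b then \<theta> X x else \<theta> X y)"
      using theta_natural[OF PN X pi wS, of b] pi_w[of b] by (cases b) simp_all
    also have "\<dots> = act F (\<pi> b) (act F (i True) (\<theta> X x) \<otimes>\<^bsub>ObjMap F P\<^esub> act F (i False) (\<theta> X y))"
      using ab_apply_mult[OF F_Arr[OF F PN X pi] Fi[OF tx] Fi[OF ty], of b True False] Fpi_i[OF tx, of b True] Fpi_i[OF ty, of b False] tx ty
      by (cases b) simp_all
    finally show "act F (\<pi> b) (\<theta> P w) = act F (\<pi> b) (act F (i True) (\<theta> X x) \<otimes>\<^bsub>ObjMap F P\<^esub> act F (i False) (\<theta> X y))" .
  qed
  let ?m = "\<lambda>a v. comp_at (\<pi> True) a v \<otimes>\<^bsub>ObjMap X a\<^esub> comp_at (\<pi> False) a v"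
  define \<sigma> where "\<sigma> = mod_map P X (\<lambda>a. ab_map (ObjMap P a) (ObjMap X a) (?m a))"
  have sigma_apply: "comp_at \<sigma> a v = ?m a v" if "a \<in> Obj R" "v \<in> el P a" for a v
    using that by (simp add: \<sigma>_def)
  have sigma: "\<sigma> \<in> Hom LM P X"
    unfolding \<sigma>_def
  proof (rule mod_map_in_Hom[OF P XL])
    fix a assume a: "a \<in> Obj R"
    interpret Xa: comm_group "ObjMap X a" by (rule mod_comm_group[OF XL a])
    have "?m a \<in> hom (ObjMap P a) (ObjMap X a)"
      by (rule homI) (simp_all add: comp_at_closed[OF pi a] comp_at_mult[OF pi a] Xa.m_ac)
    then show "ab_map (ObjMap P a) (ObjMap X a) (?m a) \<in> Hom AbU (ObjMap P a) (ObjMap X a)"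
      by (rule ab_map_in_Hom[OF mod_Obj[OF P a] mod_Obj[OF XL a]])
  next
    fix a b f v assume f: "f \<in> Hom R a b" and v: "v \<in> el P a"
    note a = Hom_Obj(1)[OF f]
    show "amap (ab_map (ObjMap P b) (ObjMap X b) (?m b)) (act P f v) = act X f (amap (ab_map (ObjMap P a) (ObjMap X a) (?m a)) v)"
      using v act_closed[OF P f v] comp_at_natural[OF pi f v] act_mult[OF XL f comp_at_closed[OF pi a v] comp_at_closed[OF pi a v]]
      by simp
  qed
  have sigma_i: "Comp LM \<sigma> (i c) = Ident LM X" for c
  proof (rule LM_Hom_eqI[OF LM_Comp_in_Hom[OF i sigma] LM_Ident_in_Hom[OF XL]])
    fix a v assume a: "a \<in> Obj R" and v: "v \<in> el X a"
    interpret Xa: group "ObjMap X a" by (rule mod_group[OF XL a])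
    show "comp_at (Comp LM \<sigma> (i c)) a v = comp_at (Ident LM X) a v"
      using LM_Comp_apply[OF i a v, of \<sigma> c] sigma_apply[OF a comp_at_closed[OF i a v], of c] pi_i_apply[OF a v, of _ c]
        LM_Ident_apply[OF a v] v by (cases c) simp_all
  qed
  have "\<theta> X (x \<otimes>\<^bsub>ObjMap X k\<^esub> y) = act F \<sigma> (\<theta> P w)"
    using theta_natural[OF PN X sigma wS] sigma_apply[OF k w] pi_w by simp
  also have "\<dots> = act F \<sigma> (act F (i True) (\<theta> X x)) \<otimes>\<^bsub>ObjMap F X\<^esub> act F \<sigma> (act F (i False) (\<theta> X y))"
    unfolding theta_w by (rule ab_apply_mult[OF F_Arr[OF F PN X sigma] Fi[OF tx] Fi[OF ty]])
  also have "\<dots> = \<theta> X x \<otimes>\<^bsub>ObjMap F X\<^esub> \<theta> X y"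
    using F_Comp[OF F X PN X i sigma tx, of True] F_Comp[OF F X PN X i sigma ty, of False] sigma_i
      F_Ident[OF F X X tx] F_Ident[OF F X X ty] by simp
  finally show ?thesis .
qed

text \<open>Let \<open>y0\<close> generate \<open>F\<close>, and let \<open>\<theta>\<close> send an element \<open>x\<close> of \<open>X\<close> annihilated by \<open>f\<close> to the image of \<open>y0\<close> under the
  corresponding homomorphism \<open>coker f \<rightarrow> X\<close>. The elements with \<open>\<theta> X x = \<one>\<close> form a functor \<open>K\<close> which is again
  compatible with products, and whose elements come from cokernels by lemma \<open>Fun_element_dies_in_coker\<close>. So
  \<open>K\<close> is generated by one element \<open>k0\<close> of some cokernel of an arrow \<open>g\<close>. That element is \<open>h u\<close>, where \<open>u\<close> is the
  generator of this cokernel, and \<open>f (h u) = \<one>\<close> means that \<open>f h\<close> factors through \<open>g\<close>.\<close>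

theorem Fun_presentation:
  shows "\<exists>n m n' m' f g h \<theta>. f \<in> Hom R n m \<and> g \<in> Hom R n' m' \<and> h \<in> Hom R n' n \<and>
    (\<exists>e \<in> Hom R m' m. Comp R f h = Comp R e g) \<and>
    (\<forall>X \<in> Obj NM. \<theta> X \<in> hom ((ObjMap X n)\<lparr>carrier := {x \<in> el X n. act X f x = \<one>\<^bsub>ObjMap X m\<^esub>}\<rparr>) (ObjMap F X) \<and>
      \<theta> X ` {x \<in> el X n. act X f x = \<one>\<^bsub>ObjMap X m\<^esub>} = el F X \<and>
      (\<forall>x \<in> el X n. act X f x = \<one>\<^bsub>ObjMap X m\<^esub> \<longrightarrow>
        (\<theta> X x = \<one>\<^bsub>ObjMap F X\<^esub> \<longleftrightarrow> (\<exists>y \<in> el X n'. act X g y = \<one>\<^bsub>ObjMap X m'\<^esub> \<and> act X h y = x)))) \<and>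
    (\<forall>X \<in> Obj NM. \<forall>Y \<in> Obj NM. \<forall>t \<in> Hom LM X Y. \<forall>x \<in> el X n. act X f x = \<one>\<^bsub>ObjMap X m\<^esub> \<longrightarrow>
      \<theta> Y (comp_at t n x) = act F t (\<theta> X x))"
proof -
  have "\<exists>f \<in> Arr R. \<exists>y \<in> el F (coker f). \<forall>X \<in> Obj NM. \<forall>z \<in> el F X. \<exists>t \<in> Hom LM (coker f) X. act F t y = z"
  proof (rule single_generator)
    show "small (el F X)" if "X \<in> Obj NM" for X using F_Obj[OF F that] by (simp add: AbU_Obj_iff)
    fix I :: "('a \<times> 'u) set" and X P \<pi> z
    assume *: "small I" "\<And>i. i \<in> I \<Longrightarrow> X i \<in> Obj NM" "P \<in> Obj NM" "\<And>i. i \<in> I \<Longrightarrow> \<pi> i \<in> Hom LM P (X i)"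
      "pointwise_product I X P \<pi>" and z: "\<And>i. i \<in> I \<Longrightarrow> z i \<in> el F (X i)"
    show "\<exists>w \<in> el F P. \<forall>i \<in> I. act F (\<pi> i) w = z i"
      by (rule jointly_bijective_surj[OF Fun_product[OF F *] z])
  qed (use F_Comp[OF F] Fun_element_from_coker[OF F] in auto)
  then obtain f y0 where "f \<in> Arr R" and y0: "y0 \<in> el F (coker f)"
    and gen_y0: "\<And>X z. X \<in> Obj NM \<Longrightarrow> z \<in> el F X \<Longrightarrow> \<exists>t \<in> Hom LM (coker f) X. act F t y0 = z" by blast
  then obtain n m where f: "f \<in> Hom R n m" by (simp add: Hom_def)
  note n = Hom_Obj(1)[OF f] and m = Hom_Obj(2)[OF f]
  note Cf = coker_NM[OF f] and uf = gen_closed[OF f]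
  define S where "S X = {x \<in> el X n. act X f x = \<one>\<^bsub>ObjMap X m\<^esub>}" for X :: "('o, 'a, 'u) lmod"
  \<comment> \<open>the homomorphism corresponding to \<open>x\<close> under the Yoneda lemma\<close>
  define hat where "hat X x = (SOME t. t \<in> Hom LM (coker f) X \<and> comp_at t n (gen f) = x)" for X x
  have hat_all: "hat X x \<in> Hom LM (coker f) X \<and> comp_at (hat X x) n (gen f) = x" if "X \<in> Obj NM" "x \<in> S X" for X x
  proof -
    have "\<exists>t. t \<in> Hom LM (coker f) X \<and> comp_at t n (gen f) = x"
      using coker_map_exists[OF f NM_Obj_LM[OF that(1)], of x] that(2) by (auto simp: S_def)
    from someI_ex[OF this] show ?thesis by (simp add: hat_def)
  qed
  have hat: "hat X x \<in> Hom LM (coker f) X" and hat_u: "comp_at (hat X x) n (gen f) = x" if "X \<in> Obj NM" "x \<in> S X" for X x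
    using hat_all[OF that] by auto
  have hat_unique: "t = hat X (comp_at t n (gen f))" and S_gen: "comp_at t n (gen f) \<in> S X"
    if X: "X \<in> Obj NM" and t: "t \<in> Hom LM (coker f) X" for X t
  proof -
    show xS: "comp_at t n (gen f) \<in> S X"
      using comp_at_closed[OF t n uf] comp_at_natural[OF t f uf] act_gen_relation[OF f] comp_at_one[OF t m] by (simp add: S_def)
    show "t = hat X (comp_at t n (gen f))"
      by (rule coker_Hom_eqI[OF f t hat[OF X xS]]) (simp add: hat_u[OF X xS])
  qed
  have S_closed: "S X \<subseteq> el X n" for X by (auto simp: S_def)
  have S_map: "comp_at t n x \<in> S Y" if "t \<in> Hom LM X Y" "x \<in> S X" for X Y t x
  proof -
    have x: "x \<in> el X n" "act X f x = \<one>\<^bsub>ObjMap X m\<^esub>" using that(2) by (auto simp: S_def)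
    show ?thesis
      using comp_at_closed[OF that(1) n x(1)] comp_at_natural[OF that(1) f x(1)] comp_at_one[OF that(1) m] x(2) by (simp add: S_def)
  qed
  have hat_comp: "Comp LM t (hat X x) = hat Y (comp_at t n x)"
    if X: "X \<in> Obj NM" and Y: "Y \<in> Obj NM" and t: "t \<in> Hom LM X Y" and x: "x \<in> S X" for X Y t x
    using hat_unique[OF Y LM_Comp_in_Hom[OF hat[OF X x] t]] LM_Comp_apply[OF hat[OF X x] n uf, of t] hat_u[OF X x] by simp
  define \<theta> where "\<theta> X x = act F (hat X x) y0" for X x
  have theta_closed: "\<theta> X x \<in> el F X" if "X \<in> Obj NM" "x \<in> S X" for X x
    unfolding \<theta>_def by (rule F_closed[OF F Cf that(1) hat[OF that] y0])
  have theta_natural: "\<theta> Y (comp_at t n x) = act F t (\<theta> X x)"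
    if "X \<in> Obj NM" "Y \<in> Obj NM" "t \<in> Hom LM X Y" "x \<in> S X" for X Y t x
    unfolding \<theta>_def hat_comp[OF that, symmetric] by (rule F_Comp[OF F Cf that(1,2) hat[OF that(1,4)] that(3) y0])
  have S_product: "w \<in> S P"
    if P: "P \<in> Obj LM" and pi: "\<And>i. i \<in> I \<Longrightarrow> \<pi> i \<in> Hom LM P (X i)" and pw: "pointwise_product I X P \<pi>"
      and w: "w \<in> el P n" "\<And>i. i \<in> I \<Longrightarrow> comp_at (\<pi> i) n w \<in> S (X i)" for I :: "'i set" and X P \<pi> w
  proof -
    note bij = pointwise_productD[OF pw m]
    have "act P f w = \<one>\<^bsub>ObjMap P m\<^esub>"
      by (rule jointly_bijective_inj[OF bij act_closed[OF P f w(1)] mod_one_closed[OF P m]])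
        (use comp_at_natural[OF pi f w(1)] comp_at_one[OF pi m] w(2) in \<open>auto simp: S_def\<close>)
    then show ?thesis using w(1) by (simp add: S_def)
  qed
  have theta_mult: "\<theta> X (x \<otimes>\<^bsub>ObjMap X n\<^esub> y) = \<theta> X x \<otimes>\<^bsub>ObjMap F X\<^esub> \<theta> X y"
    if X: "X \<in> Obj NM" and x: "x \<in> S X" and y: "y \<in> S X" for X x y
  proof (rule natural_map_multiplicative[OF X n S_closed _ theta_closed theta_natural x y])
    fix P and \<pi> :: "bool \<Rightarrow> ('o, 'a, 'u) lmod_arrow" and w
    assume "P \<in> Obj NM" "\<And>b. \<pi> b \<in> Hom LM P X" "pointwise_product UNIV (\<lambda>_. X) P \<pi>"
      "w \<in> el P n" "\<And>b. comp_at (\<pi> b) n w \<in> S X"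
    then show "w \<in> S P" by (intro S_product[of P UNIV \<pi> "\<lambda>_. X" w] NM_Obj_LM)
  qed
  have theta_hom: "\<theta> X \<in> hom ((ObjMap X n)\<lparr>carrier := S X\<rparr>) (ObjMap F X)" if X: "X \<in> Obj NM" for X
    by (rule homI) (simp_all add: theta_closed[OF X] theta_mult[OF X])
  have theta_surj: "\<theta> X ` S X = el F X" if X: "X \<in> Obj NM" for X
  proof -
    have "z \<in> \<theta> X ` S X" if z: "z \<in> el F X" for z
    proof -
      obtain t where t: "t \<in> Hom LM (coker f) X" "act F t y0 = z" using gen_y0[OF X z] by blast
      then have "\<theta> X (comp_at t n (gen f)) = z" using hat_unique[OF X t(1)] by (simp add: \<theta>_def)
      then show ?thesis using S_gen[OF X t(1)] by blast
    qed
    then show ?thesis using theta_closed[OF X] by blast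
  qed
  define K where "K X = {x \<in> S X. \<theta> X x = \<one>\<^bsub>ObjMap F X\<^esub>}" for X
  have K_map: "comp_at t n x \<in> K Y" if "X \<in> Obj NM" "Y \<in> Obj NM" "t \<in> Hom LM X Y" "x \<in> K X" for X Y t x
    using S_map[OF that(3)] theta_natural[OF that(1-3)] that(4) ab_apply_one[OF F_Arr[OF F that(1-3)]] by (simp add: K_def)
  have "\<exists>g \<in> Arr R. \<exists>y \<in> K (coker g). \<forall>X \<in> Obj NM. \<forall>z \<in> K X. \<exists>t \<in> Hom LM (coker g) X. comp_at t n y = z"
  proof (rule single_generator)
    fix X Y Z s t z
    assume "X \<in> Obj NM" "s \<in> Hom LM X Y" "z \<in> K X"
    then show "comp_at (Comp LM t s) n z = comp_at t n (comp_at s n z)"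
      by (intro LM_Comp_apply[OF _ n]) (auto simp: K_def S_def)
  next
    fix X assume X: "X \<in> Obj NM"
    show "small (K X)"
      by (rule small_subset[OF _ mod_small[OF NM_Obj_LM[OF X] n]]) (auto simp: K_def S_def)
  next
    fix X x assume X: "X \<in> Obj NM" and x: "x \<in> K X"
    then have xS: "x \<in> S X" and "act F (hat X x) y0 = \<one>\<^bsub>ObjMap F X\<^esub>" by (auto simp: K_def \<theta>_def)
    from Fun_element_dies_in_coker[OF F X f hat[OF X xS] y0 this(2)]
    obtain g s t where g: "g \<in> Arr R" and s: "s \<in> Hom LM (coker f) (coker g)" and t: "t \<in> Hom LM (coker g) X"
      and ts: "Comp LM t s = hat X x" and sy: "act F s y0 = \<one>\<^bsub>ObjMap F (coker g)\<^esub>" by blast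
    have Cg: "coker g \<in> Obj NM" using coker_NM[of g "Dom R g" "Cod R g"] g by (simp add: Hom_def)
    have "comp_at s n (gen f) \<in> K (coker g)"
      using S_gen[OF Cg s] hat_unique[OF Cg s] sy by (simp add: K_def \<theta>_def)
    moreover have "comp_at t n (comp_at s n (gen f)) = x"
      using LM_Comp_apply[OF s n uf, of t] ts hat_u[OF X xS] by simp
    ultimately show "\<exists>g \<in> Arr R. \<exists>t \<in> Hom LM (coker g) X. \<exists>y \<in> K (coker g). comp_at t n y = x" using g t by blast
  next
    fix I :: "('a \<times> 'u) set" and X P \<pi> z
    assume I: "small I" and X: "\<And>i. i \<in> I \<Longrightarrow> X i \<in> Obj NM" and P: "P \<in> Obj NM"
      and pi: "\<And>i. i \<in> I \<Longrightarrow> \<pi> i \<in> Hom LM P (X i)" and pw: "pointwise_product I X P \<pi>" and z: "\<And>i. i \<in> I \<Longrightarrow> z i \<in> K (X i)"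
    note bij = pointwise_productD[OF pw n]
    have zS: "z i \<in> S (X i)" "z i \<in> el (X i) n" if "i \<in> I" for i using z[OF that] by (auto simp: K_def S_def)
    have "\<exists>w \<in> el P n. \<forall>i \<in> I. comp_at (\<pi> i) n w = z i" by (rule jointly_bijective_surj[OF bij zS(2)])
    then obtain w where w: "w \<in> el P n" "\<And>i. i \<in> I \<Longrightarrow> comp_at (\<pi> i) n w = z i" by blast
    have wS: "w \<in> S P" by (rule S_product[OF NM_Obj_LM[OF P] pi pw w(1)]) (use w(2) zS in auto)
    interpret FP: group "ObjMap F P" by (rule ab_Obj_group[OF F_Obj[OF F P]])
    have "\<theta> P w = \<one>\<^bsub>ObjMap F P\<^esub>"
    proof (rule jointly_bijective_inj[OF Fun_product[OF F I X P pi pw] theta_closed[OF P wS] FP.one_closed])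
      fix i assume i: "i \<in> I"
      have "act F (\<pi> i) (\<theta> P w) = \<theta> (X i) (z i)" using theta_natural[OF P X[OF i] pi[OF i] wS] w(2)[OF i] by simp
      then show "act F (\<pi> i) (\<theta> P w) = act F (\<pi> i) \<one>\<^bsub>ObjMap F P\<^esub>"
        using z[OF i] ab_apply_one[OF F_Arr[OF F P X[OF i] pi[OF i]]] by (simp add: K_def)
    qed
    then show "\<exists>w \<in> K P. \<forall>i \<in> I. comp_at (\<pi> i) n w = z i" using wS w(2) by (auto simp: K_def)
  qed
  then obtain g k0 where "g \<in> Arr R" and k0: "k0 \<in> K (coker g)"
    and gen_k0: "\<And>X z. X \<in> Obj NM \<Longrightarrow> z \<in> K X \<Longrightarrow> \<exists>t \<in> Hom LM (coker g) X. comp_at t n k0 = z" by blast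
  then obtain n' m' where g: "g \<in> Hom R n' m'" by (simp add: Hom_def)
  note n' = Hom_Obj(1)[OF g] and m' = Hom_Obj(2)[OF g]
  note Cg = coker_NM[OF g] and CgL = coker_LM[OF g] and ug = gen_closed[OF g]
  have k0S: "k0 \<in> el (coker g) n" "act (coker g) f k0 = \<one>\<^bsub>ObjMap (coker g) m\<^esub>" using k0 by (auto simp: K_def S_def)
  obtain h where h: "h \<in> Hom R n' n" "k0 = act (coker g) h (gen g)" using coker_cases[OF g n k0S(1)] by blast
  have e: "\<exists>e \<in> Hom R m' m. Comp R f h = Comp R e g"
    using k0S(2) act_Comp[OF CgL h(1) f ug] h(2) act_gen_one_iff[OF g Comp_closed[OF h(1) f]] by simp
  have kernel: "\<theta> X x = \<one>\<^bsub>ObjMap F X\<^esub> \<longleftrightarrow> (\<exists>y \<in> el X n'. act X g y = \<one>\<^bsub>ObjMap X m'\<^esub> \<and> act X h y = x)"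
    if X: "X \<in> Obj NM" and x: "x \<in> S X" for X x
  proof
    assume "\<theta> X x = \<one>\<^bsub>ObjMap F X\<^esub>"
    then have "x \<in> K X" using x by (simp add: K_def)
    from gen_k0[OF X this] obtain t where t: "t \<in> Hom LM (coker g) X" "comp_at t n k0 = x" by blast
    let ?y = "comp_at t n' (gen g)"
    have "act X g ?y = \<one>\<^bsub>ObjMap X m'\<^esub>"
      using comp_at_natural[OF t(1) g ug] act_gen_relation[OF g] comp_at_one[OF t(1) m'] by simp
    moreover have "act X h ?y = x" using comp_at_natural[OF t(1) h(1) ug] h(2) t(2) by simp
    ultimately show "\<exists>y \<in> el X n'. act X g y = \<one>\<^bsub>ObjMap X m'\<^esub> \<and> act X h y = x"
      using comp_at_closed[OF t(1) n' ug] by blast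
  next
    assume "\<exists>y \<in> el X n'. act X g y = \<one>\<^bsub>ObjMap X m'\<^esub> \<and> act X h y = x"
    then obtain y where y: "y \<in> el X n'" "act X g y = \<one>\<^bsub>ObjMap X m'\<^esub>" "act X h y = x" by blast
    obtain t where t: "t \<in> Hom LM (coker g) X" "comp_at t n' (gen g) = y"
      using coker_map_exists[OF g NM_Obj_LM[OF X] y(1,2)] by blast
    have "comp_at t n k0 = x" using comp_at_natural[OF t(1) h(1) ug] h(2) t(2) y(3) by simp
    then show "\<theta> X x = \<one>\<^bsub>ObjMap F X\<^esub>" using K_map[OF Cg X t(1) k0] by (simp add: K_def)
  qed
  show ?thesis
  proof (intro exI conjI)
    show "f \<in> Hom R n m" "g \<in> Hom R n' m'" "h \<in> Hom R n' n" by (fact f, fact g, fact h(1))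
    show "\<exists>e \<in> Hom R m' m. Comp R f h = Comp R e g" by (rule e)
    show "\<forall>X \<in> Obj NM. \<theta> X \<in> hom ((ObjMap X n)\<lparr>carrier := {x \<in> el X n. act X f x = \<one>\<^bsub>ObjMap X m\<^esub>}\<rparr>) (ObjMap F X) \<and>
      \<theta> X ` {x \<in> el X n. act X f x = \<one>\<^bsub>ObjMap X m\<^esub>} = el F X \<and>
      (\<forall>x \<in> el X n. act X f x = \<one>\<^bsub>ObjMap X m\<^esub> \<longrightarrow>
        (\<theta> X x = \<one>\<^bsub>ObjMap F X\<^esub> \<longleftrightarrow> (\<exists>y \<in> el X n'. act X g y = \<one>\<^bsub>ObjMap X m'\<^esub> \<and> act X h y = x)))"
      using theta_hom theta_surj kernel unfolding S_def by simp
    show "\<forall>X \<in> Obj NM. \<forall>Y \<in> Obj NM. \<forall>t \<in> Hom LM X Y. \<forall>x \<in> el X n. act X f x = \<one>\<^bsub>ObjMap X m\<^esub> \<longrightarrow>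
      \<theta> Y (comp_at t n x) = act F t (\<theta> X x)"
      using theta_natural unfolding S_def by simp
  qed
qed

end

end

lemma iso_of_common_quotients:
  assumes A: "group A" and G1: "G1 \<in> Obj Ab" and G2: "G2 \<in> Obj Ab"
    and q1: "q1 \<in> hom A G1" "q1 ` carrier A = carrier G1" and q2: "q2 \<in> hom A G2" "q2 ` carrier A = carrier G2"
    and ker: "\<And>a. a \<in> carrier A \<Longrightarrow> q1 a = \<one>\<^bsub>G1\<^esub> \<longleftrightarrow> q2 a = \<one>\<^bsub>G2\<^esub>"
  shows "\<exists>h. is_iso Ab G1 G2 h \<and> (\<forall>a \<in> carrier A. amap h (q1 a) = q2 a)"
proof -
  interpret A: group A by fact
  have gh: "group_hom A G1 q1" "group_hom A G2 q2"
    using A q1(1) q2(1) ab_Obj_group[OF G1] ab_Obj_group[OF G2] by (simp_all add: group_hom_def group_hom_axioms_def)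
  have eq: "q1 a = q1 b \<longleftrightarrow> q2 a = q2 b" if "a \<in> carrier A" "b \<in> carrier A" for a b
    using group_hom_eq_iff[OF gh(1) that] group_hom_eq_iff[OF gh(2) that] ker[of "a \<otimes>\<^bsub>A\<^esub> inv\<^bsub>A\<^esub> b"] that by simp
  define rep where "rep z = (SOME a. a \<in> carrier A \<and> q1 a = z)" for z
  have rep: "rep z \<in> carrier A \<and> q1 (rep z) = z" if "z \<in> carrier G1" for z
  proof -
    have "\<exists>a. a \<in> carrier A \<and> q1 a = z" using that unfolding q1(2)[symmetric] by auto
    from someI_ex[OF this] show ?thesis by (simp add: rep_def)
  qed
  define h where "h = ab_map G1 G2 (\<lambda>z. q2 (rep z))"
  have h_q: "amap h (q1 a) = q2 a" if a: "a \<in> carrier A" for a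
    using rep[OF hom_apply_closed[OF q1(1) a]] eq[of "rep (q1 a)" a] a hom_apply_closed[OF q1(1) a] by (simp add: h_def)
  have cases1: "\<exists>a \<in> carrier A. z = q1 a" if "z \<in> carrier G1" for z using that unfolding q1(2)[symmetric] by auto
  have "(\<lambda>z. q2 (rep z)) \<in> hom G1 G2"
  proof (rule homI)
    show "q2 (rep z) \<in> carrier G2" if "z \<in> carrier G1" for z using rep[OF that] hom_apply_closed[OF q2(1)] by blast
    fix z w assume z: "z \<in> carrier G1" and w: "w \<in> carrier G1"
    obtain a b where ab: "a \<in> carrier A" "z = q1 a" "b \<in> carrier A" "w = q1 b" using cases1[OF z] cases1[OF w] by blast
    have zw: "z \<otimes>\<^bsub>G1\<^esub> w = q1 (a \<otimes>\<^bsub>A\<^esub> b)" using hom_apply_mult[OF q1(1) ab(1,3)] ab(2,4) by simp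
    have h: "q2 (rep v) = amap h v" if "v \<in> carrier G1" for v using that by (simp add: h_def)
    have "z \<otimes>\<^bsub>G1\<^esub> w \<in> carrier G1" unfolding zw by (rule hom_apply_closed[OF q1(1)]) (simp add: ab)
    then show "q2 (rep (z \<otimes>\<^bsub>G1\<^esub> w)) = q2 (rep z) \<otimes>\<^bsub>G2\<^esub> q2 (rep w)"
      using h z w zw ab h_q[of a] h_q[of b] h_q[of "a \<otimes>\<^bsub>A\<^esub> b"] hom_apply_mult[OF q2(1) ab(1,3)] by simp
  qed
  then have h: "h \<in> Hom Ab G1 G2" unfolding h_def by (rule ab_map_in_Hom[OF G1 G2])
  have "bij_betw (amap h) (carrier G1) (carrier G2)"
    unfolding bij_betw_def
  proof
    show "inj_on (amap h) (carrier G1)"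
    proof (rule inj_onI)
      fix z w assume z: "z \<in> carrier G1" and w: "w \<in> carrier G1" and e: "amap h z = amap h w"
      obtain a b where ab: "a \<in> carrier A" "z = q1 a" "b \<in> carrier A" "w = q1 b" using cases1[OF z] cases1[OF w] by blast
      then show "z = w" using e eq[of a b] h_q by simp
    qed
    show "amap h ` carrier G1 = carrier G2"
      unfolding q1(2)[symmetric] q2(2)[symmetric] image_image using h_q by simp
  qed
  then show ?thesis using ab_is_isoI[OF h] h_q by blast
qed

section \<open>The functors of pp-pairs\<close>

context small_additive_category
begin

lemma pp_formulaD:
  assumes "pp_formula R n \<chi>"
  obtains m l where "fst \<chi> \<in> Hom R n m" "snd \<chi> \<in> Hom R l m"
    "\<And>M :: ('o, 'a, 'u) lmod. pp_solutions R \<chi> M = {x \<in> el M n. \<exists>y \<in> el M l. act M (fst \<chi>) x = act M (snd \<chi>) y}"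
  using assms unfolding pp_formula_def pp_solutions_def by (auto simp: Hom_def)

lemma pp_solutions_subset:
  "pp_formula R n \<chi> \<Longrightarrow> x \<in> pp_solutions R \<chi> M \<Longrightarrow> x \<in> el M n" for M :: "('o, 'a, 'u) lmod"
  by (erule pp_formulaD) auto

lemma subgroup_pp_solutions:
  assumes \<chi>: "pp_formula R n \<chi>" and M: "M \<in> Obj LM"
  shows "subgroup (pp_solutions R \<chi> M) (ObjMap M n)"
proof -
  obtain m l where A: "fst \<chi> \<in> Hom R n m" and B: "snd \<chi> \<in> Hom R l m"
    and sol: "\<And>M :: ('o, 'a, 'u) lmod. pp_solutions R \<chi> M = {x \<in> el M n. \<exists>y \<in> el M l. act M (fst \<chi>) x = act M (snd \<chi>) y}"
    using pp_formulaD[OF \<chi>] by blast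
  interpret n: group "ObjMap M n" by (rule mod_group[OF M Hom_Obj(1)[OF A]])
  interpret l: group "ObjMap M l" by (rule mod_group[OF M Hom_Obj(1)[OF B]])
  interpret A: group_hom "ObjMap M n" "ObjMap M m" "act M (fst \<chi>)" by (rule ab_apply_hom[OF mod_Arr[OF M A]])
  interpret B: group_hom "ObjMap M l" "ObjMap M m" "act M (snd \<chi>)" by (rule ab_apply_hom[OF mod_Arr[OF M B]])
  show ?thesis unfolding sol
  proof (rule n.subgroupI)
    show "{x \<in> el M n. \<exists>y\<in>el M l. act M (fst \<chi>) x = act M (snd \<chi>) y} \<noteq> {}"
      using A.hom_one B.hom_one n.one_closed l.one_closed by (auto intro!: exI[of _ "\<one>\<^bsub>ObjMap M n\<^esub>"] bexI[of _ "\<one>\<^bsub>ObjMap M l\<^esub>"])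
  next
    fix x assume "x \<in> {x \<in> el M n. \<exists>y\<in>el M l. act M (fst \<chi>) x = act M (snd \<chi>) y}"
    then obtain y where x: "x \<in> el M n" and y: "y \<in> el M l" "act M (fst \<chi>) x = act M (snd \<chi>) y" by blast
    then show "inv\<^bsub>ObjMap M n\<^esub> x \<in> {x \<in> el M n. \<exists>y\<in>el M l. act M (fst \<chi>) x = act M (snd \<chi>) y}"
      by (auto intro!: bexI[of _ "inv\<^bsub>ObjMap M l\<^esub> y"])
    fix x' assume "x' \<in> {x \<in> el M n. \<exists>y\<in>el M l. act M (fst \<chi>) x = act M (snd \<chi>) y}"
    then obtain y' where x': "x' \<in> el M n" and y': "y' \<in> el M l" "act M (fst \<chi>) x' = act M (snd \<chi>) y'" by blast
    show "x \<otimes>\<^bsub>ObjMap M n\<^esub> x' \<in> {x \<in> el M n. \<exists>y\<in>el M l. act M (fst \<chi>) x = act M (snd \<chi>) y}"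
      using x y x' y' by (auto intro!: bexI[of _ "y \<otimes>\<^bsub>ObjMap M l\<^esub> y'"])
  qed auto
qed

lemma pp_solutions_map:
  assumes \<chi>: "pp_formula R n \<chi>" and t: "t \<in> Hom LM M N" and x: "x \<in> pp_solutions R \<chi> M"
  shows "comp_at t n x \<in> pp_solutions R \<chi> N"
proof -
  obtain m l where A: "fst \<chi> \<in> Hom R n m" and B: "snd \<chi> \<in> Hom R l m"
    and sol: "\<And>M :: ('o, 'a, 'u) lmod. pp_solutions R \<chi> M = {x \<in> el M n. \<exists>y \<in> el M l. act M (fst \<chi>) x = act M (snd \<chi>) y}"
    using pp_formulaD[OF \<chi>] by blast
  obtain y where x: "x \<in> el M n" and y: "y \<in> el M l" "act M (fst \<chi>) x = act M (snd \<chi>) y" using x by (auto simp: sol)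
  have "act N (fst \<chi>) (comp_at t n x) = act N (snd \<chi>) (comp_at t l y)"
    using comp_at_natural[OF t A x] comp_at_natural[OF t B y(1)] y(2) by simp
  then show ?thesis
    using comp_at_closed[OF t Hom_Obj(1)[OF A] x] comp_at_closed[OF t Hom_Obj(1)[OF B] y(1)] by (auto simp: sol)
qed

lemma pp_solutions_product:
  assumes \<chi>: "pp_formula R n \<chi>" and P: "P \<in> Obj LM" and pi: "\<And>i. i \<in> I \<Longrightarrow> \<pi> i \<in> Hom LM P (X i)"
    and pw: "pointwise_product I X P \<pi>"
    and x: "x \<in> el P n" "\<And>i. i \<in> I \<Longrightarrow> comp_at (\<pi> i) n x \<in> pp_solutions R \<chi> (X i)"
  shows "x \<in> pp_solutions R \<chi> P"
proof -
  obtain m l where A: "fst \<chi> \<in> Hom R n m" and B: "snd \<chi> \<in> Hom R l m"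
    and sol: "\<And>M :: ('o, 'a, 'u) lmod. pp_solutions R \<chi> M = {x \<in> el M n. \<exists>y \<in> el M l. act M (fst \<chi>) x = act M (snd \<chi>) y}"
    using pp_formulaD[OF \<chi>] by blast
  note bij = pointwise_productD[OF pw]
  have "\<forall>i \<in> I. \<exists>y. y \<in> el (X i) l \<and> act (X i) (fst \<chi>) (comp_at (\<pi> i) n x) = act (X i) (snd \<chi>) y"
    using x(2) by (auto simp: sol)
  from bchoice[OF this] obtain y where y: "\<forall>i \<in> I. y i \<in> el (X i) l \<and> act (X i) (fst \<chi>) (comp_at (\<pi> i) n x) = act (X i) (snd \<chi>) (y i)"
    by blast
  have "\<exists>w \<in> el P l. \<forall>i \<in> I. comp_at (\<pi> i) l w = y i"
    by (rule jointly_bijective_surj[OF bij[OF Hom_Obj(1)[OF B]]]) (use y in blast)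
  then obtain w where w: "w \<in> el P l" "\<And>i. i \<in> I \<Longrightarrow> comp_at (\<pi> i) l w = y i" by blast
  have "act P (fst \<chi>) x = act P (snd \<chi>) w"
    by (rule jointly_bijective_inj[OF bij[OF Hom_Obj(2)[OF A]] act_closed[OF P A x(1)] act_closed[OF P B w(1)]])
      (use comp_at_natural[OF pi A x(1)] comp_at_natural[OF pi B w(1)] w(2) y in simp)
  then show ?thesis using x(1) w(1) by (auto simp: sol)
qed

text \<open>A solution together with its witness lives at a common stage, and the equation between them holds at a later one.\<close>

lemma pp_solutions_colimit:
  assumes \<chi>: "pp_formula R n \<chi>" and dir: "directed_poset natLeq I r" and diag: "poset_diagram LM I r X T"
    and cocone: "is_cocone LM I r X T L c" and pw: "pointwise_colimit I r X T L c"
    and z: "z \<in> pp_solutions R \<chi> L"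
  shows "\<exists>i \<in> I. \<exists>x \<in> pp_solutions R \<chi> (X i). comp_at (c i) n x = z"
proof -
  obtain m l where A: "fst \<chi> \<in> Hom R n m" and B: "snd \<chi> \<in> Hom R l m"
    and sol: "\<And>M :: ('o, 'a, 'u) lmod. pp_solutions R \<chi> M = {x \<in> el M n. \<exists>y \<in> el M l. act M (fst \<chi>) x = act M (snd \<chi>) y}"
    using pp_formulaD[OF \<chi>] by blast
  note n = Hom_Obj(1)[OF A] and m = Hom_Obj(2)[OF A] and l = Hom_Obj(1)[OF B]
  note X = LM_poset_diagramD(1)[OF diag] and T = LM_poset_diagramD(2)[OF diag]
    and c = LM_is_coconeD(2)[OF cocone] and T_c = LM_cocone_apply[OF cocone _ T]
  have rI: "i \<in> I" "j \<in> I" if "(i, j) \<in> r" for i j using directed_posetD(1)[OF dir] that by auto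
  note col = pointwise_colimitD[OF pw]
  obtain w where z: "z \<in> el L n" and w: "w \<in> el L l" "act L (fst \<chi>) z = act L (snd \<chi>) w" using z by (auto simp: sol)
  obtain i x where i: "i \<in> I" and x: "x \<in> el (X i) n" "comp_at (c i) n x = z"
    using elementwise_colimit_surj[OF col[OF n] z] by blast
  obtain j y where j: "j \<in> I" and y: "y \<in> el (X j) l" "comp_at (c j) l y = w"
    using elementwise_colimit_surj[OF col[OF l] w(1)] by blast
  obtain u where u: "u \<in> I" "(i, u) \<in> r" "(j, u) \<in> r" using directed_poset_two[OF dir i j] by blast
  let ?x = "comp_at (T i u) n x" and ?y = "comp_at (T j u) l y"
  have xu: "?x \<in> el (X u) n" "comp_at (c u) n ?x = z"
    using comp_at_closed[OF T[OF u(2)] n x(1)] T_c[OF u(2) u(2) n x(1)] x(2) by auto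
  have yu: "?y \<in> el (X u) l" "comp_at (c u) l ?y = w"
    using comp_at_closed[OF T[OF u(3)] l y(1)] T_c[OF u(3) u(3) l y(1)] y(2) by auto
  have "comp_at (c u) m (act (X u) (fst \<chi>) ?x) = comp_at (c u) m (act (X u) (snd \<chi>) ?y)"
    using comp_at_natural[OF c[OF u(1)] A xu(1)] comp_at_natural[OF c[OF u(1)] B yu(1)] xu(2) yu(2) w(2) by simp
  then obtain v where v: "(u, v) \<in> r" "comp_at (T u v) m (act (X u) (fst \<chi>) ?x) = comp_at (T u v) m (act (X u) (snd \<chi>) ?y)"
    using elementwise_colimit_eq[OF col[OF m] u(1) act_closed[OF X[OF u(1)] A xu(1)] act_closed[OF X[OF u(1)] B yu(1)]] by blast
  have "act (X v) (fst \<chi>) (comp_at (T u v) n ?x) = act (X v) (snd \<chi>) (comp_at (T u v) l ?y)"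
    using comp_at_natural[OF T[OF v(1)] A xu(1)] comp_at_natural[OF T[OF v(1)] B yu(1)] v(2) by simp
  then have "comp_at (T u v) n ?x \<in> pp_solutions R \<chi> (X v)"
    using comp_at_closed[OF T[OF v(1)] n xu(1)] comp_at_closed[OF T[OF v(1)] l yu(1)] by (auto simp: sol)
  moreover have "comp_at (c v) n (comp_at (T u v) n ?x) = z" using T_c[OF v(1) v(1) n xu(1)] xu(2) by simp
  ultimately show ?thesis using rI(2)[OF v(1)] by blast
qed

definition pp_class :: "'o \<Rightarrow> 'a \<times> 'a \<Rightarrow> ('o, 'a, 'u) lmod \<Rightarrow> 'u \<Rightarrow> 'u" where
  "pp_class n \<psi> M x = coset_rep (pp_solutions R \<psi> M #>\<^bsub>ObjMap M n\<^esub> x)"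

context
  fixes n \<phi> \<psi>
  assumes pp: "pp_pair TYPE('u) R n \<phi> \<psi>"
begin

lemma pp_phi: "pp_formula R n \<phi>" and pp_psi: "pp_formula R n \<psi>"
  and pp_subset: "M \<in> Obj LM \<Longrightarrow> x \<in> pp_solutions R \<psi> M \<Longrightarrow> x \<in> pp_solutions R \<phi> M"
  using pp unfolding pp_pair_def by blast+

lemma pp_n: "n \<in> Obj R"
  using pp_phi unfolding pp_formula_def by blast

context
  fixes M assumes M: "M \<in> Obj LM"
begin

abbreviation (input) "Mn \<equiv> ObjMap M n"
abbreviation (input) "M\<phi> \<equiv> Mn\<lparr>carrier := pp_solutions R \<phi> M\<rparr>"

text \<open>Since the quotient is taken in the group of solutions of \<open>\<phi>\<close>, while cosets in \<^const>\<open>pp_functor\<close> are formed in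
  \<open>M n\<close>, the two kinds of cosets are identified on the way.\<close>

lemma pp_groups:
  shows "comm_group M\<phi>" "subgroup (pp_solutions R \<psi> M) M\<phi>" "inj_on coset_rep (carrier (M\<phi> Mod pp_solutions R \<psi> M))"
    and pp_class_in_coset: "\<And>x. x \<in> pp_solutions R \<phi> M \<Longrightarrow> pp_class n \<psi> M x \<in> pp_solutions R \<psi> M #>\<^bsub>Mn\<^esub> x"
proof -
  interpret Mn: comm_group Mn by (rule mod_comm_group[OF M pp_n])
  note sub = subgroup_pp_solutions[OF pp_phi M] subgroup_pp_solutions[OF pp_psi M]
  show G: "comm_group M\<phi>" by (rule Mn.subgroup_imp_comm_group[OF sub(1)])
  show K: "subgroup (pp_solutions R \<psi> M) M\<phi>"
    by (rule Mn.subgroup_incl[OF sub(2,1)]) (use pp_subset[OF M] in blast)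
  interpret G: comm_group M\<phi> by (rule G)
  have coset: "pp_solutions R \<psi> M #>\<^bsub>M\<phi>\<^esub> x = pp_solutions R \<psi> M #>\<^bsub>Mn\<^esub> x" for x by (simp add: r_coset_def)
  have rep: "coset_rep (pp_solutions R \<psi> M #>\<^bsub>M\<phi>\<^esub> x) \<in> pp_solutions R \<psi> M #>\<^bsub>M\<phi>\<^esub> x" if "x \<in> carrier M\<phi>" for x
    unfolding coset_rep_def by (rule someI[of _ x]) (rule G.rcos_self[OF that K])
  then show "pp_class n \<psi> M x \<in> pp_solutions R \<psi> M #>\<^bsub>Mn\<^esub> x" if "x \<in> pp_solutions R \<phi> M" for x
    using that by (simp add: pp_class_def coset)
  show "inj_on coset_rep (carrier (M\<phi> Mod pp_solutions R \<psi> M))"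
  proof (rule inj_onI)
    fix C D assume "C \<in> carrier (M\<phi> Mod pp_solutions R \<psi> M)" "D \<in> carrier (M\<phi> Mod pp_solutions R \<psi> M)"
      and eq: "coset_rep C = coset_rep D"
    then obtain x y where x: "x \<in> carrier M\<phi>" "C = pp_solutions R \<psi> M #>\<^bsub>M\<phi>\<^esub> x"
      and y: "y \<in> carrier M\<phi>" "D = pp_solutions R \<psi> M #>\<^bsub>M\<phi>\<^esub> y"
      unfolding carrier_FactGroup by blast
    show "C = D"
      using G.repr_independence[OF rep[OF x(1)] x(1) K] G.repr_independence[OF rep[OF y(1)] y(1) K] eq x(2) y(2) by simp
  qed
qed

lemma pp_class_quotient:
  shows "comm_group (pp_quotient R n \<phi> \<psi> M)" "pp_class n \<psi> M \<in> hom M\<phi> (pp_quotient R n \<phi> \<psi> M)"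
    "pp_class n \<psi> M ` pp_solutions R \<phi> M = carrier (pp_quotient R n \<phi> \<psi> M)"
    "x \<in> pp_solutions R \<phi> M \<Longrightarrow> pp_class n \<psi> M x = \<one>\<^bsub>pp_quotient R n \<phi> \<psi> M\<^esub> \<longleftrightarrow> x \<in> pp_solutions R \<psi> M"
proof -
  have coset: "pp_solutions R \<psi> M #>\<^bsub>M\<phi>\<^esub> x = pp_solutions R \<psi> M #>\<^bsub>Mn\<^esub> x" for x by (simp add: r_coset_def)
  note q = image_of_quotient[OF pp_groups(1-3)]
  have class_eq: "(\<lambda>x. coset_rep (pp_solutions R \<psi> M #>\<^bsub>M\<phi>\<^esub> x)) = pp_class n \<psi> M"
    unfolding coset by (simp add: pp_class_def fun_eq_iff)
  show "comm_group (pp_quotient R n \<phi> \<psi> M)" using q(1) by (simp add: pp_quotient_def)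
  show "pp_class n \<psi> M \<in> hom M\<phi> (pp_quotient R n \<phi> \<psi> M)"
    using q(2) unfolding class_eq by (simp add: pp_quotient_def)
  show "pp_class n \<psi> M ` pp_solutions R \<phi> M = carrier (pp_quotient R n \<phi> \<psi> M)"
    using q(3) unfolding class_eq by (simp add: pp_quotient_def)
  show "x \<in> pp_solutions R \<phi> M \<Longrightarrow> pp_class n \<psi> M x = \<one>\<^bsub>pp_quotient R n \<phi> \<psi> M\<^esub> \<longleftrightarrow> x \<in> pp_solutions R \<psi> M"
    using q(4)[of x] unfolding coset by (simp add: pp_quotient_def pp_class_def)
qed

lemma pp_quotient_Obj: "pp_quotient R n \<phi> \<psi> M \<in> Obj AbU"
proof -
  have "pp_solutions R \<phi> M \<subseteq> el M n" using pp_solutions_subset[OF pp_phi] by blast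
  then have "small (pp_solutions R \<phi> M)" using small_subset mod_small[OF M pp_n] by blast
  from small_image[OF this, of "pp_class n \<psi> M"] show ?thesis
    by (simp add: AbU_Obj_iff pp_class_quotient)
qed

lemma pp_class_eq_iff:
  assumes x: "x \<in> pp_solutions R \<phi> M" and y: "y \<in> pp_solutions R \<phi> M"
  shows "pp_class n \<psi> M x = pp_class n \<psi> M y \<longleftrightarrow> x \<otimes>\<^bsub>Mn\<^esub> inv\<^bsub>Mn\<^esub> y \<in> pp_solutions R \<psi> M"
proof -
  interpret G: comm_group M\<phi> by (rule pp_groups(1))
  interpret Mn: group Mn by (rule mod_group[OF M pp_n])
  have gh: "group_hom M\<phi> (pp_quotient R n \<phi> \<psi> M) (pp_class n \<psi> M)"
    using pp_class_quotient(2) ab_Obj_group[OF pp_quotient_Obj] G.group_axioms by (simp add: group_hom_def group_hom_axioms_def)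
  have xy: "x \<otimes>\<^bsub>M\<phi>\<^esub> inv\<^bsub>M\<phi>\<^esub> y \<in> pp_solutions R \<phi> M"
    using G.m_closed[of x "inv\<^bsub>M\<phi>\<^esub> y"] G.inv_closed[of y] x y by simp
  have "inv\<^bsub>M\<phi>\<^esub> y = inv\<^bsub>Mn\<^esub> y" by (rule Mn.m_inv_consistent[OF subgroup_pp_solutions[OF pp_phi M] y])
  then show ?thesis
    using group_hom_eq_iff[OF gh, of x y] pp_class_quotient(4)[OF xy] x y by simp
qed

text \<open>The representative of the class of \<open>x\<close> is the product of \<open>x\<close> with a solution of \<open>\<psi>\<close>, which is also a
  solution of \<open>\<phi>\<close>.\<close>

lemma pp_quotient_element:
  assumes u: "u \<in> carrier (pp_quotient R n \<phi> \<psi> M)"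
  shows "u \<in> pp_solutions R \<phi> M" and "pp_class n \<psi> M u = u"
proof -
  obtain x where x: "x \<in> pp_solutions R \<phi> M" "u = pp_class n \<psi> M x" using u unfolding pp_class_quotient(3)[symmetric] by blast
  interpret Mn: group Mn by (rule mod_group[OF M pp_n])
  have xM: "x \<in> el M n" by (rule pp_solutions_subset[OF pp_phi x(1)])
  have rep: "u \<in> pp_solutions R \<psi> M #>\<^bsub>Mn\<^esub> x" using pp_class_in_coset[OF x(1)] x(2) by simp
  then obtain v where v: "v \<in> pp_solutions R \<psi> M" "u = v \<otimes>\<^bsub>Mn\<^esub> x" by (auto simp: r_coset_def)
  show "u \<in> pp_solutions R \<phi> M"
    using subgroup.m_closed[OF subgroup_pp_solutions[OF pp_phi M] pp_subset[OF M v(1)] x(1)] v(2) by simp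
  show "pp_class n \<psi> M u = u"
    using Mn.repr_independence[OF rep xM subgroup_pp_solutions[OF pp_psi M]] x(2) by (simp add: pp_class_def)
qed

lemma pp_class_closed: "x \<in> pp_solutions R \<phi> M \<Longrightarrow> pp_class n \<psi> M x \<in> carrier (pp_quotient R n \<phi> \<psi> M)"
  using pp_class_quotient(3) by blast

lemma pp_class_mult:
  "x \<in> pp_solutions R \<phi> M \<Longrightarrow> y \<in> pp_solutions R \<phi> M \<Longrightarrow>
    pp_class n \<psi> M (x \<otimes>\<^bsub>Mn\<^esub> y) = pp_class n \<psi> M x \<otimes>\<^bsub>pp_quotient R n \<phi> \<psi> M\<^esub> pp_class n \<psi> M y"
  using hom_apply_mult[OF pp_class_quotient(2), of x y] by simp

end

abbreviation "ppF \<equiv> (pp_functor R n \<phi> \<psi> :: ('o, 'a, 'u) lmod_functor)"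

lemma ppF_Obj: "ObjMap ppF M = pp_quotient R n \<phi> \<psi> M"
  by (simp add: pp_functor_def)

context
  fixes t M N assumes t: "t \<in> Hom LM M N"
begin

text \<open>The definition of \<^const>\<open>pp_functor\<close> maps a chosen representative; this says that the choice does not matter.\<close>

lemma ppF_class:
  assumes x: "x \<in> pp_solutions R \<phi> M"
  shows "act ppF t (pp_class n \<psi> M x) = pp_class n \<psi> N (comp_at t n x)"
proof -
  note M = LM_Hom_Obj(1)[OF t] and N = LM_Hom_Obj(2)[OF t]
  let ?u = "pp_class n \<psi> M x"
  note cl = pp_class_closed[OF M x]
  note u = pp_quotient_element[OF M cl]
  have st: "src t = M" "tgt t = N" using t by (simp_all add: LM_Hom_iff)
  interpret th: group_hom "ObjMap M n" "ObjMap N n" "comp_at t n" by (rule ab_apply_hom[OF LM_comp_at[OF t pp_n]])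
  have "?u \<otimes>\<^bsub>ObjMap M n\<^esub> inv\<^bsub>ObjMap M n\<^esub> x \<in> pp_solutions R \<psi> M"
    using pp_class_eq_iff[OF M u(1) x] u(2) by simp
  from pp_solutions_map[OF pp_psi t this]
  have "comp_at t n ?u \<otimes>\<^bsub>ObjMap N n\<^esub> inv\<^bsub>ObjMap N n\<^esub> comp_at t n x \<in> pp_solutions R \<psi> N"
    using pp_solutions_subset[OF pp_phi u(1)] pp_solutions_subset[OF pp_phi x] by (simp add: th.hom_mult th.hom_inv)
  then have "pp_class n \<psi> N (comp_at t n ?u) = pp_class n \<psi> N (comp_at t n x)"
    using pp_class_eq_iff[OF N pp_solutions_map[OF pp_phi t u(1)] pp_solutions_map[OF pp_phi t x]] by simp
  then show ?thesis using cl by (simp add: pp_functor_def st pp_class_def)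
qed

lemma ppF_Arr: "ArrMap ppF t \<in> Hom AbU (ObjMap ppF M) (ObjMap ppF N)"
proof -
  note M = LM_Hom_Obj(1)[OF t] and N = LM_Hom_Obj(2)[OF t]
  have st: "src t = M" "tgt t = N" using t by (simp_all add: LM_Hom_iff)
  let ?h = "\<lambda>u. pp_class n \<psi> N (comp_at t n u)"
  have "?h \<in> hom (pp_quotient R n \<phi> \<psi> M) (pp_quotient R n \<phi> \<psi> N)"
  proof (rule homI)
    fix u assume u: "u \<in> carrier (pp_quotient R n \<phi> \<psi> M)"
    note u' = pp_quotient_element[OF M u]
    show "?h u \<in> carrier (pp_quotient R n \<phi> \<psi> N)" by (rule pp_class_closed[OF N pp_solutions_map[OF pp_phi t u'(1)]])
    fix v assume v: "v \<in> carrier (pp_quotient R n \<phi> \<psi> M)"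
    note v' = pp_quotient_element[OF M v]
    have m: "u \<otimes>\<^bsub>ObjMap M n\<^esub> v \<in> pp_solutions R \<phi> M"
      by (rule subgroup.m_closed[OF subgroup_pp_solutions[OF pp_phi M] u'(1) v'(1)])
    have uv: "u \<otimes>\<^bsub>pp_quotient R n \<phi> \<psi> M\<^esub> v = pp_class n \<psi> M (u \<otimes>\<^bsub>ObjMap M n\<^esub> v)"
      using pp_class_mult[OF M u'(1) v'(1)] u'(2) v'(2) by simp
    have "?h w = act ppF t w" if "w \<in> carrier (pp_quotient R n \<phi> \<psi> M)" for w
      using that by (simp add: pp_functor_def st pp_class_def)
    from this[OF pp_class_closed[OF M m]]
    have "?h (u \<otimes>\<^bsub>pp_quotient R n \<phi> \<psi> M\<^esub> v) = pp_class n \<psi> N (comp_at t n (u \<otimes>\<^bsub>ObjMap M n\<^esub> v))"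
      unfolding uv using ppF_class[OF m] by simp
    also have "\<dots> = ?h u \<otimes>\<^bsub>pp_quotient R n \<phi> \<psi> N\<^esub> ?h v"
      using comp_at_mult[OF t pp_n pp_solutions_subset[OF pp_phi u'(1)] pp_solutions_subset[OF pp_phi v'(1)]]
        pp_class_mult[OF N pp_solutions_map[OF pp_phi t u'(1)] pp_solutions_map[OF pp_phi t v'(1)]] by simp
    finally show "?h (u \<otimes>\<^bsub>pp_quotient R n \<phi> \<psi> M\<^esub> v) = ?h u \<otimes>\<^bsub>pp_quotient R n \<phi> \<psi> N\<^esub> ?h v" .
  qed
  from ab_map_in_Hom[OF pp_quotient_Obj[OF M] pp_quotient_Obj[OF N] this]
  show ?thesis by (simp add: pp_functor_def st ab_map_def pp_class_def)
qed

end

lemma ppF_functor: "is_functor LM AbU ppF"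
  unfolding is_functor_def
proof (intro conjI ballI)
  fix M assume M: "M \<in> Obj LM"
  show MQ: "ObjMap ppF M \<in> Obj AbU" using pp_quotient_Obj[OF M] by (simp add: ppF_Obj)
  note id = LM_Ident_in_Hom[OF M]
  show "ArrMap ppF (Ident LM M) = Ident AbU (ObjMap ppF M)"
  proof (rule ab_Hom_eqI[OF ppF_Arr[OF id] ab_Ident_in_Hom[OF MQ]])
    fix u assume u: "u \<in> el ppF M"
    then have "u \<in> carrier (pp_quotient R n \<phi> \<psi> M)" by (simp add: ppF_Obj)
    note u' = pp_quotient_element[OF M this]
    show "act ppF (Ident LM M) u = amap (Ident AbU (ObjMap ppF M)) u"
      using ppF_class[OF id u'(1)] u'(2) LM_Ident_apply[OF pp_n pp_solutions_subset[OF pp_phi u'(1)]] ab_Ident_apply[OF u] by simp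
  qed
  fix N t assume t: "t \<in> Hom LM M N"
  show "ArrMap ppF t \<in> Hom AbU (ObjMap ppF M) (ObjMap ppF N)" by (rule ppF_Arr[OF t])
  fix P s assume s: "s \<in> Hom LM N P"
  show "ArrMap ppF (Comp LM s t) = Comp AbU (ArrMap ppF s) (ArrMap ppF t)"
  proof (rule ab_Hom_eqI[OF ppF_Arr[OF LM_Comp_in_Hom[OF t s]] ab_Comp_in_Hom[OF ppF_Arr[OF t] ppF_Arr[OF s]]])
    fix u assume u: "u \<in> el ppF M"
    then have "u \<in> carrier (pp_quotient R n \<phi> \<psi> M)" by (simp add: ppF_Obj)
    note u' = pp_quotient_element[OF M this]
    show "act ppF (Comp LM s t) u = amap (Comp AbU (ArrMap ppF s) (ArrMap ppF t)) u"
      using ab_Comp_apply[OF ppF_Arr[OF t] u, of "ArrMap ppF s"] ppF_class[OF t u'(1)] ppF_class[OF s pp_solutions_map[OF pp_phi t u'(1)]]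
        ppF_class[OF LM_Comp_in_Hom[OF t s] u'(1)] LM_Comp_apply[OF t pp_n pp_solutions_subset[OF pp_phi u'(1)], of s] u'(2) by simp
  qed
qed

lemma ppF_product:
  assumes X: "\<And>i. i \<in> I \<Longrightarrow> X i \<in> Obj LM" and P: "P \<in> Obj LM" and pi: "\<And>i. i \<in> I \<Longrightarrow> \<pi> i \<in> Hom LM P (X i)"
    and pw: "pointwise_product I X P \<pi>"
  shows "jointly_bijective I (\<lambda>i. el ppF (X i)) (el ppF P) (\<lambda>i. act ppF (\<pi> i))"
  unfolding jointly_bijective_def ppF_Obj
proof (intro conjI ballI allI impI)
  note bij = pointwise_productD[OF pw pp_n]
  {
    fix u v assume u: "u \<in> carrier (pp_quotient R n \<phi> \<psi> P)" and v: "v \<in> carrier (pp_quotient R n \<phi> \<psi> P)"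
      and eq: "\<forall>i\<in>I. act ppF (\<pi> i) u = act ppF (\<pi> i) v"
    note u' = pp_quotient_element[OF P u] and v' = pp_quotient_element[OF P v]
    note ue = pp_solutions_subset[OF pp_phi u'(1)] and ve = pp_solutions_subset[OF pp_phi v'(1)]
    interpret Pn: group "ObjMap P n" by (rule mod_group[OF P pp_n])
    have "comp_at (\<pi> i) n (u \<otimes>\<^bsub>ObjMap P n\<^esub> inv\<^bsub>ObjMap P n\<^esub> v) \<in> pp_solutions R \<psi> (X i)" if i: "i \<in> I" for i
    proof -
      interpret p: group_hom "ObjMap P n" "ObjMap (X i) n" "comp_at (\<pi> i) n" by (rule ab_apply_hom[OF LM_comp_at[OF pi[OF i] pp_n]])
      have "pp_class n \<psi> (X i) (comp_at (\<pi> i) n u) = pp_class n \<psi> (X i) (comp_at (\<pi> i) n v)"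
        using eq i ppF_class[OF pi[OF i] u'(1)] ppF_class[OF pi[OF i] v'(1)] u'(2) v'(2) by simp
      then show ?thesis
        using pp_class_eq_iff[OF X[OF i] pp_solutions_map[OF pp_phi pi[OF i] u'(1)] pp_solutions_map[OF pp_phi pi[OF i] v'(1)]] ue ve
        by (simp add: p.hom_mult p.hom_inv)
    qed
    from pp_solutions_product[OF pp_psi P pi pw _ this]
    have "u \<otimes>\<^bsub>ObjMap P n\<^esub> inv\<^bsub>ObjMap P n\<^esub> v \<in> pp_solutions R \<psi> P" using ue ve by simp
    then show "u = v" using pp_class_eq_iff[OF P u'(1) v'(1)] u'(2) v'(2) by simp
  next
    fix z assume z: "\<forall>i\<in>I. z i \<in> carrier (pp_quotient R n \<phi> \<psi> (X i))"
    then have z': "z i \<in> pp_solutions R \<phi> (X i)" "pp_class n \<psi> (X i) (z i) = z i" if "i \<in> I" for i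
      using pp_quotient_element[OF X[OF that]] that by auto
    have "\<exists>x \<in> el P n. \<forall>i \<in> I. comp_at (\<pi> i) n x = z i"
      by (rule jointly_bijective_surj[OF bij]) (use pp_solutions_subset[OF pp_phi] z' in blast)
    then obtain x where x: "x \<in> el P n" "\<And>i. i \<in> I \<Longrightarrow> comp_at (\<pi> i) n x = z i" by blast
    have xs: "x \<in> pp_solutions R \<phi> P" by (rule pp_solutions_product[OF pp_phi P pi pw x(1)]) (use x(2) z' in auto)
    have "act ppF (\<pi> i) (pp_class n \<psi> P x) = z i" if "i \<in> I" for i
      using ppF_class[OF pi[OF that] xs] x(2)[OF that] z'(2)[OF that] by simp
    then show "\<exists>u\<in>carrier (pp_quotient R n \<phi> \<psi> P). \<forall>i\<in>I. act ppF (\<pi> i) u = z i"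
      using pp_class_closed[OF P xs] by blast
  }
qed

lemma ppF_colimit:
  assumes dir: "directed_poset natLeq I r" and diag: "poset_diagram LM I r X T"
    and cocone: "is_cocone LM I r X T L c" and pw: "pointwise_colimit I r X T L c"
  shows "elementwise_colimit I r (\<lambda>i. el ppF (X i)) (\<lambda>i j. act ppF (T i j)) (el ppF L) (\<lambda>i. act ppF (c i))"
  unfolding elementwise_colimit_def ppF_Obj
proof (intro conjI ballI impI)
  note X = LM_poset_diagramD(1)[OF diag] and T = LM_poset_diagramD(2)[OF diag]
    and L = LM_is_coconeD(1)[OF cocone] and c = LM_is_coconeD(2)[OF cocone]
    and T_c = LM_cocone_apply[OF cocone _ T]
  have rI: "i \<in> I" "j \<in> I" if "(i, j) \<in> r" for i j using directed_posetD(1)[OF dir] that by auto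
  note col = pointwise_colimitD[OF pw pp_n]
  {
    fix u assume u: "u \<in> carrier (pp_quotient R n \<phi> \<psi> L)"
    note u' = pp_quotient_element[OF L u]
    obtain i x where i: "i \<in> I" and x: "x \<in> pp_solutions R \<phi> (X i)" "comp_at (c i) n x = u"
      using pp_solutions_colimit[OF pp_phi dir diag cocone pw u'(1)] by blast
    then show "\<exists>i\<in>I. \<exists>x\<in>carrier (pp_quotient R n \<phi> \<psi> (X i)). act ppF (c i) x = u"
      using ppF_class[OF c[OF i] x(1)] u'(2) pp_class_closed[OF X[OF i] x(1)] by auto
  next
    fix i u v assume i: "i \<in> I" and u: "u \<in> carrier (pp_quotient R n \<phi> \<psi> (X i))" and v: "v \<in> carrier (pp_quotient R n \<phi> \<psi> (X i))"
      and eq: "act ppF (c i) u = act ppF (c i) v"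
    note u' = pp_quotient_element[OF X[OF i] u] and v' = pp_quotient_element[OF X[OF i] v]
    note ue = pp_solutions_subset[OF pp_phi u'(1)] and ve = pp_solutions_subset[OF pp_phi v'(1)]
    interpret Xn: group "ObjMap (X i) n" by (rule mod_group[OF X[OF i] pp_n])
    interpret ci: group_hom "ObjMap (X i) n" "ObjMap L n" "comp_at (c i) n" by (rule ab_apply_hom[OF LM_comp_at[OF c[OF i] pp_n]])
    let ?w = "u \<otimes>\<^bsub>ObjMap (X i) n\<^esub> inv\<^bsub>ObjMap (X i) n\<^esub> v"
    have w: "?w \<in> el (X i) n" using ue ve by simp
    have "pp_class n \<psi> L (comp_at (c i) n u) = pp_class n \<psi> L (comp_at (c i) n v)"
      using eq ppF_class[OF c[OF i] u'(1)] ppF_class[OF c[OF i] v'(1)] u'(2) v'(2) by simp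
    then have "comp_at (c i) n ?w \<in> pp_solutions R \<psi> L"
      using pp_class_eq_iff[OF L pp_solutions_map[OF pp_phi c[OF i] u'(1)] pp_solutions_map[OF pp_phi c[OF i] v'(1)]] ue ve
      by (simp add: ci.hom_mult ci.hom_inv)
    from pp_solutions_colimit[OF pp_psi dir diag cocone pw this]
    obtain j y where j: "j \<in> I" and y: "y \<in> pp_solutions R \<psi> (X j)" "comp_at (c j) n y = comp_at (c i) n ?w" by blast
    have ye: "y \<in> el (X j) n" by (rule pp_solutions_subset[OF pp_psi y(1)])
    obtain b where b: "b \<in> I" "(i, b) \<in> r" "(j, b) \<in> r" using directed_poset_two[OF dir i j] by blast
    have "comp_at (c b) n (comp_at (T i b) n ?w) = comp_at (c b) n (comp_at (T j b) n y)"
      using T_c[OF b(2) b(2) pp_n w] T_c[OF b(3) b(3) pp_n ye] y(2) by simp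
    then obtain d where d: "(b, d) \<in> r" "comp_at (T b d) n (comp_at (T i b) n ?w) = comp_at (T b d) n (comp_at (T j b) n y)"
      using elementwise_colimit_eq[OF col b(1) comp_at_closed[OF T[OF b(2)] pp_n w] comp_at_closed[OF T[OF b(3)] pp_n ye]] by blast
    have id: "(i, d) \<in> r" using transD[OF directed_posetD(3)[OF dir] b(2) d(1)] .
    have "comp_at (T i d) n ?w = comp_at (T b d) n (comp_at (T i b) n ?w)"
      unfolding LM_poset_diagramD(4)[OF diag b(2) d(1)] by (rule LM_Comp_apply[OF T[OF b(2)] pp_n w])
    then have Tw: "comp_at (T i d) n ?w \<in> pp_solutions R \<psi> (X d)"
      using d(2) pp_solutions_map[OF pp_psi T[OF d(1)] pp_solutions_map[OF pp_psi T[OF b(3)] y(1)]] by simp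
    interpret Ti: group_hom "ObjMap (X i) n" "ObjMap (X d) n" "comp_at (T i d) n" by (rule ab_apply_hom[OF LM_comp_at[OF T[OF id] pp_n]])
    have "pp_class n \<psi> (X d) (comp_at (T i d) n u) = pp_class n \<psi> (X d) (comp_at (T i d) n v)"
      using pp_class_eq_iff[OF X[OF rI(2)[OF d(1)]] pp_solutions_map[OF pp_phi T[OF id] u'(1)] pp_solutions_map[OF pp_phi T[OF id] v'(1)]] ue ve Tw
      by (simp add: Ti.hom_mult Ti.hom_inv)
    then show "\<exists>j. (i, j) \<in> r \<and> act ppF (T i j) u = act ppF (T i j) v"
      using id ppF_class[OF T[OF id] u'(1)] ppF_class[OF T[OF id] v'(1)] u'(2) v'(2) by auto
  }
qed

lemma LM_full: "LM = full_subcat LM (\<lambda>_. True)"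
  by (simp add: full_subcat_def)

theorem ppF_in_Fun: "ppF \<in> Fun natLeq LM"
  unfolding Fun_def
proof (intro CollectI conjI ppF_functor)
  show "preserves_products |UNIV :: 'u set| LM AbU ppF"
    unfolding preserves_products_def
  proof (intro allI impI)
    fix I :: "'u set" and X P \<pi>
    assume I: "|I| <o |UNIV :: 'u set|" and X: "\<forall>i\<in>I. X i \<in> Obj LM" and prod: "is_product LM I X P \<pi>"
    have I: "small I" using I by (simp add: small_def)
    have X: "X i \<in> Obj LM" if "i \<in> I" for i using X that by blast
    note P = is_productD[OF prod]
    have pw: "pointwise_product I X P \<pi>"
      using is_product_iff_pointwise[of I X "\<lambda>_. True" P \<pi>, OF I X _ P(1) _ P(2)] prod by (simp add: LM_full[symmetric])
    show "is_product AbU I (\<lambda>i. ObjMap ppF (X i)) (ObjMap ppF P) (\<lambda>i. ArrMap ppF (\<pi> i))"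
      by (rule ab_is_productI[OF is_functorD(1)[OF ppF_functor P(1)] ppF_Arr[OF P(2)] ppF_product[OF X P pw]])
  qed
  show "preserves_directed_colimits |UNIV :: 'u set| natLeq LM AbU ppF"
    unfolding preserves_directed_colimits_def
  proof (intro allI impI)
    fix I :: "'u set" and r X T L c
    assume I: "|I| <o |UNIV :: 'u set|" and dir: "directed_poset natLeq I r" and diag: "poset_diagram LM I r X T"
      and colim: "is_colimit LM I r X T L c"
    have I: "small I" using I by (simp add: small_def)
    have cocone: "is_cocone LM I r X T L c" using colim by (simp add: is_colimit_def)
    have pw: "pointwise_colimit I r X T L c"
      using is_colimit_iff_pointwise[of I r X T "\<lambda>_. True" L c, OF I dir diag _ cocone] colim by (simp add: LM_full[symmetric])
    have "is_cocone AbU I r (\<lambda>i. ObjMap ppF (X i)) (\<lambda>i j. ArrMap ppF (T i j)) (ObjMap ppF L) (\<lambda>i. ArrMap ppF (c i))"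
      unfolding is_cocone_def
    proof (intro conjI ballI, goal_cases)
      case 1 show ?case by (rule is_functorD(1)[OF ppF_functor LM_is_coconeD(1)[OF cocone]])
    next
      case (2 i) then show ?case by (rule ppF_Arr[OF LM_is_coconeD(2)[OF cocone]])
    next
      case (3 p)
      obtain i j where p: "p = (i, j)" by (cases p)
      then have ij: "(i, j) \<in> r" using 3 by simp
      then have j: "j \<in> I" using directed_posetD(1)[OF dir] by blast
      note T = LM_poset_diagramD(2)[OF diag ij] and c = LM_is_coconeD(2)[OF cocone j]
      have "ArrMap ppF (c i) = Comp AbU (ArrMap ppF (c j)) (ArrMap ppF (T i j))"
        unfolding LM_is_coconeD(3)[OF cocone ij, symmetric]
        by (rule is_functorD(4)[OF ppF_functor LM_Hom_Obj[OF T] LM_Hom_Obj(2)[OF c] T c])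
      then show ?case by (simp add: p)
    qed
    from ab_is_colimitI[OF dir functor_poset_diagram[OF category_LM ppF_functor diag] this ppF_colimit[OF dir diag cocone pw]]
    show "is_colimit AbU I r (\<lambda>i. ObjMap ppF (X i)) (\<lambda>i j. ArrMap ppF (T i j)) (ObjMap ppF L) (\<lambda>i. ArrMap ppF (c i))" .
  qed
qed

end

end

context small_additive_category_with_products
begin

section \<open>Restriction to product-preserving modules\<close>

text \<open>By the closure properties above, products and \<open>lam\<close>-directed colimits of product-preserving modules are pointwise, hence are also
  products and directed colimits of modules.\<close>

theorem restrict_functor_in_Fun:
  fixes G :: "('o, 'a, 'u) lmod_functor"
  assumes G: "G \<in> Fun natLeq LM"
  shows "restrict_functor G NM \<in> Fun lam NM"
proof -
  let ?G = "restrict_functor G NM"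
  have GF: "is_functor LM AbU G" using G by (simp add: Fun_def)
  have Obj_eq: "ObjMap ?G X = ObjMap G X" if "X \<in> Obj NM" for X using that by (simp add: restrict_functor_def)
  have Arr_eq: "ArrMap ?G t = ArrMap G t" if "t \<in> Hom NM X Y" for t X Y
    using that by (simp add: restrict_functor_def Hom_def)
  have fn: "is_functor NM AbU ?G"
    unfolding is_functor_def
  proof (intro conjI ballI)
    fix X assume X: "X \<in> Obj NM"
    show "ObjMap ?G X \<in> Obj AbU" using Obj_eq[OF X] is_functorD(1)[OF GF NM_Obj_LM[OF X]] by simp
    show "ArrMap ?G (Ident NM X) = Ident AbU (ObjMap ?G X)"
      using Arr_eq[OF category.Ident_closed[OF category_NM X]] is_functorD(3)[OF GF NM_Obj_LM[OF X]] Obj_eq[OF X]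
      by (simp add: NM_Ident)
    fix Y t assume Y: "Y \<in> Obj NM" and t: "t \<in> Hom NM X Y"
    have tL: "t \<in> Hom LM X Y" using t NM_Hom[OF X Y] by simp
    show "ArrMap ?G t \<in> Hom AbU (ObjMap ?G X) (ObjMap ?G Y)"
      using Arr_eq[OF t] Obj_eq[OF X] Obj_eq[OF Y] functor_Arr[OF category_LM GF tL] by simp
    fix Z s assume Z: "Z \<in> Obj NM" and s: "s \<in> Hom NM Y Z"
    have sL: "s \<in> Hom LM Y Z" using s NM_Hom[OF Y Z] by simp
    show "ArrMap ?G (Comp NM s t) = Comp AbU (ArrMap ?G s) (ArrMap ?G t)"
      using Arr_eq[OF category.Comp_closed[OF category_NM t s]] Arr_eq[OF t] Arr_eq[OF s]
        is_functorD(4)[OF GF LM_Hom_Obj[OF tL] LM_Hom_Obj(2)[OF sL] tL sL] by (simp add: NM_Comp)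
  qed
  moreover have "preserves_products |UNIV :: 'u set| NM AbU ?G"
    unfolding preserves_products_def
  proof (intro allI impI)
    fix I :: "'u set" and X P \<pi>
    assume I: "|I| <o |UNIV :: 'u set|" and X: "\<forall>i\<in>I. X i \<in> Obj NM" and prod: "is_product NM I X P \<pi>"
    have sI: "small I" using I by (simp add: small_def)
    have X: "X i \<in> Obj NM" if "i \<in> I" for i using X that by blast
    note XL = NM_Obj_LM[OF X]
    have P: "P \<in> Obj NM" and pi: "\<pi> i \<in> Hom NM P (X i)" if "i \<in> I" for i
      using is_productD[OF prod] that by auto
    have P: "P \<in> Obj NM" by (rule is_productD(1)[OF prod])
    have piL: "\<pi> i \<in> Hom LM P (X i)" if "i \<in> I" for i using pi[OF that] NM_Hom[OF P X[OF that]] by simp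
    have "pointwise_product I X P \<pi>"
    proof (rule is_product_iff_pointwise[where Q = "preserves_products lam R AbU", THEN iffD1,
          OF sI XL NM_preserves_products[OF X] NM_Obj_LM[OF P] NM_preserves_products[OF P] piL])
      fix P' \<rho> assume "P' \<in> Obj LM" "\<And>i. i \<in> I \<Longrightarrow> \<rho> i \<in> Hom LM P' (X i)" "pointwise_product I X P' \<rho>"
      then show "preserves_products lam R AbU P'" by (intro NM_preserves_products NM_closed_products[OF X])
    qed (use prod in \<open>simp_all add: NM_eq\<close>)
    then have prodL: "is_product LM I X P \<pi>"
      using is_product_if_pointwise[where Q = "\<lambda>_. True", OF NM_Obj_LM[OF P] _ piL] by (simp add: full_subcat_def)
    have "preserves_products |UNIV :: 'u set| LM AbU G" using G by (simp add: Fun_def)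
    from this[unfolded preserves_products_def, rule_format, OF I XL prodL]
    have *: "is_product AbU I (\<lambda>i. ObjMap G (X i)) (ObjMap G P) (\<lambda>i. ArrMap G (\<pi> i))" .
    show "is_product AbU I (\<lambda>i. ObjMap ?G (X i)) (ObjMap ?G P) (\<lambda>i. ArrMap ?G (\<pi> i))"
      unfolding Obj_eq[OF P] by (rule is_product_cong[THEN iffD2, OF _ _ *]) (simp_all add: Obj_eq[OF X] Arr_eq[OF pi])
  qed
  moreover have "preserves_directed_colimits |UNIV :: 'u set| lam NM AbU ?G"
    unfolding preserves_directed_colimits_def
  proof (intro allI impI)
    fix I :: "'u set" and r X T L c
    assume I: "|I| <o |UNIV :: 'u set|" and dir: "directed_poset lam I r" and diag: "poset_diagram NM I r X T"
      and colim: "is_colimit NM I r X T L c"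
    have sI: "small I" using I by (simp add: small_def)
    note rI = directed_posetD(1)[OF dir] and dirN = directed_lam_natLeq[OF dir]
    have X: "X i \<in> Obj NM" if "i \<in> I" for i using diag that by (simp add: poset_diagram_def)
    have coconeN: "is_cocone NM I r X T L c" using colim by (simp add: is_colimit_def)
    then have L: "L \<in> Obj NM" and cN: "\<And>i. i \<in> I \<Longrightarrow> c i \<in> Hom NM (X i) L" by (simp_all add: is_cocone_def)
    have cocone: "is_cocone LM I r X T L c"
      using coconeN is_cocone_full_subcat[of I "preserves_products lam R AbU" X, OF NM_preserves_products[OF X]] by (simp add: NM_eq)
    have TN: "T i j \<in> Hom NM (X i) (X j)" if "(i, j) \<in> r" for i j using diag that by (auto simp: poset_diagram_def)
    have diagL: "poset_diagram LM I r X T" using diag NM_poset_diagram_iff[of I X r T, OF X rI] by simp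
    have pw: "pointwise_colimit I r X T L c"
    proof (rule is_colimit_iff_pointwise[where Q = "preserves_products lam R AbU", THEN iffD1,
          OF sI dirN diagL NM_preserves_products[OF X] cocone NM_preserves_products[OF L]])
      show "preserves_products lam R AbU L'" if "is_cocone LM I r X T L' d" "pointwise_colimit I r X T L' d" for L' d
        by (rule NM_preserves_products[OF NM_closed_colimits[OF dir diagL X that]])
    qed (use colim in \<open>simp_all add: NM_eq\<close>)
    have colimL: "is_colimit LM I r X T L c"
      using is_colimit_if_pointwise[where Q = "\<lambda>_. True", OF dirN diagL _ cocone _ pw] by (simp add: full_subcat_def)
    have "preserves_directed_colimits |UNIV :: 'u set| natLeq LM AbU G" using G by (simp add: Fun_def)
    from this[unfolded preserves_directed_colimits_def, rule_format, OF I dirN diagL colimL]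
    have *: "is_colimit AbU I r (\<lambda>i. ObjMap G (X i)) (\<lambda>i j. ArrMap G (T i j)) (ObjMap G L) (\<lambda>i. ArrMap G (c i))" .
    have "is_cocone AbU I r (\<lambda>i. ObjMap ?G (X i)) (\<lambda>i j. ArrMap ?G (T i j)) q d
        \<longleftrightarrow> is_cocone AbU I r (\<lambda>i. ObjMap G (X i)) (\<lambda>i j. ArrMap G (T i j)) q d" for q d
      using Obj_eq[OF X] Arr_eq[OF TN] by (auto simp: is_cocone_def)
    moreover have "is_cocone AbU I r (\<lambda>i. ObjMap G (X i)) (\<lambda>i j. ArrMap G (T i j)) (ObjMap ?G L) (\<lambda>i. ArrMap ?G (c i))
        \<longleftrightarrow> is_cocone AbU I r (\<lambda>i. ObjMap G (X i)) (\<lambda>i j. ArrMap G (T i j)) (ObjMap G L) (\<lambda>i. ArrMap G (c i))"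
      using Obj_eq[OF L] Arr_eq[OF cN] rI by (fastforce simp: is_cocone_def)
    ultimately show "is_colimit AbU I r (\<lambda>i. ObjMap ?G (X i)) (\<lambda>i j. ArrMap ?G (T i j)) (ObjMap ?G L) (\<lambda>i. ArrMap ?G (c i))"
      using * Arr_eq[OF cN] Obj_eq[OF L] by (simp add: is_colimit_def)
  qed
  ultimately show ?thesis by (simp add: Fun_def)
qed

section \<open>From presentations to pp-pairs\<close>

text \<open>The first solution set is that of \<open>f x = 0 y\<close>. For the second, the two equations \<open>x = h y\<close> and \<open>0 = g y\<close> are combined
  into one by means of a biproduct of \<open>n\<close> and \<open>m'\<close> with injections \<open>i\<close> and \<open>j\<close>, namely \<open>i x = (i h + j g) y\<close>.\<close>

lemma presentation_pp_pair:
  assumes f: "f \<in> Hom R n m" and g: "g \<in> Hom R n' m'" and h: "h \<in> Hom R n' n"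
    and e: "e \<in> Hom R m' m" "Comp R f h = Comp R e g"
  shows "\<exists>\<phi> \<psi>. pp_pair TYPE('u) R n \<phi> \<psi> \<and> (\<forall>M \<in> Obj LM.
    pp_solutions R \<phi> M = {x \<in> el M n. act M f x = \<one>\<^bsub>ObjMap M m\<^esub>} \<and>
    pp_solutions R \<psi> M = {x \<in> el M n. \<exists>y \<in> el M n'. act M g y = \<one>\<^bsub>ObjMap M m'\<^esub> \<and> act M h y = x})"
proof -
  note n = Hom_Obj(1)[OF f] and m = Hom_Obj(2)[OF f] and n' = Hom_Obj(1)[OF g] and m' = Hom_Obj(2)[OF g]
  obtain s i j p q where "is_biproduct R n m' s i j p q" using ex_biproduct[OF n m'] by blast
  then have i: "i \<in> Hom R n s" and j: "j \<in> Hom R m' s" and p: "p \<in> Hom R s n" and q: "q \<in> Hom R s m'"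
    and pi: "Comp R p i = Ident R n" and qj: "Comp R q j = Ident R m'"
    and qi: "Comp R q i = \<one>\<^bsub>HomGrp R n m'\<^esub>" and pj: "Comp R p j = \<one>\<^bsub>HomGrp R m' n\<^esub>"
    by (auto simp: is_biproduct_def)
  define z where "z = \<one>\<^bsub>HomGrp R n m\<^esub>"
  have z: "z \<in> Hom R n m" unfolding z_def by (rule HomGrp_one_closed[OF n m])
  define b where "b = Comp R i h \<otimes>\<^bsub>HomGrp R n' s\<^esub> Comp R j g"
  note ih = Comp_closed[OF h i] and jg = Comp_closed[OF g j]
  have b: "b \<in> Hom R n' s" unfolding b_def by (rule HomGrp_mult_closed[OF ih jg])
  have phi: "pp_formula R n (f, z)" and psi: "pp_formula R n (i, b)"
    using f z i b n m n' Hom_Obj(2)[OF i] by (auto simp: pp_formula_def)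
  have sol: "pp_solutions R (f, z) M = {x \<in> el M n. act M f x = \<one>\<^bsub>ObjMap M m\<^esub>} \<and>
    pp_solutions R (i, b) M = {x \<in> el M n. \<exists>y \<in> el M n'. act M g y = \<one>\<^bsub>ObjMap M m'\<^esub> \<and> act M h y = x}"
    if M: "M \<in> Obj LM" for M
  proof
    have "act M z y = \<one>\<^bsub>ObjMap M m\<^esub>" if "y \<in> el M n" for y unfolding z_def by (rule act_zero[OF M n m that])
    then show "pp_solutions R (f, z) M = {x \<in> el M n. act M f x = \<one>\<^bsub>ObjMap M m\<^esub>}"
      using f z mod_one_closed[OF M n] by (auto simp: pp_solutions_def Hom_def)
    interpret Mn: group "ObjMap M n" by (rule mod_group[OF M n])
    interpret Mm: group "ObjMap M m'" by (rule mod_group[OF M m'])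
    interpret Ms: group "ObjMap M s" by (rule mod_group[OF M Hom_Obj(2)[OF i]])
    have iff: "act M i x = act M b y \<longleftrightarrow> act M g y = \<one>\<^bsub>ObjMap M m'\<^esub> \<and> act M h y = x"
      if x: "x \<in> el M n" and y: "y \<in> el M n'" for x y
    proof -
      note hy = act_closed[OF M h y] and gy = act_closed[OF M g y]
      note ihy = act_closed[OF M i hy] and jgy = act_closed[OF M j gy] and ix = act_closed[OF M i x]
      have b_y: "act M b y = act M i (act M h y) \<otimes>\<^bsub>ObjMap M s\<^esub> act M j (act M g y)"
        unfolding b_def act_add[OF M ih jg y] act_Comp[OF M h i y] act_Comp[OF M g j y] ..
      have pi_x: "act M p (act M i v) = v" "act M q (act M i v) = \<one>\<^bsub>ObjMap M m'\<^esub>" if "v \<in> el M n" for v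
        using act_Comp[OF M i p that] act_Comp[OF M i q that] pi qi act_Ident[OF M n that] act_zero[OF M n m' that] by auto
      have pj_w: "act M p (act M j w) = \<one>\<^bsub>ObjMap M n\<^esub>" "act M q (act M j w) = w" if "w \<in> el M m'" for w
        using act_Comp[OF M j p that] act_Comp[OF M j q that] pj qj act_Ident[OF M m' that] act_zero[OF M m' n that] by auto
      have pb: "act M p (act M b y) = act M h y" and qb: "act M q (act M b y) = act M g y"
        unfolding b_y act_mult[OF M p ihy jgy] act_mult[OF M q ihy jgy] pi_x[OF hy] pj_w[OF gy] using hy gy by simp_all
      show ?thesis
      proof
        assume eq: "act M i x = act M b y"
        show "act M g y = \<one>\<^bsub>ObjMap M m'\<^esub> \<and> act M h y = x" using pb qb pi_x[OF x] unfolding eq[symmetric] by simp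
      next
        assume "act M g y = \<one>\<^bsub>ObjMap M m'\<^esub> \<and> act M h y = x"
        then show "act M i x = act M b y" unfolding b_y using act_one[OF M j] ix by simp
      qed
    qed
    have D: "Dom R i = n" "Dom R b = n'" using i b by (auto simp: Hom_def)
    show "pp_solutions R (i, b) M = {x \<in> el M n. \<exists>y \<in> el M n'. act M g y = \<one>\<^bsub>ObjMap M m'\<^esub> \<and> act M h y = x}"
      unfolding pp_solutions_def fst_conv snd_conv D using iff by blast
  qed
  have "pp_solutions R (i, b) M \<subseteq> pp_solutions R (f, z) M" if M: "M \<in> Obj LM" for M
  proof
    fix x assume "x \<in> pp_solutions R (i, b) M"
    then obtain y where y: "y \<in> el M n'" "act M g y = \<one>\<^bsub>ObjMap M m'\<^esub>" "act M h y = x" and x: "x \<in> el M n" using sol[OF M] by auto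
    have "act M f x = \<one>\<^bsub>ObjMap M m\<^esub>"
      using act_Comp[OF M h f y(1)] act_Comp[OF M g e(1) y(1)] e(2) y(2,3) act_one[OF M e(1)] by simp
    then show "x \<in> pp_solutions R (f, z) M" using x sol[OF M] by simp
  qed
  then have "pp_pair TYPE('u) R n (f, z) (i, b)" using phi psi by (simp add: pp_pair_def)
  then show ?thesis using sol by blast
qed

text \<open>Both \<open>F X\<close> and the pp quotient are quotients of the solutions of \<open>\<phi>\<close> in \<open>X\<close> by the solutions of \<open>\<psi>\<close>.\<close>

theorem Fun_iso_pp_functor:
  fixes F :: "('o, 'a, 'u) lmod_functor"
  assumes F: "F \<in> Fun lam NM"
  shows "\<exists>n \<phi> \<psi>. pp_pair TYPE('u) R n \<phi> \<psi> \<and> nat_isomorphic NM Ab F (restrict_functor (pp_functor R n \<phi> \<psi>) NM)"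
proof -
  obtain n m n' m' f g h \<theta> where f: "f \<in> Hom R n m" and g: "g \<in> Hom R n' m'" and h: "h \<in> Hom R n' n"
    and ex_e: "\<exists>e \<in> Hom R m' m. Comp R f h = Comp R e g"
    and pres: "\<forall>X \<in> Obj NM. \<theta> X \<in> hom ((ObjMap X n)\<lparr>carrier := {x \<in> el X n. act X f x = \<one>\<^bsub>ObjMap X m\<^esub>}\<rparr>) (ObjMap F X) \<and>
      \<theta> X ` {x \<in> el X n. act X f x = \<one>\<^bsub>ObjMap X m\<^esub>} = el F X \<and>
      (\<forall>x \<in> el X n. act X f x = \<one>\<^bsub>ObjMap X m\<^esub> \<longrightarrow>
        (\<theta> X x = \<one>\<^bsub>ObjMap F X\<^esub> \<longleftrightarrow> (\<exists>y \<in> el X n'. act X g y = \<one>\<^bsub>ObjMap X m'\<^esub> \<and> act X h y = x)))"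
    and nat: "\<forall>X \<in> Obj NM. \<forall>Y \<in> Obj NM. \<forall>t \<in> Hom LM X Y. \<forall>x \<in> el X n. act X f x = \<one>\<^bsub>ObjMap X m\<^esub> \<longrightarrow>
      \<theta> Y (comp_at t n x) = act F t (\<theta> X x)"
    using Fun_presentation[OF F] by (elim exE conjE) blast
  obtain e where e: "e \<in> Hom R m' m" "Comp R f h = Comp R e g" using ex_e by blast
  obtain \<phi> \<psi> where pp: "pp_pair TYPE('u) R n \<phi> \<psi>"
    and sol: "\<And>M. M \<in> Obj LM \<Longrightarrow> pp_solutions R \<phi> M = {x \<in> el M n. act M f x = \<one>\<^bsub>ObjMap M m\<^esub>}"
      "\<And>M. M \<in> Obj LM \<Longrightarrow> pp_solutions R \<psi> M = {x \<in> el M n. \<exists>y \<in> el M n'. act M g y = \<one>\<^bsub>ObjMap M m'\<^esub> \<and> act M h y = x}"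
    using presentation_pp_pair[OF f g h e] by blast
  let ?P = "pp_functor R n \<phi> \<psi> :: ('o, 'a, 'u) lmod_functor"
  let ?G = "restrict_functor ?P NM"
  have "\<forall>X \<in> Obj NM. \<exists>k. is_iso Ab (ObjMap F X) (ObjMap ?P X) k \<and> (\<forall>x \<in> pp_solutions R \<phi> X. amap k (\<theta> X x) = pp_class n \<psi> X x)"
  proof
    fix X assume X: "X \<in> Obj NM"
    note XL = NM_Obj_LM[OF X]
    let ?A = "(ObjMap X n)\<lparr>carrier := pp_solutions R \<phi> X\<rparr>"
    have X_pres: "\<theta> X \<in> hom ?A (ObjMap F X)" "\<theta> X ` pp_solutions R \<phi> X = el F X"
      "\<And>x. x \<in> pp_solutions R \<phi> X \<Longrightarrow> \<theta> X x = \<one>\<^bsub>ObjMap F X\<^esub> \<longleftrightarrow> x \<in> pp_solutions R \<psi> X"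
      using pres X unfolding sol[OF XL] by auto
    have "\<exists>k. is_iso Ab (ObjMap F X) (ObjMap ?P X) k \<and> (\<forall>x \<in> carrier ?A. amap k (\<theta> X x) = pp_class n \<psi> X x)"
    proof (rule iso_of_common_quotients[OF comm_group_is_group[OF pp_groups(1)[OF pp XL]] F_Obj[OF F X]])
      show "ObjMap ?P X \<in> Obj Ab" using pp_quotient_Obj[OF pp XL] by (simp add: ppF_Obj[OF pp])
    qed (use X_pres pp_class_quotient[OF pp XL] in \<open>simp_all add: ppF_Obj[OF pp]\<close>)
    then show "\<exists>k. is_iso Ab (ObjMap F X) (ObjMap ?P X) k \<and> (\<forall>x \<in> pp_solutions R \<phi> X. amap k (\<theta> X x) = pp_class n \<psi> X x)"
      by simp
  qed
  from bchoice[OF this] obtain k where k_all: "\<forall>X \<in> Obj NM. is_iso Ab (ObjMap F X) (ObjMap ?P X) (k X) \<and>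
      (\<forall>x \<in> pp_solutions R \<phi> X. amap (k X) (\<theta> X x) = pp_class n \<psi> X x)" by blast
  have k_iso: "is_iso Ab (ObjMap F X) (ObjMap ?P X) (k X)"
    and k_theta: "x \<in> pp_solutions R \<phi> X \<Longrightarrow> amap (k X) (\<theta> X x) = pp_class n \<psi> X x" if "X \<in> Obj NM" for X x
    using k_all that by auto
  have Obj_eq: "ObjMap ?G X = ObjMap ?P X" if "X \<in> Obj NM" for X using that by (simp add: restrict_functor_def)
  have k_Hom: "k X \<in> Hom AbU (ObjMap F X) (ObjMap ?P X)" if "X \<in> Obj NM" for X using k_iso[OF that] by (simp add: is_iso_def)
  have "nat_trans NM AbU F ?G k"
    unfolding nat_trans_def
  proof (intro conjI ballI)
    fix X assume X: "X \<in> Obj NM"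
    show "k X \<in> Hom AbU (ObjMap F X) (ObjMap ?G X)" using k_Hom[OF X] Obj_eq[OF X] by simp
    fix Y t assume Y: "Y \<in> Obj NM" and t: "t \<in> Hom NM X Y"
    have tL: "t \<in> Hom LM X Y" using t NM_Hom[OF X Y] by simp
    have Gt: "ArrMap ?G t = ArrMap ?P t" using t by (simp add: restrict_functor_def Hom_def)
    note XL = NM_Obj_LM[OF X] and Ft = F_Arr[OF F X Y tL] and Pt = ppF_Arr[OF pp tL]
    have "Comp AbU (k Y) (ArrMap F t) = Comp AbU (ArrMap ?P t) (k X)"
    proof (rule ab_Hom_eqI[OF ab_Comp_in_Hom[OF Ft k_Hom[OF Y]] ab_Comp_in_Hom[OF k_Hom[OF X] Pt]])
      fix z assume z: "z \<in> el F X"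
      have "z \<in> \<theta> X ` pp_solutions R \<phi> X" using z pres X unfolding sol[OF XL] by auto
      then obtain x where x: "x \<in> pp_solutions R \<phi> X" "z = \<theta> X x" by blast
      have "\<theta> Y (comp_at t n x) = act F t z" using nat X Y tL x unfolding sol[OF XL] by auto
      moreover have "comp_at t n x \<in> pp_solutions R \<phi> Y" by (rule pp_solutions_map[OF pp_phi[OF pp] tL x(1)])
      ultimately show "amap (Comp AbU (k Y) (ArrMap F t)) z = amap (Comp AbU (ArrMap ?P t) (k X)) z"
        using ab_Comp_apply[OF Ft z, of "k Y"] ab_Comp_apply[OF k_Hom[OF X] z, of "ArrMap ?P t"]
          k_theta[OF X x(1)] k_theta[OF Y, of "comp_at t n x"] ppF_class[OF pp tL x(1)] x(2) by simp
    qed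
    then show "Comp AbU (k Y) (ArrMap F t) = Comp AbU (ArrMap ?G t) (k X)" using Gt by simp
  qed
  then have "nat_isomorphic NM Ab F ?G"
    unfolding nat_isomorphic_def using k_iso Obj_eq by auto
  then show ?thesis using pp by blast
qed

end

theorem corollary2p20:
  fixes R :: "('o, 'a) additive_precat" and lam :: "'u rel"
  assumes "inaccessible |UNIV :: 'u set|"
    and "Cinfinite lam" and "regularCard lam" and "lam <o |UNIV :: 'u set|"
    and "additive_category R"
    and "|Obj R| <o |UNIV :: 'u set|" and "|Arr R| <o |UNIV :: 'u set|"
    and "has_products lam R"
  shows "(\<forall>F :: ('o, 'a, 'u) lmod_functor \<in> Fun lam (product_preserving_modules lam R).
            \<exists>G \<in> Fun natLeq (left_modules R).
              nat_isomorphic (product_preserving_modules lam R) Ab F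
                (restrict_functor G (product_preserving_modules lam R))) \<and>
         (\<forall>G :: ('o, 'a, 'u) lmod_functor \<in> Fun natLeq (left_modules R).
            restrict_functor G (product_preserving_modules lam R)
              \<in> Fun lam (product_preserving_modules lam R)) \<and>
         (\<forall>F :: ('o, 'a, 'u) lmod_functor \<in> Fun lam (product_preserving_modules lam R).
            \<exists>n \<phi> \<psi>. pp_pair TYPE('u) R n \<phi> \<psi> \<and>
              nat_isomorphic (product_preserving_modules lam R) Ab F
                (restrict_functor (pp_functor R n \<phi> \<psi>) (product_preserving_modules lam R)))"
proof -
  have U: "universe TYPE('u)" by (rule universe.intro[OF assms(1)])
  interpret small_additive_category_with_products "TYPE('u)" R lam
    by (intro small_additive_category_with_products.intro small_additive_category.intro
        small_additive_category_axioms.intro small_additive_category_with_products_axioms.intro U assms)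
      (use assms(6,7) in \<open>simp_all add: universe.small_def[OF U]\<close>)
  have presented: "\<forall>F :: ('o, 'a, 'u) lmod_functor \<in> Fun lam NM. \<exists>n \<phi> \<psi>. pp_pair TYPE('u) R n \<phi> \<psi> \<and>
      nat_isomorphic NM Ab F (restrict_functor (pp_functor R n \<phi> \<psi>) NM)"
    using Fun_iso_pp_functor by blast
  moreover have "\<forall>F :: ('o, 'a, 'u) lmod_functor \<in> Fun lam NM. \<exists>G \<in> Fun natLeq LM.
      nat_isomorphic NM Ab F (restrict_functor G NM)"
    using presented ppF_in_Fun by blast
  moreover have "\<forall>G :: ('o, 'a, 'u) lmod_functor \<in> Fun natLeq LM. restrict_functor G NM \<in> Fun lam NM"
    using restrict_functor_in_Fun by blast
  ultimately show ?thesis by blast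
qed

end
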